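(* Let $\mathbb{G}$ be a homogeneous group of homogeneous dimension $Q$, let $|\cdot|$ be any homogeneous quasi-norm on $\mathbb{G}$, and let $R>0$. Then for all complex-valued functions $f\in C_{0}^{\infty}(B(0,R)\setminus\{0\})$, $$\int_{B(0,R)}\frac{|f(x)|^{Q}}{|x|^{Q}}\,dx\leq Q^{Q}\int_{B(0,R)}\left|(\log|x|)\,\mathcal{R}f(x)\right|^{Q}dx,$$ where the constant $Q^{Q}$ is optimal (it cannot be replaced by a smaller constant valid for all such $f$).
   Context: A homogeneous group $\mathbb{G}$ is a connected simply connected Lie group whose Lie algebra $\mathfrak{g}$ is equipped with a family of dilations $D_{\lambda}=\mathrm{Exp}(A\ln\lambda)=\sum_{k\ge 0}\frac{1}{k!}(\ln(\lambda)A)^{k}$, $\lambda>0$, where $A$ is a diagonalisable linear operator on $\mathfrak{g}$ with positive eigenvalues and each $D_{\lambda}$ is a Lie algebra morphism. Such a group is nilpotent, the exponential map $\mathfrak{g}\to\mathbb{G}$ is a global diffeomorphism, and the dilations are transported to $\mathbb{G}$ via it; write $\lambda x:=D_{\lambda}x$ for $x\in\mathbb{G}$. The unit element of $\mathbb{G}$ is denoted $0$. The homogeneous dimension is $Q=\mathrm{Tr}\,A$, with the convention that $Q\geq n=\dim\mathbb{G}$ (in particular $Q\ge 1$); $dx$ denotes Haar measure. A homogeneous quasi-norm is a continuous function $|\cdot|:\mathbb{G}\to[0,\infty)$ with $|x^{-1}|=|x|$, $|\lambda x|=\lambda|x|$ for all $x\in\mathbb{G}$, $\lambda>0$, and $|x|=0$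 if and only if $x=0$. $B(0,R)=\{x\in\mathbb{G}:|x|<R\}$ is the quasi-ball with respect to $|\cdot|$. The radial operator $\mathcal{R}=\frac{d}{d|x|}$ is defined by $\mathcal{R}f(x)=\frac{d}{dr}f(D_{r}y)\big|_{r=|x|}$, where $y=D_{1/|x|}x$ (so $|y|=1$). *)

theory Defs
  imports "HOL-Analysis.Analysis"
begin

section \<open>Smooth maps between Euclidean spaces\<close>

text \<open>The definitions below are meant for open sets \<open>S\<close>.\<close>

primrec C_k_on :: "nat \<Rightarrow> ('a::euclidean_space \<Rightarrow> 'b::real_normed_vector) \<Rightarrow> 'a set \<Rightarrow> bool" where
  "C_k_on 0 f S \<longleftrightarrow> continuous_on S f"
| "C_k_on (Suc k) f S \<longleftrightarrow>
     (\<forall>x\<in>S. f differentiable (at x)) \<and> (\<forall>v. C_k_on k (\<lambda>x. frechet_derivative f (at x) v) S)"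

definition smooth_on :: "('a::euclidean_space \<Rightarrow> 'b::real_normed_vector) \<Rightarrow> 'a set \<Rightarrow> bool" where
  "smooth_on f S \<longleftrightarrow> (\<forall>k. C_k_on k f S)"


section \<open>Lie groups\<close>

text \<open>
  Groups are written additively, although they need not be commutative: the product of \<open>x\<close> and
  \<open>y\<close> is \<open>x + y\<close>, the inverse of \<open>x\<close> is \<open>- x\<close> and the unit element is \<open>0\<close>. The topology is that
  of the type, and a chart is a pair \<open>(U, \<phi>)\<close> where only the values of \<open>\<phi>\<close> on \<open>U\<close> matter.
\<close>

type_synonym ('g, 'n) chart = "'g set \<times> ('g \<Rightarrow> real^'n)"

locale lie_group =
  fixes atlas :: "('g::{topological_group_add, t2_space, second_countable_topology}, 'n::finite) chart set"
  assumes chart: "\<And>U \<phi>. (U, \<phi>) \<in> atlas \<Longrightarrow>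
      open U \<and> open (\<phi> ` U) \<and> homeomorphism U (\<phi> ` U) \<phi> (inv_into U \<phi>)"
    and charts_cover: "(\<Union>(U, \<phi>)\<in>atlas. U) = UNIV"
    and charts_compatible: "\<And>U \<phi> V \<psi>. (U, \<phi>) \<in> atlas \<Longrightarrow> (V, \<psi>) \<in> atlas \<Longrightarrow>
      smooth_on (\<lambda>p. \<psi> (inv_into U \<phi> p)) (\<phi> ` (U \<inter> V))"
    and smooth_product: "\<And>U \<phi> V \<psi> W \<theta>. (U, \<phi>) \<in> atlas \<Longrightarrow> (V, \<psi>) \<in> atlas \<Longrightarrow> (W, \<theta>) \<in> atlas \<Longrightarrow>
      smooth_on (\<lambda>(p, q). \<theta> (inv_into U \<phi> p + inv_into V \<psi> q))
        {(\<phi> x, \<psi> y) | x y. x \<in> U \<and> y \<in> V \<and> x + y \<in> W}"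
    and smooth_inverse: "\<And>U \<phi> V \<psi>. (U, \<phi>) \<in> atlas \<Longrightarrow> (V, \<psi>) \<in> atlas \<Longrightarrow>
      smooth_on (\<lambda>p. \<psi> (- inv_into U \<phi> p)) {\<phi> x | x. x \<in> U \<and> - x \<in> V}"

definition smooth_fun :: "('g, 'n::finite) chart set \<Rightarrow> ('g \<Rightarrow> 'b::real_normed_vector) \<Rightarrow> bool" where
  "smooth_fun atlas f \<longleftrightarrow> (\<forall>(U, \<phi>)\<in>atlas. smooth_on (\<lambda>p. f (inv_into U \<phi> p)) (\<phi> ` U))"

definition diffeo_from_euclidean ::
    "('g::topological_space, 'n::finite) chart set \<Rightarrow> (real^'n \<Rightarrow> 'g) \<Rightarrow> bool" where
  "diffeo_from_euclidean atlas h \<longleftrightarrow>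
     bij h \<and> continuous_on UNIV h \<and>
     (\<forall>(U, \<phi>)\<in>atlas. smooth_on (\<lambda>v. \<phi> (h v)) (h -` U)) \<and>
     smooth_fun atlas (inv h)"


section \<open>The Lie algebra and the exponential map\<close>

text \<open>
  Smooth vector fields are the derivations of the algebra of real-valued smooth functions. As HOL
  functions are total, a derivation is extended by \<open>0\<close> to the functions that are not smooth.
\<close>

type_synonym 'g vfield = "('g \<Rightarrow> real) \<Rightarrow> 'g \<Rightarrow> real"

definition vector_field :: "('g, 'n::finite) chart set \<Rightarrow> 'g vfield \<Rightarrow> bool" where
  "vector_field atlas X \<longleftrightarrow>
     (\<forall>f. smooth_fun atlas f \<longrightarrow> smooth_fun atlas (X f)) \<and>
     (\<forall>f. \<not> smooth_fun atlas f \<longrightarrow> X f = (\<lambda>x. 0)) \<and>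
     (\<forall>f g. smooth_fun atlas f \<and> smooth_fun atlas g \<longrightarrow>
        X (\<lambda>x. f x + g x) = (\<lambda>x. X f x + X g x)) \<and>
     (\<forall>c f. smooth_fun atlas f \<longrightarrow> X (\<lambda>x. c * f x) = (\<lambda>x. c * X f x)) \<and>
     (\<forall>f g. smooth_fun atlas f \<and> smooth_fun atlas g \<longrightarrow>
        X (\<lambda>x. f x * g x) = (\<lambda>x. X f x * g x + f x * X g x))"

definition left_invariant :: "('g::group_add, 'n::finite) chart set \<Rightarrow> 'g vfield \<Rightarrow> bool" where
  "left_invariant atlas X \<longleftrightarrow>
     (\<forall>y f. smooth_fun atlas f \<longrightarrow> X (\<lambda>x. f (y + x)) = (\<lambda>x. X f (y + x)))"

definition lie_algebra :: "('g::group_add, 'n::finite) chart set \<Rightarrow> 'g vfield set" where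
  "lie_algebra atlas = {X. vector_field atlas X \<and> left_invariant atlas X}"

definition commutator :: "'g vfield \<Rightarrow> 'g vfield \<Rightarrow> 'g vfield" where
  "commutator X Y = (\<lambda>f x. X (Y f) x - Y (X f) x)"

text \<open>
  To have the linear algebra of the library available, the Lie algebra is identified with
  \<open>real^'n\<close> by an arbitrary linear isomorphism \<open>\<iota>\<close>, that is, by the choice of a basis. The bracket
  of left-invariant vector fields becomes a bracket on \<open>real^'n\<close>.
\<close>

definition lie_algebra_iso ::
    "('g::group_add, 'n::finite) chart set \<Rightarrow> (real^'n \<Rightarrow> 'g vfield) \<Rightarrow> bool" where
  "lie_algebra_iso atlas \<iota> \<longleftrightarrow>
     bij_betw \<iota> UNIV (lie_algebra atlas) \<and>
     (\<forall>u v f x. \<iota> (u + v) f x = \<iota> u f x + \<iota> v f x) \<and>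
     (\<forall>c v f x. \<iota> (c *\<^sub>R v) f x = c * \<iota> v f x)"

definition lie_bracket :: "(real^'n \<Rightarrow> 'g vfield) \<Rightarrow> real^'n \<Rightarrow> real^'n \<Rightarrow> real^'n::finite" where
  "lie_bracket \<iota> u v = inv \<iota> (commutator (\<iota> u) (\<iota> v))"

definition lie_algebra_morphism ::
    "(real^'n \<Rightarrow> 'g vfield) \<Rightarrow> (real^'n \<Rightarrow> real^'n::finite) \<Rightarrow> bool" where
  "lie_algebra_morphism \<iota> T \<longleftrightarrow>
     linear T \<and> (\<forall>u v. T (lie_bracket \<iota> u v) = lie_bracket \<iota> (T u) (T v))"

definition one_parameter_subgroup ::
    "('g::group_add, 'n::finite) chart set \<Rightarrow> 'g vfield \<Rightarrow> (real \<Rightarrow> 'g) \<Rightarrow> bool" where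
  "one_parameter_subgroup atlas X \<gamma> \<longleftrightarrow>
     (\<forall>s t. \<gamma> (s + t) = \<gamma> s + \<gamma> t) \<and>
     (\<forall>f. smooth_fun atlas f \<longrightarrow> ((\<lambda>t. f (\<gamma> t)) has_real_derivative X f 0) (at 0))"

text \<open>
  For each left-invariant vector field \<open>X\<close> there is exactly one one-parameter subgroup with initial
  velocity \<open>X\<close>; hence the following predicate holds of exactly one map.
\<close>

definition exponential_map ::
    "('g::group_add, 'n::finite) chart set \<Rightarrow> (real^'n \<Rightarrow> 'g vfield) \<Rightarrow> (real^'n \<Rightarrow> 'g) \<Rightarrow> bool" where
  "exponential_map atlas \<iota> expo \<longleftrightarrow>
     (\<forall>v. one_parameter_subgroup atlas (\<iota> v) (\<lambda>t. expo (t *\<^sub>R v)))"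


section \<open>Homogeneous groups\<close>

definition diagonalisable :: "(real^'n \<Rightarrow> real^'n::finite) \<Rightarrow> bool" where
  "diagonalisable A \<longleftrightarrow>
     linear A \<and> (\<exists>B. independent B \<and> span B = UNIV \<and> (\<forall>b\<in>B. \<exists>\<nu>. A b = \<nu> *\<^sub>R b))"

definition positive_eigenvalues :: "(real^'n \<Rightarrow> real^'n::finite) \<Rightarrow> bool" where
  "positive_eigenvalues A \<longleftrightarrow> (\<forall>\<nu> v. v \<noteq> 0 \<and> A v = \<nu> *\<^sub>R v \<longrightarrow> \<nu> > 0)"

text \<open>\<open>Exp (A ln r)\<close>, for \<open>r > 0\<close>.\<close>

definition dilation :: "(real^'n \<Rightarrow> real^'n) \<Rightarrow> real \<Rightarrow> real^'n \<Rightarrow> real^'n::finite" where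
  "dilation A r v = (\<Sum>k. (1 / fact k) *\<^sub>R ((\<lambda>w. ln r *\<^sub>R A w) ^^ k) v)"

definition homogeneous_dim :: "(real^'n \<Rightarrow> real^'n::finite) \<Rightarrow> real" where
  "homogeneous_dim A = trace (matrix A)"

text \<open>
  The assumption \<open>expo_diffeo\<close> is the standard fact that the exponential map of such a group is a
  global diffeomorphism, and \<open>dim_le\<close> is the usual normalisation of \<open>A\<close>.
\<close>

locale homogeneous_group = lie_group atlas
  for atlas :: "('g::{topological_group_add, t2_space, second_countable_topology}, 'n::finite) chart set" +
  fixes \<iota> :: "real^'n \<Rightarrow> 'g vfield"
    and expo :: "real^'n \<Rightarrow> 'g"
    and A :: "real^'n \<Rightarrow> real^'n"
  assumes connected_group: "connected (UNIV :: 'g set)"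
    and simply_connected_group: "simply_connected (UNIV :: 'g set)"
    and lie_algebra_iso: "lie_algebra_iso atlas \<iota>"
    and exponential_map: "exponential_map atlas \<iota> expo"
    and expo_diffeo: "diffeo_from_euclidean atlas expo"
    and diagonalisable: "diagonalisable A"
    and positive_eigenvalues: "positive_eigenvalues A"
    and dilation_morphism: "\<And>r. r > 0 \<Longrightarrow> lie_algebra_morphism \<iota> (dilation A r)"
    and dim_le: "real CARD('n) \<le> homogeneous_dim A"

definition group_dilation ::
    "(real^'n \<Rightarrow> 'g) \<Rightarrow> (real^'n \<Rightarrow> real^'n::finite) \<Rightarrow> real \<Rightarrow> 'g \<Rightarrow> 'g" where
  "group_dilation expo A r x = expo (dilation A r (inv expo x))"

definition homogeneous_quasi_norm ::
    "(real^'n \<Rightarrow> 'g::{topological_space, group_add}) \<Rightarrow> (real^'n \<Rightarrow> real^'n::finite) \<Rightarrow>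
     ('g \<Rightarrow> real) \<Rightarrow> bool" where
  "homogeneous_quasi_norm expo A N \<longleftrightarrow>
     continuous_on UNIV N \<and>
     (\<forall>x. N x \<ge> 0) \<and>
     (\<forall>x. N (- x) = N x) \<and>
     (\<forall>r x. r > 0 \<longrightarrow> N (group_dilation expo A r x) = r * N x) \<and>
     (\<forall>x. N x = 0 \<longleftrightarrow> x = 0)"

definition quasi_ball :: "('g \<Rightarrow> real) \<Rightarrow> real \<Rightarrow> 'g set" where
  "quasi_ball N R = {x. N x < R}"

text \<open>The value at \<open>x = 0\<close> carries no meaning.\<close>

definition radial_derivative ::
    "(real^'n \<Rightarrow> 'g) \<Rightarrow> (real^'n \<Rightarrow> real^'n::finite) \<Rightarrow> ('g \<Rightarrow> real) \<Rightarrow> ('g \<Rightarrow> complex) \<Rightarrow>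
     'g \<Rightarrow> complex" where
  "radial_derivative expo A N f x =
     vector_derivative (\<lambda>r. f (group_dilation expo A r (group_dilation expo A (1 / N x) x)))
       (at (N x))"

text \<open>
  Left-invariant Borel measures that are finite on compact sets and positive on nonempty open sets;
  regularity is automatic because the topology is locally compact and second countable.
\<close>

definition haar_measure :: "'g::{topological_space, group_add} measure \<Rightarrow> bool" where
  "haar_measure M \<longleftrightarrow>
     sets M = sets borel \<and>
     (\<forall>y. distr M M (\<lambda>x. y + x) = M) \<and>
     (\<forall>K. compact K \<longrightarrow> emeasure M K < \<infinity>) \<and>
     (\<forall>U. open U \<and> U \<noteq> {} \<longrightarrow> emeasure M U > 0)"

text \<open>Functions on an open set \<open>\<Omega>\<close> are represented by their extension by \<open>0\<close> to the whole group.\<close>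

definition test_functions ::
    "('g::topological_space, 'n::finite) chart set \<Rightarrow> 'g set \<Rightarrow> ('g \<Rightarrow> complex) set" where
  "test_functions atlas \<Omega> =
     {f. smooth_fun atlas f \<and> compact (closure {x. f x \<noteq> 0}) \<and> closure {x. f x \<noteq> 0} \<subseteq> \<Omega>}"

end

theory Submission
  imports Defs "HOL-Computational_Algebra.Polynomial"
begin

text \<open>
  In exponential coordinates adapted to an eigenbasis of \<open>A\<close>, the derivative \<open>W q\<close> of \<open>p \<mapsto> - q + p\<close>
  at \<open>q\<close> (the Maurer-Cartan form) satisfies \<open>(t W(t p))' = 1 - [p, t W(t p)]\<close>. As the bracket with \<open>p\<close>
  strictly raises weights, \<open>W q\<close> is unitriangular, so left translations preserve Lebesgue measure. Hence Haar
  measure is Lebesgue measure up to a factor and scales by \<open>r\<^bsup>Q\<^esup>\<close> under dilations.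

  Along an orbit \<open>t \<mapsto> D\<^bsub>exp t\<^esub> x\<close> both integrals become one-dimensional: with \<open>s = ln |x|\<close> the claim is
  Hardy's inequality \<open>\<integral> |h|\<^bsup>Q\<^esup> ds \<le> Q\<^bsup>Q\<^esup> \<integral> |s h'|\<^bsup>Q\<^esup> ds\<close>, obtained by integrating \<open>(s |h|\<^bsup>Q\<^esup>)'\<close> and
  Young's inequality. Its near-extremals are cut-offs of \<open>|s|\<^bsup>-1/Q\<^esup>\<close> near \<open>s = -\<infinity>\<close>, which every ball around
  \<open>0\<close> contains, so the constant is optimal for all \<open>R\<close>.
\<close>

subsection \<open>Calculus of smooth maps\<close>

text \<open>The exponent \<open>Q\<close> on both sides is what reduces the problem to a line:
  \<open>dx / |x|^Q\<close> is invariant under dilations, so on each orbit it becomes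
  \<open>ds\<close> with \<open>s = ln |x|\<close>, and \<open>|x|\<close> times the radial
  derivative becomes \<open>d/ds\<close>. The zero of the weight at \<open>s = 0\<close>, that is on
  the sphere \<open>|x| = 1\<close>, is harmless because \<open>h\<close> is differentiable across
  it. Equality in Young's inequality asks for \<open>|h| = Q |s h'|\<close>, whose solution
  \<open>|s| powr (- 1 / Q)\<close> misses \<open>L^Q\<close> only logarithmically; a cut-off that
  is slow in \<open>ln |s|\<close> therefore has arbitrarily small relative cost. On the group side
  no series for the product is used. That left translations preserve volume is read off from three
  facts: lines through \<open>0\<close> are one-parameter subgroups, the bracket is the commutator
  of left-invariant fields, and the dilations are automorphisms with positive weights. The last one
  forces the bracket of vectors of weights \<open>a\<close> and \<open>b\<close> to have weight
  \<open>a + b\<close>, which exceeds both.\<close>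

lemma C_k_on_cong:
  assumes "open S" "\<And>x. x \<in> S \<Longrightarrow> f x = g x" "C_k_on k f S"
  shows "C_k_on k g S"
  using assms(2,3)
proof (induction k arbitrary: f g)
  case 0
  then show ?case by (simp cong: continuous_on_cong)
next
  case (Suc k)
  have d: "f differentiable at x" if "x \<in> S" for x using Suc.prems that by auto
  have fr: "frechet_derivative f (at x) = frechet_derivative g (at x)" if "x \<in> S" for x
    by (rule frechet_derivative_transform_within_open[OF d \<open>open S\<close>]) (use that Suc.prems in auto)
  have "g differentiable at x" if "x \<in> S" for x
    using d[OF that] has_derivative_transform_within_open[OF _ \<open>open S\<close> that] Suc.prems(1)
    unfolding differentiable_def by metis
  moreover have "C_k_on k (\<lambda>x. frechet_derivative g (at x) v) S" for v
    by (rule Suc.IH[of "\<lambda>x. frechet_derivative f (at x) v"]) (use Suc.prems fr in auto)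
  ultimately show ?case by simp
qed

lemma C_k_on_subset: "C_k_on k f S \<Longrightarrow> T \<subseteq> S \<Longrightarrow> C_k_on k f T"
  by (induction k arbitrary: f) (auto intro: continuous_on_subset)

lemma C_k_on_local:
  assumes "\<And>x. x \<in> S \<Longrightarrow> \<exists>T. open T \<and> x \<in> T \<and> C_k_on k f T"
  shows "C_k_on k f S"
  using assms
proof (induction k arbitrary: f)
  case 0
  then show ?case
    by (metis C_k_on.simps(1) continuous_at_imp_continuous_on continuous_on_eq_continuous_at)
next
  case (Suc k)
  have "f differentiable at x" if "x \<in> S" for x
    using Suc.prems[OF that] by auto
  moreover have "C_k_on k (\<lambda>x. frechet_derivative f (at x) v) S" for v
    by (rule Suc.IH) (use Suc.prems in fastforce)
  ultimately show ?case by simp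
qed

lemma C_k_on_SucI:
  assumes "open S" "\<And>x. x \<in> S \<Longrightarrow> (f has_derivative f' x) (at x)"
    and "\<And>v. C_k_on k (\<lambda>x. f' x v) S"
  shows "C_k_on (Suc k) f S"
proof -
  have "C_k_on k (\<lambda>x. frechet_derivative f (at x) v) S" for v
    by (rule C_k_on_cong[OF \<open>open S\<close> _ assms(3)[of v]]) (use assms(2) frechet_derivative_at in metis)
  then show ?thesis using assms(2) by (auto simp: differentiable_def)
qed

lemma C_k_on_has_derivative:
  "C_k_on (Suc k) f S \<Longrightarrow> x \<in> S \<Longrightarrow> (f has_derivative frechet_derivative f (at x)) (at x)"
  by (auto simp: frechet_derivative_works)

lemma C_k_on_Suc_imp: "C_k_on (Suc k) f S \<Longrightarrow> C_k_on k f S"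
proof (induction k arbitrary: f)
  case 0
  then show ?case
    by (auto intro!: continuous_at_imp_continuous_on differentiable_imp_continuous_within)
next
  case (Suc k)
  then show ?case by (metis C_k_on.simps(2))
qed

lemma C_k_on_frechet_derivative:
  "C_k_on (Suc k) f S \<Longrightarrow> C_k_on k (\<lambda>x. frechet_derivative f (at x) v) S"
  by simp

text \<open>From here on regularity is handled by closure rules; automatic unfolding would trade
  them for explicit Frechet derivatives.\<close>

lemmas [simp del] = C_k_on.simps(2)

lemma C_k_on_const: "open S \<Longrightarrow> C_k_on k (\<lambda>x. c) S"
proof (induction k arbitrary: c)
  case (Suc k)
  show ?case by (rule C_k_on_SucI[where f' = "\<lambda>x v. 0"]) (use Suc in auto)
qed simp

lemma C_k_on_linear:
  assumes "open S" "bounded_linear f" shows "C_k_on k f S"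
proof (cases k)
  case 0
  then show ?thesis using linear_continuous_on[OF assms(2)] by simp
next
  case (Suc k')
  show ?thesis unfolding Suc
    by (rule C_k_on_SucI[where f' = "\<lambda>x. f"])
      (use assms C_k_on_const in \<open>auto intro: bounded_linear_imp_has_derivative\<close>)
qed

lemma C_k_on_add:
  assumes "open S" "C_k_on k f S" "C_k_on k g S" shows "C_k_on k (\<lambda>x. f x + g x) S"
  using assms(2,3)
proof (induction k arbitrary: f g)
  case 0
  then show ?case by (auto intro: continuous_intros)
next
  case (Suc k)
  show ?case
    by (rule C_k_on_SucI[where f' = "\<lambda>x v. frechet_derivative f (at x) v + frechet_derivative g (at x) v"])
      (use assms(1) Suc.prems C_k_on_has_derivative
        in \<open>auto intro!: has_derivative_add Suc.IH C_k_on_frechet_derivative\<close>)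
qed

lemma C_k_on_sum:
  assumes "open S" "\<And>i. i \<in> I \<Longrightarrow> C_k_on k (f i) S" shows "C_k_on k (\<lambda>x. \<Sum>i\<in>I. f i x) S"
  using assms(2)
proof (induction I rule: infinite_finite_induct)
  case (insert i I)
  then show ?case by (auto intro!: C_k_on_add assms(1))
qed (auto intro: C_k_on_const assms(1))

lemma C_k_on_linear_compose:
  assumes "open S" "bounded_linear h" "C_k_on k f S" shows "C_k_on k (\<lambda>x. h (f x)) S"
  using assms(3)
proof (induction k arbitrary: f)
  case 0
  then show ?case
    using bounded_linear.continuous_on[OF assms(2)] by auto
next
  case (Suc k)
  show ?case
    by (rule C_k_on_SucI[where f' = "\<lambda>x v. h (frechet_derivative f (at x) v)"])
      (use assms(1) Suc.prems C_k_on_has_derivative in \<open>auto intro!: Suc.IH C_k_on_frechet_derivative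
          bounded_linear.has_derivative[OF assms(2)]\<close>)
qed

lemma C_k_on_scaleR:
  fixes f :: "'a::euclidean_space \<Rightarrow> real"
  assumes "open S" "C_k_on k f S" "C_k_on k g S" shows "C_k_on k (\<lambda>x. f x *\<^sub>R g x) S"
  using assms(2,3)
proof (induction k arbitrary: f g)
  case 0
  then show ?case by (auto intro: continuous_intros)
next
  case (Suc k)
  show ?case
    by (rule C_k_on_SucI[where f' = "\<lambda>x v. f x *\<^sub>R frechet_derivative g (at x) v
          + frechet_derivative f (at x) v *\<^sub>R g x"])
      (use assms(1) Suc C_k_on_has_derivative[OF Suc.prems(1)] C_k_on_has_derivative[OF Suc.prems(2)]
          C_k_on_frechet_derivative[OF Suc.prems(1)] C_k_on_frechet_derivative[OF Suc.prems(2)]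
          C_k_on_Suc_imp[OF Suc.prems(1)] C_k_on_Suc_imp[OF Suc.prems(2)]
        in \<open>auto intro!: has_derivative_scaleR C_k_on_add\<close>)
qed

lemma C_k_on_mult:
  fixes f g :: "'a::euclidean_space \<Rightarrow> real"
  assumes "open S" "C_k_on k f S" "C_k_on k g S" shows "C_k_on k (\<lambda>x. f x * g x) S"
  using C_k_on_scaleR[OF assms] by simp

lemma C_k_on_Pair:
  assumes "open S" "C_k_on k f S" "C_k_on k g S" shows "C_k_on k (\<lambda>x. (f x, g x)) S"
proof -
  have "C_k_on k (\<lambda>x. (f x, 0) + (0, g x)) S"
    by (intro C_k_on_add C_k_on_linear_compose[of _ "\<lambda>y. (y, 0)"]
          C_k_on_linear_compose[of _ "\<lambda>y. (0, y)"] assms bounded_linear_Pair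
          bounded_linear_ident bounded_linear_zero)
  then show ?thesis by simp
qed

text \<open>The chain rule gives \<open>f' (g x) (g' x v)\<close>, whose direction moves with
  \<open>x\<close>, while the induction hypothesis covers fixed directions only. Expanding the
  direction in the basis yields a sum of products to which the closure rules apply.\<close>

lemma C_k_on_compose:
  fixes g :: "'a::euclidean_space \<Rightarrow> 'b::euclidean_space"
  assumes "open S" "C_k_on k g S" "C_k_on k f T" "g ` S \<subseteq> T"
  shows "C_k_on k (\<lambda>x. f (g x)) S"
  using assms(2-)
proof (induction k arbitrary: f)
  case 0
  then show ?case by (auto intro: continuous_on_compose2)
next
  case (Suc k)
  let ?f' = "\<lambda>x. frechet_derivative f (at x)" and ?g' = "\<lambda>x. frechet_derivative g (at x)"
  have df: "(f has_derivative ?f' (g x)) (at (g x))" if "x \<in> S" for x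
    using C_k_on_has_derivative[OF Suc.prems(2)] Suc.prems(3) that by blast
  have "C_k_on k (\<lambda>x. ?f' (g x) (?g' x v)) S" for v
  proof -
    have "C_k_on k (\<lambda>x. \<Sum>b\<in>Basis. (?g' x v \<bullet> b) *\<^sub>R ?f' (g x) b) S"
      by (intro C_k_on_sum C_k_on_scaleR Suc.IH
            C_k_on_linear_compose[of _ "\<lambda>y. y \<bullet> _"] bounded_linear_inner_left)
        (use assms(1) Suc.prems C_k_on_Suc_imp C_k_on_frechet_derivative in \<open>auto\<close>)
    moreover have "(\<Sum>b\<in>Basis. (?g' x v \<bullet> b) *\<^sub>R ?f' (g x) b) = ?f' (g x) (?g' x v)"
      if "x \<in> S" for x
    proof -
      interpret L: bounded_linear "?f' (g x)" using df[OF that] by (rule has_derivative_bounded_linear)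
      show ?thesis
        by (subst (2) euclidean_representation[symmetric], simp only: L.sum L.scaleR)
    qed
    ultimately show ?thesis by (rule C_k_on_cong[OF assms(1) _, rotated]) auto
  qed
  then show ?case
    using diff_chain_at[OF C_k_on_has_derivative[OF Suc.prems(1)] df]
    by (intro C_k_on_SucI[where f' = "\<lambda>x v. ?f' (g x) (?g' x v)"]) (auto simp: o_def assms(1))
qed

lemma C_k_on_real_SucI:
  fixes f :: "real \<Rightarrow> real"
  assumes "open S" "\<And>x. x \<in> S \<Longrightarrow> (f has_real_derivative f' x) (at x)" "C_k_on k f' S"
  shows "C_k_on (Suc k) f S"
  by (rule C_k_on_SucI[where f' = "\<lambda>x v. f' x * v"])
    (use assms in \<open>auto simp: has_field_derivative_def intro!: C_k_on_mult C_k_on_const\<close>)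

lemma C_k_on_powr: "C_k_on k (\<lambda>x::real. x powr a) {0<..}"
proof (induction k arbitrary: a)
  case 0
  then show ?case by (auto intro!: continuous_intros)
next
  case (Suc k)
  show ?case
    by (rule C_k_on_real_SucI[where f' = "\<lambda>x. a * x powr (a - 1)"])
      (auto intro!: C_k_on_mult C_k_on_const Suc derivative_eq_intros)
qed

lemma C_k_on_ln: "C_k_on k (ln :: real \<Rightarrow> real) {0<..}"
proof -
  have "C_k_on (Suc k) (ln :: real \<Rightarrow> real) {0<..}"
    by (rule C_k_on_real_SucI[where f' = "\<lambda>x. x powr -1"])
      (use C_k_on_powr[of k "-1"] in \<open>auto intro!: derivative_eq_intros simp: powr_minus_divide\<close>)
  then show ?thesis by (rule C_k_on_Suc_imp)
qed

section \<open>Functions that are flat at the origin\<close>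

definition flat_exp :: "real poly \<Rightarrow> real \<Rightarrow> real" where
  "flat_exp p x = (if x > 0 then poly p (1 / x) * exp (- (1 / x)) else 0)"

lemma poly_times_exp_minus_tendsto_0:
  "((\<lambda>x::real. poly p x * exp (- x)) \<longlongrightarrow> 0) at_top"
proof -
  have "((\<lambda>x. \<Sum>i\<le>degree p. coeff p i * (x ^ i / exp x)) \<longlongrightarrow> (\<Sum>i\<le>degree p. coeff p i * 0)) at_top"
    by (intro tendsto_intros tendsto_power_div_exp_0)
  then show ?thesis
    by (simp add: poly_altdef exp_minus sum_distrib_right divide_inverse mult.assoc)
qed

text \<open>With \<open>y = 1 / x\<close> one has \<open>d/dx = - y^2 d/dy\<close>, and
  \<open>p(y) exp(-y)\<close> has the \<open>y\<close>-derivative \<open>(p' - p) exp(-y)\<close>.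
  The polynomial parameter makes the family closed under differentiation, so smoothness follows by a
  plain induction; \<open>p = 1\<close> is the classical flat function.\<close>

lemma flat_exp_has_derivative:
  "(flat_exp p has_real_derivative flat_exp ([:0, 0, 1:] * (p - pderiv p)) x) (at x)"
proof -
  consider "x > 0" | "x < 0" | "x = 0" by linarith
  then show ?thesis
  proof cases
    case 1
    have "((\<lambda>x. poly p (1 / x) * exp (- (1 / x))) has_real_derivative
        flat_exp ([:0, 0, 1:] * (p - pderiv p)) x) (at x)"
      using 1 by (auto intro!: derivative_eq_intros DERIV_chain2[OF poly_DERIV]
          simp: flat_exp_def field_simps power2_eq_square)
    then show ?thesis
      by (rule has_field_derivative_transform_within_open[where S = "{0<..}"])
        (use 1 in \<open>auto simp: flat_exp_def\<close>)
  next
    case 2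
    have "((\<lambda>x. 0) has_real_derivative flat_exp ([:0, 0, 1:] * (p - pderiv p)) x) (at x)"
      using 2 by (auto simp: flat_exp_def)
    then show ?thesis
      by (rule has_field_derivative_transform_within_open[where S = "{..<0}"])
        (use 2 in \<open>auto simp: flat_exp_def\<close>)
  next
    case 3
    \<comment> \<open>In \<open>y = 1 / h\<close> the right difference quotient is
      \<open>y p(y) exp(-y)\<close>, whence the polynomial \<open>[:0,1:] * p\<close>.\<close>
    have r: "((\<lambda>h. flat_exp p h / h) \<longlongrightarrow> 0) (at_right 0)"
    proof -
      have "((\<lambda>h. poly ([:0,1:] * p) (inverse h) * exp (- inverse h)) \<longlongrightarrow> 0) (at_right 0)"
        by (rule filterlim_compose[OF poly_times_exp_minus_tendsto_0 filterlim_inverse_at_top_right])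
      then show ?thesis
        by (rule Lim_transform_eventually)
          (auto simp: flat_exp_def eventually_at_filter field_simps)
    qed
    have l: "((\<lambda>h. flat_exp p h / h) \<longlongrightarrow> 0) (at_left 0)"
      by (rule Lim_transform_eventually[OF tendsto_const])
        (auto simp: flat_exp_def eventually_at_filter)
    have "((\<lambda>h. flat_exp p h / h) \<longlongrightarrow> 0) (at 0)" using l r by (simp add: filterlim_at_split)
    then show ?thesis using 3 by (simp add: DERIV_def flat_exp_def)
  qed
qed

lemma C_k_on_flat_exp: "C_k_on k (flat_exp p) UNIV"
proof (induction k arbitrary: p)
  case 0
  then show ?case
    by (auto intro!: continuous_at_imp_continuous_on DERIV_isCont flat_exp_has_derivative)
next
  case (Suc k)
  show ?case by (rule C_k_on_real_SucI[OF _ flat_exp_has_derivative Suc]) auto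
qed

lemma smooth_onD: "smooth_on f S \<Longrightarrow> C_k_on k f S"
  by (simp add: smooth_on_def)

lemma smooth_on_compose:
  fixes g :: "'a::euclidean_space \<Rightarrow> 'b::euclidean_space"
  assumes "open S" "smooth_on g S" "smooth_on f T" "g ` S \<subseteq> T"
  shows "smooth_on (\<lambda>x. f (g x)) S"
  using assms C_k_on_compose unfolding smooth_on_def by blast

lemma smooth_on_has_derivative:
  "smooth_on f S \<Longrightarrow> x \<in> S \<Longrightarrow> (f has_derivative frechet_derivative f (at x)) (at x)"
  using C_k_on_has_derivative smooth_onD by blast

lemma smooth_on_local:
  "(\<And>x. x \<in> S \<Longrightarrow> \<exists>T. open T \<and> x \<in> T \<and> smooth_on f T) \<Longrightarrow> smooth_on f S"
  unfolding smooth_on_def by (intro allI C_k_on_local) blast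

lemma smooth_on_linear: "open S \<Longrightarrow> bounded_linear f \<Longrightarrow> smooth_on f S"
  unfolding smooth_on_def using C_k_on_linear by blast

lemma smooth_on_const: "open S \<Longrightarrow> smooth_on (\<lambda>x. c) S"
  unfolding smooth_on_def using C_k_on_const by blast

lemma smooth_on_Pair:
  "open S \<Longrightarrow> smooth_on f S \<Longrightarrow> smooth_on g S \<Longrightarrow> smooth_on (\<lambda>x. (f x, g x)) S"
  unfolding smooth_on_def using C_k_on_Pair by blast

lemma smooth_on_frechet_derivative:
  "smooth_on f S \<Longrightarrow> smooth_on (\<lambda>x. frechet_derivative f (at x) v) S"
  unfolding smooth_on_def using C_k_on_frechet_derivative by blast

lemma smooth_on_imp_continuous_on: "smooth_on f S \<Longrightarrow> continuous_on S f"
  by (metis C_k_on.simps(1) smooth_onD)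

lemma smooth_on_cong: "open S \<Longrightarrow> (\<And>x. x \<in> S \<Longrightarrow> f x = g x) \<Longrightarrow> smooth_on f S \<Longrightarrow> smooth_on g S"
  unfolding smooth_on_def using C_k_on_cong by blast

subsection \<open>Lie groups in exponential coordinates\<close>

definition diag_dilation :: "('n \<Rightarrow> real) \<Rightarrow> real \<Rightarrow> real^'n \<Rightarrow> real^'n::finite" where
  "diag_dilation \<nu> r x = (\<chi> i. r powr \<nu> i * x $ i)"

text \<open>The identification \<open>j\<close> and the map \<open>e\<close> are kept free because
  the theory is applied twice: to the given \<open>\<iota>\<close> and \<open>expo\<close>, and to
  their compositions with the change to an eigenbasis of \<open>A\<close>.\<close>

locale exponential_coordinates = lie_group atlas
  for atlas :: "('g::{topological_group_add, t2_space, second_countable_topology}, 'n::finite) chart set" +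
  fixes j :: "real^'n \<Rightarrow> 'g vfield"
    and e :: "real^'n \<Rightarrow> 'g"
  assumes iso: "lie_algebra_iso atlas j"
    and exp_map: "exponential_map atlas j e"
    and diffeo: "diffeo_from_euclidean atlas e"
begin

lemma bij_e: "bij e" and cont_e: "continuous_on UNIV e"
  and smooth_e: "(U, \<phi>) \<in> atlas \<Longrightarrow> smooth_on (\<lambda>v. \<phi> (e v)) (e -` U)"
  and smooth_inv_e: "smooth_fun atlas (inv e)"
  using diffeo by (auto simp: diffeo_from_euclidean_def)

lemma inv_e_e [simp]: "inv e (e p) = p" and e_inv_e [simp]: "e (inv e x) = x"
  using bij_e by (auto simp: bij_is_inj bij_is_surj surj_f_inv_f)

lemma obtain_chart: obtains U \<phi> where "(U, \<phi>) \<in> atlas" "x \<in> U"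
proof -
  have "x \<in> (\<Union>(U, \<phi>)\<in>atlas. U)" by (simp add: charts_cover)
  then show ?thesis using that by auto
qed

lemma open_chart: "(U, \<phi>) \<in> atlas \<Longrightarrow> open U" "(U, \<phi>) \<in> atlas \<Longrightarrow> open (\<phi> ` U)"
  using chart by blast+

lemma inj_chart: assumes "(U, \<phi>) \<in> atlas" shows "inj_on \<phi> U"
  using chart[OF assms] by (auto simp: homeomorphism_def intro: inj_on_inverseI)

lemma open_vimage_e: "open U \<Longrightarrow> open (e -` U)"
  using cont_e by (simp add: continuous_on_open_vimage)

lemma smooth_fun_compose_e:
  assumes "smooth_fun atlas f" shows "smooth_on (\<lambda>p. f (e p)) UNIV"
proof (rule smooth_on_local)
  fix p
  obtain U \<phi> where U: "(U, \<phi>) \<in> atlas" "e p \<in> U" by (rule obtain_chart)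
  have "smooth_on (\<lambda>q. f (inv_into U \<phi> (\<phi> (e q)))) (e -` U)"
    by (rule smooth_on_compose[where T = "\<phi> ` U"])
      (use U open_vimage_e open_chart smooth_e assms in \<open>auto simp: smooth_fun_def\<close>)
  then have "smooth_on (\<lambda>q. f (e q)) (e -` U)"
    by (rule smooth_on_cong[rotated 2])
      (use U open_vimage_e open_chart inj_chart in \<open>auto simp: inv_into_f_f\<close>)
  then show "\<exists>T. open T \<and> p \<in> T \<and> smooth_on (\<lambda>p. f (e p)) T"
    using U open_vimage_e open_chart by blast
qed

lemma smooth_fun_compose_inv_e:
  fixes F :: "real^'n \<Rightarrow> 'b::real_normed_vector"
  assumes "smooth_on F UNIV" shows "smooth_fun atlas (\<lambda>x. F (inv e x))"
  using smooth_inv_e open_chart unfolding smooth_fun_def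
  by (auto intro!: smooth_on_compose[OF _ _ assms])

lemma continuous_inv_e: "continuous_on UNIV (inv e)"
proof -
  have "isCont (inv e) x" for x
  proof -
    obtain U \<phi> where U: "(U, \<phi>) \<in> atlas" "x \<in> U" by (rule obtain_chart)
    have "continuous_on U \<phi>" using chart[OF U(1)] by (auto simp: homeomorphism_def)
    moreover have "continuous_on (\<phi> ` U) (\<lambda>p. inv e (inv_into U \<phi> p))"
      using smooth_inv_e U(1) by (auto simp: smooth_fun_def intro: smooth_on_imp_continuous_on)
    ultimately have "continuous_on U (\<lambda>y. inv e (inv_into U \<phi> (\<phi> y)))"
      using continuous_on_compose2[of "\<phi> ` U" "\<lambda>p. inv e (inv_into U \<phi> p)" U \<phi>] by auto
    then have "continuous_on U (inv e)"
      by (rule continuous_on_eq) (use inj_chart[OF U(1)] in \<open>auto simp: inv_into_f_f\<close>)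
    then show ?thesis
      using U open_chart(1)[OF U(1)] continuous_on_eq_continuous_at by blast
  qed
  then show ?thesis by (simp add: continuous_on_eq_continuous_at)
qed

text \<open>The group law in exponential coordinates. Its unit is \<open>0\<close>, its inverse is
  \<open>- p\<close>, and on every line through \<open>0\<close> it is ordinary addition
  (\<open>m_scaleR\<close>).\<close>

definition m :: "real^'n \<Rightarrow> real^'n \<Rightarrow> real^'n" where "m p q = inv e (e p + e q)"

lemma e_m: "e (m p q) = e p + e q" by (simp add: m_def)

lemma e_add: "e (s *\<^sub>R v + t *\<^sub>R v) = e (s *\<^sub>R v) + e (t *\<^sub>R v)"
  using exp_map by (simp add: exponential_map_def one_parameter_subgroup_def scaleR_add_left)

lemma e_0 [simp]: "e 0 = 0"
proof -
  have "e 0 + e 0 = e 0 + 0" using e_add[of 0 0 0] by (metis add.right_neutral scaleR_zero_left)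
  then show ?thesis by (rule add_left_imp_eq)
qed

lemma e_minus: "e (- v) = - e v"
proof -
  have "e (- v) + e v = 0" using e_add[of "-1" v 1] by simp
  then show ?thesis by (simp add: eq_neg_iff_add_eq_0)
qed

lemma inv_e_0 [simp]: "inv e 0 = 0"
  using inv_e_e[of 0] by simp

lemma m_assoc: "m (m p q) x = m p (m q x)" by (simp add: m_def add.assoc)
lemma m_0 [simp]: "m p 0 = p" "m 0 p = p" by (simp_all add: m_def)
lemma m_minus [simp]: "m p (- p) = 0" "m (- p) p = 0" by (simp_all add: m_def e_minus)
lemma m_cancel: "m (- p) (m p q) = q" "m p (m (- p) q) = q" by (simp_all flip: m_assoc)
lemma m_scaleR: "m (s *\<^sub>R v) (t *\<^sub>R v) = (s + t) *\<^sub>R v"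
  by (simp add: m_def scaleR_add_left flip: e_add)

lemma minus_m: "- m p q = m (- q) (- p)"
proof -
  have "e (- m p q) = e (m (- q) (- p))" by (simp add: e_minus e_m minus_add)
  then show ?thesis by (metis inv_e_e)
qed

lemma smooth_m: "smooth_on (\<lambda>z. m (fst z) (snd z)) UNIV"
proof (rule smooth_on_local)
  fix z :: "(real^'n) \<times> (real^'n)"
  obtain p q where z: "z = (p, q)" by force
  obtain U \<phi> where U: "(U, \<phi>) \<in> atlas" "e p \<in> U" by (rule obtain_chart)
  obtain V \<psi> where V: "(V, \<psi>) \<in> atlas" "e q \<in> V" by (rule obtain_chart)
  obtain W \<theta> where W: "(W, \<theta>) \<in> atlas" "e p + e q \<in> W" by (rule obtain_chart)
  define T where "T = {z. e (fst z) \<in> U \<and> e (snd z) \<in> V \<and> e (fst z) + e (snd z) \<in> W}"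
  have "open ((\<lambda>z. e (fst z)) -` U \<inter> (\<lambda>z. e (snd z)) -` V \<inter> (\<lambda>z. e (fst z) + e (snd z)) -` W)"
    using U V W open_chart(1)
    by (intro open_Int open_vimage continuous_intros continuous_on_compose2[OF cont_e]) auto
  also have "\<dots> = T" by (auto simp: T_def)
  finally have oT: "open T" .
  have 1: "smooth_on (\<lambda>z. (\<phi> (e (fst z)), \<psi> (e (snd z)))) T"
    by (intro smooth_on_Pair oT smooth_on_compose[OF _ _ smooth_e[OF U(1)], of _ fst]
          smooth_on_compose[OF _ _ smooth_e[OF V(1)], of _ snd] smooth_on_linear
          bounded_linear_fst bounded_linear_snd) (auto simp: T_def)
  let ?g = "\<lambda>(p, q). \<theta> (inv_into U \<phi> p + inv_into V \<psi> q)"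
  have "smooth_on (\<lambda>z. ?g (\<phi> (e (fst z)), \<psi> (e (snd z)))) T"
    by (rule smooth_on_compose[OF oT 1 smooth_product[OF U(1) V(1) W(1)]]) (auto simp: T_def)
  then have 2: "smooth_on (\<lambda>z. \<theta> (e (fst z) + e (snd z))) T"
    by (rule smooth_on_cong[OF oT, rotated])
      (use inj_chart[OF U(1)] inj_chart[OF V(1)] in \<open>auto simp: T_def inv_into_f_f\<close>)
  have "smooth_on (\<lambda>z. inv e (inv_into W \<theta> (\<theta> (e (fst z) + e (snd z))))) T"
    by (rule smooth_on_compose[OF oT 2, of _ "\<theta> ` W"])
      (use smooth_inv_e W(1) in \<open>auto simp: T_def smooth_fun_def\<close>)
  then have "smooth_on (\<lambda>z. m (fst z) (snd z)) T"
    by (rule smooth_on_cong[OF oT, rotated])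
      (use inj_chart[OF W(1)] in \<open>auto simp: T_def inv_into_f_f m_def\<close>)
  then show "\<exists>T. open T \<and> z \<in> T \<and> smooth_on (\<lambda>z. m (fst z) (snd z)) T"
    using oT U V W z by (auto simp: T_def)
qed

lemma smooth_m_left: "smooth_on (m q) UNIV"
proof -
  have "smooth_on (\<lambda>p. (q, p)) UNIV"
    by (intro smooth_on_Pair smooth_on_linear smooth_on_const bounded_linear_ident open_UNIV)
  from smooth_on_compose[OF _ this smooth_m] show ?thesis by simp
qed

section \<open>Left-invariant fields and the Maurer-Cartan form\<close>

abbreviation "m2 \<equiv> \<lambda>z. m (fst z) (snd z)"

text \<open>\<open>L q v\<close> is the value at \<open>q\<close> of the left-invariant vector field with value \<open>v\<close> at \<open>0\<close>.\<close>

definition L :: "real^'n \<Rightarrow> real^'n \<Rightarrow> real^'n" where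
  "L q v = frechet_derivative m2 (at (q, 0)) (0, v)"
text \<open>Like \<open>L\<close>, a partial derivative of \<open>m2\<close> at a point that moves
  with \<open>q\<close>; smoothness in \<open>q\<close> is then inherited from smoothness of the
  product.\<close>

definition W :: "real^'n \<Rightarrow> real^'n \<Rightarrow> real^'n" where
  "W q w = frechet_derivative m2 (at (- q, q)) (0, w)"

lemma m_has_derivative:
  "((m q) has_derivative (\<lambda>v. frechet_derivative m2 (at (q, p)) (0, v))) (at p)"
proof -
  have "((\<lambda>x. (q, x)) has_derivative (\<lambda>v. (0, v))) (at p)"
    by (auto intro!: derivative_eq_intros)
  then show ?thesis
    using has_derivative_compose[of "\<lambda>x. (q, x)" _ p UNIV m2]
      smooth_on_has_derivative[OF smooth_m] by auto
qed

lemma L_has_derivative: "(m q has_derivative L q) (at 0)"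
  unfolding L_def[abs_def] by (rule m_has_derivative)

lemma W_has_derivative: "(m (- q) has_derivative W q) (at q)"
  unfolding W_def[abs_def] by (rule m_has_derivative)

lemma linear_L: "linear (L q)" and linear_W: "linear (W q)"
  using L_has_derivative W_has_derivative has_derivative_linear by blast+

lemma smooth_L: "smooth_on (\<lambda>q. L q v) UNIV"
  unfolding L_def
  by (rule smooth_on_compose[OF _ _ smooth_on_frechet_derivative[OF smooth_m]])
    (auto intro!: smooth_on_linear bounded_linear_Pair)

lemma smooth_W: "smooth_on (\<lambda>q. W q v) UNIV"
  unfolding W_def
  by (rule smooth_on_compose[OF _ _ smooth_on_frechet_derivative[OF smooth_m]])
    (auto intro!: smooth_on_linear bounded_linear_Pair bounded_linear_minus)

lemma L_W: "L q (W q w) = w" and W_L: "W q (L q v) = v"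
proof -
  have "((\<lambda>x. m q (m (- q) x)) has_derivative (\<lambda>w. L q (W q w))) (at q)"
    using has_derivative_compose[OF W_has_derivative, of "m q" "L q"] L_has_derivative[of q] by simp
  moreover have "((\<lambda>x. m q (m (- q) x)) has_derivative (\<lambda>w. w)) (at q)"
    by (simp add: m_cancel)
  ultimately have "(\<lambda>w. L q (W q w)) = (\<lambda>w. w)" by (rule has_derivative_unique)
  from fun_cong[OF this] show "L q (W q w) = w" .
  have "((\<lambda>x. m (- q) (m q x)) has_derivative (\<lambda>w. W q (L q w))) (at 0)"
    using has_derivative_compose[OF L_has_derivative, of "m (-q)" "W q"] W_has_derivative[of q] by simp
  moreover have "((\<lambda>x. m (- q) (m q x)) has_derivative (\<lambda>w. w)) (at 0)"
    by (simp add: m_cancel)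
  ultimately have "(\<lambda>w. W q (L q w)) = (\<lambda>w. w)" by (rule has_derivative_unique)
  from fun_cong[OF this] show "W q (L q v) = v" .
qed

text \<open>The map \<open>m y\<close> factors as \<open>m (- p)\<close>, which moves
  \<open>p\<close> to \<open>0\<close>, followed by the translation to \<open>m y p\<close>.
  Jacobians of translations are thereby reduced to those of \<open>L\<close> and
  \<open>W\<close>.\<close>

lemma m_has_derivative_LW: "(m y has_derivative (\<lambda>w. L (m y p) (W p w))) (at p)"
proof -
  have "((\<lambda>x. m (m y p) (m (- p) x)) has_derivative (\<lambda>w. L (m y p) (W p w))) (at p)"
    using has_derivative_compose[OF W_has_derivative, of "m (m y p)" "L (m y p)" p]
      L_has_derivative[of "m y p"] by simp
  then show ?thesis by (simp add: m_assoc m_cancel)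
qed

lemma L_0 [simp]: "L 0 v = v"
proof -
  have "m 0 = (\<lambda>p. p)" by (rule ext) simp
  then have "(m 0 has_derivative (\<lambda>v. v)) (at 0)" by simp
  from has_derivative_unique[OF L_has_derivative this] show ?thesis by (rule fun_cong)
qed

text \<open>The curve \<open>t -> m q (t q)\<close> has initial velocity \<open>L q q\<close>; it is
  also the straight line \<open>(1 + t) q\<close>, as both factors lie in one one-parameter
  subgroup.\<close>

lemma L_self: "L q q = q"
proof -
  have "((\<lambda>t. m q (t *\<^sub>R q)) has_derivative (\<lambda>t. L q (t *\<^sub>R q))) (at 0)"
    by (rule has_derivative_compose[of "\<lambda>t. t *\<^sub>R q"])
      (auto intro!: derivative_eq_intros L_has_derivative)
  moreover have "((\<lambda>t. m q (t *\<^sub>R q)) has_derivative (\<lambda>t. t *\<^sub>R q)) (at 0)"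
  proof -
    have "m q (t *\<^sub>R q) = (1 + t) *\<^sub>R q" for t using m_scaleR[of 1 q t] by simp
    then show ?thesis by (auto intro!: derivative_eq_intros)
  qed
  ultimately have "(\<lambda>t. L q (t *\<^sub>R q)) = (\<lambda>t. t *\<^sub>R q)" by (rule has_derivative_unique)
  from fun_cong[OF this, of 1] show ?thesis by simp
qed

definition DL :: "real^'n \<Rightarrow> real^'n \<Rightarrow> real^'n \<Rightarrow> real^'n" where
  "DL q w v = frechet_derivative (\<lambda>q. L q v) (at q) w"

lemma DL: "((\<lambda>q. L q v) has_derivative (\<lambda>w. DL q w v)) (at q)"
  unfolding DL_def by (rule smooth_on_has_derivative[OF smooth_L]) auto

text \<open>A product rule for \<open>L\<close> with a moving vector. Differentiability in
  \<open>q\<close> is known for each fixed vector only, so the vector is expanded in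
  coordinates.\<close>

lemma L_field_has_derivative:
  assumes "(y has_derivative y') (at q)"
  shows "((\<lambda>q. L q (y q)) has_derivative (\<lambda>w. DL q w (y q) + L q (y' w))) (at q)"
proof -
  have L_sum: "L q v = (\<Sum>i\<in>UNIV. v $ i *\<^sub>R L q (axis i 1))" for q v
  proof -
    have "L q v = L q (\<Sum>i\<in>UNIV. v $ i *\<^sub>R axis i 1)"
      using basis_expansion[of v] by (simp add: scalar_mult_eq_scaleR)
    then show ?thesis by (simp add: linear_sum[OF linear_L] linear_cmul[OF linear_L])
  qed
  have DL_sum: "DL q w v = (\<Sum>i\<in>UNIV. v $ i *\<^sub>R DL q w (axis i 1))" for q w v
  proof -
    have "((\<lambda>q. L q v) has_derivative (\<lambda>w. \<Sum>i\<in>UNIV. v $ i *\<^sub>R DL q w (axis i 1))) (at q)"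
      by (subst L_sum) (auto intro!: has_derivative_sum has_derivative_scaleR_right DL)
    from has_derivative_unique[OF DL this] show ?thesis by (rule fun_cong)
  qed
  have c: "((\<lambda>q. y q $ i) has_derivative (\<lambda>w. y' w $ i)) (at q)" for i
    by (rule bounded_linear.has_derivative[OF bounded_linear_vec_nth assms])
  have "((\<lambda>q. \<Sum>i\<in>UNIV. y q $ i *\<^sub>R L q (axis i 1)) has_derivative
      (\<lambda>w. \<Sum>i\<in>UNIV. y q $ i *\<^sub>R DL q w (axis i 1) + y' w $ i *\<^sub>R L q (axis i 1))) (at q)"
    by (intro has_derivative_sum has_derivative_scaleR c DL)
  then show ?thesis
    by (subst L_sum, subst L_sum, subst DL_sum) (simp add: sum.distrib)
qed

text \<open>Obtained by differentiating \<open>L_self\<close>. It makes one derivative term of the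
  structure equation explicit when an argument is \<open>q\<close> itself.\<close>

lemma DL_self: "DL q w q = w - L q w"
proof -
  have "((\<lambda>q. L q q) has_derivative (\<lambda>w. DL q w q + L q w)) (at q)"
    by (rule L_field_has_derivative) auto
  moreover have "((\<lambda>q. L q q) has_derivative (\<lambda>w. w)) (at q)" by (simp add: L_self)
  ultimately have "(\<lambda>w. DL q w q + L q w) = (\<lambda>w. w)" by (rule has_derivative_unique)
  from fun_cong[OF this, of w] show ?thesis by (simp add: algebra_simps)
qed

lemma j_in: "j v \<in> lie_algebra atlas"
  using iso by (auto simp: lie_algebra_iso_def bij_betw_def)

text \<open>Left invariance moves the base point to the unit, where the one-parameter subgroup of
  \<open>v\<close> computes the derivative; translating back turns its velocity \<open>v\<close>
  into \<open>L q v\<close>.\<close>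

lemma j_eq:
  assumes "smooth_fun atlas f"
  shows "j v f (e q) = frechet_derivative (\<lambda>p. f (e p)) (at q) (L q v)"
proof -
  let ?f = "\<lambda>x. f (e q + x)"
  have sf: "smooth_on (\<lambda>p. f (e p)) UNIV" by (rule smooth_fun_compose_e[OF assms])
  have "smooth_on (\<lambda>p. f (e (m q p))) UNIV"
    by (rule smooth_on_compose[OF _ smooth_m_left sf]) auto
  from smooth_fun_compose_inv_e[OF this] have s: "smooth_fun atlas ?f" by (simp add: e_m)
  have "left_invariant atlas (j v)" using j_in by (simp add: lie_algebra_def)
  then have "j v ?f = (\<lambda>x. j v f (e q + x))" using assms by (simp add: left_invariant_def)
  then have 1: "j v f (e q) = j v ?f 0" by simp
  have 2: "((\<lambda>t. ?f (e (t *\<^sub>R v))) has_real_derivative j v ?f 0) (at 0)"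
    using exp_map s by (auto simp: exponential_map_def one_parameter_subgroup_def)
  have m': "((\<lambda>t. m q (t *\<^sub>R v)) has_derivative (\<lambda>t. L q (t *\<^sub>R v))) (at 0)"
    by (rule has_derivative_compose[of "\<lambda>t. t *\<^sub>R v"])
      (auto intro!: derivative_eq_intros L_has_derivative)
  have "((\<lambda>t. f (e (m q (t *\<^sub>R v)))) has_derivative
      (\<lambda>t. frechet_derivative (\<lambda>p. f (e p)) (at q) (L q (t *\<^sub>R v)))) (at 0)"
    by (rule has_derivative_compose[OF m']) (use smooth_on_has_derivative[OF sf, of q] in simp)
  moreover have "((\<lambda>t. f (e (m q (t *\<^sub>R v)))) has_derivative (*) (j v ?f 0)) (at 0)"
    using 2 by (simp add: e_m has_field_derivative_def)
  ultimately have "(\<lambda>t. frechet_derivative (\<lambda>p. f (e p)) (at q) (L q (t *\<^sub>R v))) = (*) (j v ?f 0)"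
    by (rule has_derivative_unique)
  from fun_cong[OF this, of 1] show ?thesis using 1 by simp
qed

section \<open>The Lie bracket in coordinates\<close>

abbreviation br :: "real^'n \<Rightarrow> real^'n \<Rightarrow> real^'n" where "br \<equiv> lie_bracket j"

text \<open>Needed because \<open>lie_bracket\<close> is read off through \<open>inv j\<close>,
  which is meaningful only on the range of \<open>j\<close>.\<close>

lemma commutator_in_lie_algebra:
  assumes "X \<in> lie_algebra atlas" "Y \<in> lie_algebra atlas"
  shows "commutator X Y \<in> lie_algebra atlas"
proof -
  have X: "vector_field atlas X" "left_invariant atlas X"
    and Y: "vector_field atlas Y" "left_invariant atlas Y"
    using assms by (auto simp: lie_algebra_def)
  have sm: "smooth_on f S \<Longrightarrow> smooth_on g S \<Longrightarrow> open S \<Longrightarrow> smooth_on (\<lambda>x. f x - g x) S"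
    for f g :: "real^'n \<Rightarrow> real" and S
    unfolding smooth_on_def
    using C_k_on_add[of S _ f "\<lambda>x. - g x"] C_k_on_linear_compose[of S uminus _ g]
    by (simp add: bounded_linear_minus bounded_linear_ident)
  have diff: "smooth_fun atlas (\<lambda>x. f x - g x)" if "smooth_fun atlas f" "smooth_fun atlas g" for f g :: "'g \<Rightarrow> real"
    using that open_chart unfolding smooth_fun_def by (auto intro!: sm)
  have add: "smooth_fun atlas (\<lambda>x. f x + g x)" "smooth_fun atlas (\<lambda>x. f x * g x)" if "smooth_fun atlas f" "smooth_fun atlas g" for f g :: "'g \<Rightarrow> real"
    using that open_chart unfolding smooth_fun_def smooth_on_def
    by (auto intro!: C_k_on_add C_k_on_mult)
  have c: "smooth_fun atlas (\<lambda>x. c)" for c :: real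
    using open_chart unfolding smooth_fun_def smooth_on_def by (auto intro!: C_k_on_const)
  have cm: "smooth_fun atlas (\<lambda>x. d * f x)" if "smooth_fun atlas f" for f :: "'g \<Rightarrow> real" and d
    using add(2)[OF c that] .
  note vX = X(1)[unfolded vector_field_def] and vY = Y(1)[unfolded vector_field_def]
  note sX = vX[THEN conjunct1, rule_format]
      vY[THEN conjunct1, rule_format]
    and nX = vX[THEN conjunct2, THEN conjunct1, rule_format]
      vY[THEN conjunct2, THEN conjunct1, rule_format]
    and cX = vX[THEN conjunct2, THEN conjunct2, THEN conjunct2, THEN conjunct1, rule_format]
      vY[THEN conjunct2, THEN conjunct2, THEN conjunct2, THEN conjunct1, rule_format]
    and aX = vX[THEN conjunct2, THEN conjunct2, THEN conjunct1, rule_format, OF conjI]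
      vY[THEN conjunct2, THEN conjunct2, THEN conjunct1, rule_format, OF conjI]
      vX[THEN conjunct2, THEN conjunct2, THEN conjunct2, THEN conjunct2, rule_format, OF conjI]
      vY[THEN conjunct2, THEN conjunct2, THEN conjunct2, THEN conjunct2, rule_format, OF conjI]
  \<comment> \<open>A function that is not smooth is sent to the zero function, so the second
    derivation is then evaluated at the zero function.\<close>
  have X0: "X (\<lambda>x. 0) = (\<lambda>x. 0)" "Y (\<lambda>x. 0) = (\<lambda>x. 0)"
    using cX(1)[OF c, of 0 0] cX(2)[OF c, of 0 0] by simp_all
  have "vector_field atlas (commutator X Y)"
    unfolding vector_field_def
  proof (intro conjI allI impI; (elim conjE)?)
    fix f :: "'g \<Rightarrow> real" assume f: "smooth_fun atlas f"
    show "smooth_fun atlas (commutator X Y f)"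
      unfolding commutator_def by (intro diff sX f)
    fix d :: real
    show "commutator X Y (\<lambda>x. d * f x) = (\<lambda>x. d * commutator X Y f x)"
      unfolding commutator_def cX[OF f] cX[OF sX(1)[OF f]] cX[OF sX(2)[OF f]]
      by (simp add: algebra_simps)
  next
    fix f :: "'g \<Rightarrow> real" assume f: "\<not> smooth_fun atlas f"
    show "commutator X Y f = (\<lambda>x. 0)"
      unfolding commutator_def nX[OF f] X0 by simp
  next
    fix f g :: "'g \<Rightarrow> real" assume fg: "smooth_fun atlas f" "smooth_fun atlas g"
    show "commutator X Y (\<lambda>x. f x + g x) = (\<lambda>x. commutator X Y f x + commutator X Y g x)"
      unfolding commutator_def aX(1,2)[OF fg] aX(1)[OF sX(2)[OF fg(1)] sX(2)[OF fg(2)]]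
        aX(2)[OF sX(1)[OF fg(1)] sX(1)[OF fg(2)]]
      by (simp add: algebra_simps)
    have s: "smooth_fun atlas (\<lambda>x. X f x * g x)" "smooth_fun atlas (\<lambda>x. f x * X g x)"
      "smooth_fun atlas (\<lambda>x. Y f x * g x)" "smooth_fun atlas (\<lambda>x. f x * Y g x)"
      by (intro add(2) sX fg)+
    show "commutator X Y (\<lambda>x. f x * g x) = (\<lambda>x. commutator X Y f x * g x + f x * commutator X Y g x)"
      unfolding commutator_def aX(3,4)[OF fg] aX(1)[OF s(3,4)] aX(2)[OF s(1,2)]
        aX(3)[OF sX(2)[OF fg(1)] fg(2)] aX(3)[OF fg(1) sX(2)[OF fg(2)]]
        aX(4)[OF sX(1)[OF fg(1)] fg(2)] aX(4)[OF fg(1) sX(1)[OF fg(2)]]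
      by (simp add: algebra_simps)
  qed
  moreover have "left_invariant atlas (commutator X Y)"
    unfolding left_invariant_def commutator_def
  proof (intro allI impI)
    fix y and f :: "'g \<Rightarrow> real" assume f: "smooth_fun atlas f"
    have "X (\<lambda>x. h (y + x)) = (\<lambda>x. X h (y + x))" "Y (\<lambda>x. h (y + x)) = (\<lambda>x. Y h (y + x))"
      if "smooth_fun atlas h" for h
      using X(2) Y(2) that by (simp_all add: left_invariant_def)
    note inv = this[OF f] this(1)[OF sX(2)[OF f]] this(2)[OF sX(1)[OF f]]
    show "(\<lambda>x. X (Y (\<lambda>x. f (y + x))) x - Y (X (\<lambda>x. f (y + x))) x) =
        (\<lambda>x. X (Y f) (y + x) - Y (X f) (y + x))"
      unfolding inv ..
  qed
  ultimately show ?thesis by (simp add: lie_algebra_def)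
qed

lemma j_br: "j (br u v) = commutator (j u) (j v)"
proof -
  have "bij_betw j UNIV (lie_algebra atlas)" using iso by (simp add: lie_algebra_iso_def)
  from bij_betw_inv_into_right[OF this commutator_in_lie_algebra[OF j_in j_in]]
  show ?thesis by (simp add: lie_bracket_def)
qed

text \<open>Test \<open>j_br\<close> on the coordinate functions: by \<open>j_eq\<close> the
  commutator becomes the difference of two directional derivatives of \<open>L\<close>.\<close>

lemma structure_equation: "DL q (L q u) v - DL q (L q v) u = L q (br u v)"
proof (rule vec_eq_iff[THEN iffD2], rule allI)
  fix i
  let ?f = "\<lambda>x. inv e x $ i"
  have s: "smooth_fun atlas ?f"
    by (rule smooth_fun_compose_inv_e) (auto intro!: smooth_on_linear bounded_linear_vec_nth)
  have jv: "j v ?f = (\<lambda>x. L (inv e x) v $ i)" for v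
  proof
    fix x
    have "frechet_derivative (\<lambda>p. p $ i) (at (inv e x)) = (\<lambda>p. p $ i)"
      by (rule frechet_derivative_at[symmetric])
        (rule bounded_linear_imp_has_derivative[OF bounded_linear_vec_nth])
    then show "j v ?f x = L (inv e x) v $ i"
      using j_eq[OF s, of v "inv e x"] by simp
  qed
  have sj: "smooth_fun atlas (j v ?f)" for v
    using s j_in[of v] by (auto simp: lie_algebra_def vector_field_def)
  have jj: "j u (j v ?f) (e q) = DL q (L q u) v $ i" for u v
  proof -
    have "((\<lambda>p. L p v $ i) has_derivative (\<lambda>w. DL q w v $ i)) (at q)"
      by (rule bounded_linear.has_derivative[OF bounded_linear_vec_nth DL])
    from frechet_derivative_at[OF this] show ?thesis
      unfolding j_eq[OF sj, of u v q] unfolding jv by simp metis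
  qed
  have "L q (br u v) $ i = commutator (j u) (j v) ?f (e q)"
    unfolding j_br[symmetric] jv by simp
  then show "(DL q (L q u) v - DL q (L q v) u) $ i = L q (br u v) $ i"
    by (simp add: commutator_def jj)
qed

text \<open>Differentiate \<open>L q (W q w) = w\<close> in the direction \<open>q\<close> and use the structure equation with \<open>u = q\<close>.\<close>

lemma W_equation:
  assumes D: "((\<lambda>q. W q w) has_derivative D) (at q)"
  shows "D q = w - W q w - br q (W q w)"
proof -
  have "((\<lambda>q. L q (W q w)) has_derivative (\<lambda>x. DL q x (W q w) + L q (D x))) (at q)"
    by (rule L_field_has_derivative[OF D])
  moreover have "((\<lambda>q. L q (W q w)) has_derivative (\<lambda>x. 0)) (at q)" by (simp add: L_W)
  ultimately have "(\<lambda>x. DL q x (W q w) + L q (D x)) = (\<lambda>x. 0)" by (rule has_derivative_unique)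
  from fun_cong[OF this, of q] have 1: "L q (D q) = - DL q q (W q w)"
    by (rule minus_unique[symmetric])
  have "DL q q (W q w) - DL q w q = L q (br q (W q w))"
    using structure_equation[of q q "W q w"] by (simp add: L_self L_W)
  then have "DL q q (W q w) = L q (br q (W q w)) + (w - L q w)"
    by (simp only: DL_self diff_eq_eq)
  then have "L q (D q) = L q w - w - L q (br q (W q w))"
    unfolding 1 by (simp add: algebra_simps)
  also have "\<dots> = L q (w - W q w - br q (W q w))"
    by (simp add: linear_diff[OF linear_L] L_W)
  finally show ?thesis by (metis W_L)
qed

lemma linear_DL: "linear (\<lambda>w. DL q w v)" "linear (\<lambda>v. DL q w v)"
proof -
  show "linear (\<lambda>w. DL q w v)" using DL by (rule has_derivative_linear)
  show "linear (\<lambda>v. DL q w v)"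
  proof (rule linearI)
    fix u v and c :: real
    have "((\<lambda>q. L q (u + v)) has_derivative (\<lambda>w. DL q w u + DL q w v)) (at q)"
      by (simp add: linear_add[OF linear_L] has_derivative_add DL)
    from has_derivative_unique[OF DL this] show "DL q w (u + v) = DL q w u + DL q w v" by (rule fun_cong)
    have "((\<lambda>q. L q (c *\<^sub>R v)) has_derivative (\<lambda>w. c *\<^sub>R DL q w v)) (at q)"
      by (simp add: linear_cmul[OF linear_L] has_derivative_scaleR_right DL)
    from has_derivative_unique[OF DL this] show "DL q w (c *\<^sub>R v) = c *\<^sub>R DL q w v" by (rule fun_cong)
  qed
qed

text \<open>At the unit \<open>L\<close> is the identity, so the structure equation expresses the
  bracket through the bilinear map \<open>DL 0\<close>.\<close>

lemma linear_br: "linear (\<lambda>u. br u v)" "linear (br u)"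
proof -
  have eq: "br = (\<lambda>u v. DL 0 u v - DL 0 v u)"
  proof (intro ext)
    fix u v show "br u v = DL 0 u v - DL 0 v u" using structure_equation[of 0 u v] by simp
  qed
  show "linear (\<lambda>u. br u v)" "linear (br u)"
    unfolding eq by (intro linear_compose_sub linear_DL)+
qed

end

section \<open>Weights and unitriangularity\<close>

lemma vec_eq_sum_axis: "(x :: real^'n) = (\<Sum>i\<in>UNIV. x $ i *\<^sub>R axis i 1)"
  using basis_expansion[of x] by (simp add: scalar_mult_eq_scaleR)

locale graded_coordinates = exponential_coordinates atlas j e
  for atlas :: "('g::{topological_group_add, t2_space, second_countable_topology}, 'n::finite) chart set"
    and j e +
  fixes \<nu> :: "'n \<Rightarrow> real"
  assumes weight_pos: "\<nu> i > 0"
    and bracket_dilation: "r > 0 \<Longrightarrow>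
      lie_bracket j (diag_dilation \<nu> r u) (diag_dilation \<nu> r v) = diag_dilation \<nu> r (lie_bracket j u v)"
begin

text \<open>Applying a dilation shows that a nonzero component \<open>i\<close> of the bracket of
  basis vectors \<open>k\<close> and \<open>l\<close> forces
  \<open>\<nu> i = \<nu> k + \<nu> l\<close>, which exceeds \<open>\<nu> l\<close> since weights are
  positive. The factor 2 stands for any \<open>r > 1\<close>.\<close>

lemma br_axis_eq_0:
  assumes "\<nu> i \<le> \<nu> l" shows "br (axis k 1) (axis l 1) $ i = 0"
proof (rule ccontr)
  assume nz: "br (axis k 1) (axis l 1) $ i \<noteq> 0"
  have ax: "diag_dilation \<nu> 2 (axis k 1) = (2 powr \<nu> k) *\<^sub>R axis k 1" for k
    by (auto simp: diag_dilation_def vec_eq_iff axis_def)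
  have "2 powr \<nu> k *\<^sub>R 2 powr \<nu> l *\<^sub>R br (axis k 1) (axis l 1)
      = diag_dilation \<nu> 2 (br (axis k 1) (axis l 1))"
    using bracket_dilation[of 2 "axis k 1" "axis l 1"]
    by (simp only: ax linear_cmul[OF linear_br(1)] linear_cmul[OF linear_br(2)]) (simp add: mult.commute)
  from arg_cong[OF this, of "\<lambda>x. x $ i"] nz
  have "2 powr (\<nu> k + \<nu> l) = 2 powr \<nu> i"
    by (simp add: diag_dilation_def powr_add)
  then have "\<nu> k + \<nu> l = \<nu> i" by (subst (asm) powr_inj) auto
  then show False using assms weight_pos[of k] by simp
qed

lemma br_axis_raises:
  assumes "\<nu> i \<le> \<nu> l" shows "br p (axis l 1) $ i = 0"
proof -
  have "br p (axis l 1) = br (\<Sum>k\<in>UNIV. p $ k *\<^sub>R axis k 1) (axis l 1)"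
    by (simp only: vec_eq_sum_axis[symmetric])
  then show ?thesis
    by (simp add: linear_sum[OF linear_br(1)] linear_cmul[OF linear_br(1)] br_axis_eq_0 assms)
qed

lemma br_component: "br p v $ i = (\<Sum>l\<in>UNIV. v $ l * br p (axis l 1) $ i)"
proof -
  have "br p v = br p (\<Sum>l\<in>UNIV. v $ l *\<^sub>R axis l 1)"
    by (simp only: vec_eq_sum_axis[symmetric])
  then show ?thesis
    by (simp add: linear_sum[OF linear_br(2)] linear_cmul[OF linear_br(2)])
qed

text \<open>Along the ray \<open>t \<mapsto> t p\<close> the field \<open>J = t W(t p) w\<close> solves \<open>J' = w - [p, J]\<close>, and the bracket
  with \<open>p\<close> strictly raises weights.\<close>

lemma W_unitriangular:
  assumes "\<nu> i \<le> \<nu> k" shows "W p (axis k 1) $ i = (if i = k then 1 else 0)"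
proof -
  define w :: "real^'n" where "w = axis k 1"
  define J where "J t = t *\<^sub>R W (t *\<^sub>R p) w" for t
  have dJ: "((\<lambda>t. J t $ i) has_real_derivative w $ i - br p (J t) $ i) (at t)" for t i
  proof -
    define D where "D = frechet_derivative (\<lambda>q. W q w) (at (t *\<^sub>R p))"
    have D: "((\<lambda>q. W q w) has_derivative D) (at (t *\<^sub>R p))"
      unfolding D_def by (rule smooth_on_has_derivative[OF smooth_W]) auto
    have "((\<lambda>t. W (t *\<^sub>R p) w) has_derivative (\<lambda>s. D (s *\<^sub>R p))) (at t)"
      by (rule has_derivative_compose[where g = "\<lambda>q. W q w" and f = "\<lambda>t. t *\<^sub>R p", OF _ D])
        (auto intro!: derivative_eq_intros)
    then have "(J has_derivative (\<lambda>s. t *\<^sub>R D (s *\<^sub>R p) + s *\<^sub>R W (t *\<^sub>R p) w)) (at t)"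
      unfolding J_def[abs_def] by (auto intro!: derivative_eq_intros)
    moreover have "t *\<^sub>R D (s *\<^sub>R p) + s *\<^sub>R W (t *\<^sub>R p) w = s *\<^sub>R (w - br p (J t))" for s
    proof -
      note lD = linear_cmul[OF has_derivative_linear[OF D]]
      \<comment> \<open>\<open>W_equation\<close> gives \<open>D\<close> only in the direction of
        its base point \<open>t p\<close>; linearity moves the factor \<open>t\<close> into the
        argument.\<close>
      have "t *\<^sub>R D (s *\<^sub>R p) = s *\<^sub>R D (t *\<^sub>R p)" by (simp add: lD)
      also have "\<dots> = s *\<^sub>R (w - W (t *\<^sub>R p) w - br p (J t))"
        by (simp add: W_equation[OF D] J_def linear_cmul[OF linear_br(1)] linear_cmul[OF linear_br(2)])
      finally show ?thesis by (simp add: algebra_simps)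
    qed
    ultimately have "(J has_derivative (\<lambda>s. s *\<^sub>R (w - br p (J t)))) (at t)" by simp
    from bounded_linear.has_derivative[OF bounded_linear_vec_nth this, of i]
    moreover have "(\<lambda>s. (s *\<^sub>R (w - br p (J t))) $ i) = (*) (w $ i - br p (J t) $ i)"
      by (simp add: fun_eq_iff)
    ultimately show ?thesis by (simp only: has_field_derivative_def)
  qed
  \<comment> \<open>Induction on the weight, counted by the number of coordinates of strictly
    smaller weight. A component \<open>l\<close> with \<open>\<nu> l < \<nu> i\<close> is not
    \<open>k\<close>, so it vanishes by induction, and the others do not contribute to component
    \<open>i\<close> of the bracket; hence \<open>J' = w\<close> in that component.\<close>
  have "\<forall>t. J t $ i = (if i = k then t else 0)"
    using assms
  proof (induction "card {l. \<nu> l < \<nu> i}" arbitrary: i rule: less_induct)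
    case less
    have IH: "J t $ l = 0" if "\<nu> l < \<nu> i" for l t
    proof -
      have "card {l'. \<nu> l' < \<nu> l} < card {l. \<nu> l < \<nu> i}"
        by (rule psubset_card_mono) (use that in auto)
      from less.hyps[OF this] show ?thesis using less.prems that by auto
    qed
    have "br p (J t) $ i = 0" for t
    proof (subst br_component, rule sum.neutral, rule ballI)
      fix l show "J t $ l * br p (axis l 1) $ i = 0"
        using IH[of l t] br_axis_raises[of i l p] by (cases "\<nu> l < \<nu> i") auto
    qed
    then have d: "((\<lambda>t. J t $ i - t * w $ i) has_real_derivative 0) (at t)" for t
      using dJ[of i t] by (auto intro!: derivative_eq_intros)
    have "J t $ i - t * w $ i = J 0 $ i - 0 * w $ i" for t
      using d by (intro DERIV_isconst_all[where f = "\<lambda>t. J t $ i - t * w $ i"]) blast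
    moreover have "J 0 $ i = 0" by (simp add: J_def)
    ultimately show ?case by (auto simp: w_def axis_def)
  qed
  from spec[OF this, of 1] show ?thesis by (simp add: J_def w_def)
qed

end

subsection \<open>Haar measure\<close>

text \<open>In the permutation expansion a nonzero term must have
  \<open>\<nu> (\<sigma> i) \<le> \<nu> i\<close> for all \<open>i\<close>, strictly where
  \<open>\<sigma>\<close> moves \<open>i\<close>. Since a permutation preserves the sum of the
  weights, only the identity contributes. This avoids choosing an ordering of indices of equal
  weight.\<close>

lemma det_unitriangular:
  fixes A :: "real^'n^'n" and \<nu> :: "'n::finite \<Rightarrow> real"
  assumes A: "\<And>i k. \<nu> i \<le> \<nu> k \<Longrightarrow> A $ i $ k = (if i = k then 1 else 0)"
  shows "det A = 1"
proof -
  have "(\<Prod>i\<in>UNIV. A $ i $ \<sigma> i) = 0" if \<sigma>: "\<sigma> permutes UNIV" "\<sigma> \<noteq> id" for \<sigma>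
  proof (rule ccontr)
    assume "(\<Prod>i\<in>UNIV. A $ i $ \<sigma> i) \<noteq> 0"
    then have nz: "A $ i $ \<sigma> i \<noteq> 0" for i by simp
    have le: "\<nu> (\<sigma> i) \<le> \<nu> i" for i using A[of i "\<sigma> i"] nz[of i] by (metis linear)
    obtain i where i: "\<sigma> i \<noteq> i" using \<sigma>(2) by (auto simp: fun_eq_iff)
    then have "\<nu> (\<sigma> i) < \<nu> i" using A[of i "\<sigma> i"] nz[of i] by (metis not_le)
    then have "(\<Sum>i\<in>UNIV. \<nu> (\<sigma> i)) < (\<Sum>i\<in>UNIV. \<nu> i)"
      by (intro sum_strict_mono_ex1) (use le in auto)
    then show False using sum.permute[OF \<sigma>(1), of \<nu>] by (simp add: o_def)
  qed
  then have "det A = (\<Sum>\<sigma>\<in>{\<sigma>. \<sigma> permutes (UNIV::'n set)}. if \<sigma> = id then 1 else 0)"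
    unfolding det_def by (intro sum.cong refl) (auto simp: A sign_id)
  also have "\<dots> = 1"
    by (simp add: sum.delta' finite_permutations permutes_id)
  finally show ?thesis .
qed

text \<open>The change-of-variables theorem of the library needs a well-ordered index type.\<close>

typedef 'a ordered = "UNIV :: 'a set" by auto

instance ordered :: (finite) finite
proof
  have "UNIV = range (Abs_ordered :: 'a \<Rightarrow> 'a ordered)"
    by (metis (no_types, lifting) Rep_ordered_inverse UNIV_eq_I rangeI)
  then show "finite (UNIV :: 'a ordered set)" by (metis finite finite_imageI)
qed

instantiation ordered :: (finite) wellorder
begin

definition "x \<le> y \<longleftrightarrow> to_nat (Rep_ordered x) \<le> to_nat (Rep_ordered y)"
definition "x < y \<longleftrightarrow> to_nat (Rep_ordered x) < to_nat (Rep_ordered y)"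

instance
proof
  fix P :: "'a ordered \<Rightarrow> bool" and a :: "'a ordered"
  assume step: "\<And>x. (\<And>y. y < x \<Longrightarrow> P y) \<Longrightarrow> P x"
  show "P a"
  proof (induction "to_nat (Rep_ordered a)" arbitrary: a rule: less_induct)
    case less
    show ?case by (rule step, rule less) (simp add: less_ordered_def)
  qed
qed (auto simp: less_eq_ordered_def less_ordered_def Rep_ordered_inject)

end

definition to_ordered :: "real^'n \<Rightarrow> real^'n ordered" where
  "to_ordered x = (\<chi> i. x $ Rep_ordered i)"
definition of_ordered :: "real^'n ordered \<Rightarrow> real^'n" where
  "of_ordered x = (\<chi> i. x $ Abs_ordered i)"

lemma of_to_ordered [simp]: "of_ordered (to_ordered x) = x" "to_ordered (of_ordered y) = y"
  by (simp_all add: of_ordered_def to_ordered_def Abs_ordered_inverse Rep_ordered_inverse vec_eq_iff)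

lemma linear_to_ordered: "linear (to_ordered :: real^'n::finite \<Rightarrow> _)"
  and linear_of_ordered: "linear (of_ordered :: _ \<Rightarrow> real^'n::finite)"
  by (auto intro!: linearI simp: of_ordered_def to_ordered_def vec_eq_iff)

lemma prod_Basis_cart:
  fixes x :: "real^'n::finite"
  shows "(\<Prod>b\<in>Basis. x \<bullet> b) = (\<Prod>i\<in>UNIV. x $ i)"
proof -
  have B: "(Basis :: (real^'n) set) = range (\<lambda>i. axis i 1)" by (auto simp: Basis_vec_def)
  show ?thesis unfolding B
    by (subst prod.reindex) (auto simp: inj_on_def axis_eq_axis inner_axis)
qed

lemma borel_measurable_linear:
  "linear f \<Longrightarrow> (f :: 'a::euclidean_space \<Rightarrow> 'b::euclidean_space) \<in> borel_measurable borel"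
  by (intro borel_measurable_continuous_onI linear_continuous_on) (simp add: linear_conv_bounded_linear)

lemma distr_lborel_of_ordered: "distr lborel borel (of_ordered :: _ \<Rightarrow> real^'n::finite) = lborel"
proof (rule lborel_eqI[symmetric])
  fix l u :: "real^'n"
  assume le: "\<And>b. b \<in> Basis \<Longrightarrow> l \<bullet> b \<le> u \<bullet> b"
  have le': "l $ i \<le> u $ i" for i using le[of "axis i 1"] by (auto simp: Basis_vec_def inner_axis)
  have "of_ordered -` box l u = box (to_ordered l) (to_ordered u)"
  proof -
    have "(\<forall>i. P (Rep_ordered i)) \<longleftrightarrow> (\<forall>i. P i)" for P :: "'n \<Rightarrow> bool"
      by (metis Abs_ordered_inverse UNIV_I)
    note this[where P = "\<lambda>i. l $ i < y $ Abs_ordered i \<and> y $ Abs_ordered i < u $ i" for y]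
    then show ?thesis
      by (auto simp: mem_box_cart of_ordered_def to_ordered_def Rep_ordered_inverse)
  qed
  then have "emeasure (distr lborel borel of_ordered) (box l u)
      = emeasure lborel (box (to_ordered l) (to_ordered u))"
    by (subst emeasure_distr) (auto intro!: borel_measurable_linear linear_of_ordered)
  also have "\<dots> = ennreal (\<Prod>b\<in>Basis. (to_ordered u - to_ordered l) \<bullet> b)"
    by (subst emeasure_lborel_box) (auto simp: Basis_vec_def inner_axis to_ordered_def le')
  also have "(\<Prod>b\<in>Basis. (to_ordered u - to_ordered l) \<bullet> b) = (\<Prod>i\<in>UNIV. (u - l) $ Rep_ordered i)"
    unfolding prod_Basis_cart by (simp add: to_ordered_def)
  also have "\<dots> = (\<Prod>b\<in>Basis. (u - l) \<bullet> b)"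
    unfolding prod_Basis_cart
    by (rule prod.reindex_bij_betw)
      (metis Abs_ordered_inverse Rep_ordered_inverse UNIV_I bij_betw_byWitness subset_UNIV)
  finally show "emeasure (distr lborel borel of_ordered) (box l u) = ennreal (\<Prod>b\<in>Basis. (u - l) \<bullet> b)" .
qed simp

text \<open>Preimages of boxes under \<open>g\<close> are images under its inverse \<open>f\<close>,
  whose volume the change-of-variables theorem computes with Jacobian 1; volumes of boxes determine
  \<open>lborel\<close>.\<close>

lemma distr_lborel_eq_of_det_1:
  fixes f g :: "real^'m::{finite,wellorder} \<Rightarrow> real^'m::_"
  assumes fg: "\<And>x. f (g x) = x" "\<And>x. g (f x) = x"
    and f': "\<And>x. (f has_derivative f' x) (at x)" "\<And>x. \<bar>det (matrix (f' x))\<bar> = 1"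
    and g: "g \<in> borel_measurable borel"
  shows "distr lborel borel g = lborel"
proof (rule lborel_eqI[symmetric])
  fix l u :: "real^'m::_"
  assume le: "\<And>b. b \<in> Basis \<Longrightarrow> l \<bullet> b \<le> u \<bullet> b"
  have im: "g -` box l u = f ` box l u"
    by (auto simp: fg intro: image_eqI[where x = "g _"])
  have s: "f ` box l u \<in> sets borel"
    using measurable_sets[OF g, of "box l u"] by (simp add: im)
  have "f ` box l u \<in> lmeasurable \<and> measure lebesgue (f ` box l u) = measure lebesgue (box l u)"
  proof (subst has_measure_differentiable_image[where f' = f'])
    show "(f has_derivative f' x) (at x within box l u)" for x
      using f'(1) has_derivative_at_withinI by blast
    show "inj_on f (box l u)" using fg(2) by (metis inj_on_inverseI)
    have "box l u \<in> lmeasurable" by auto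
    moreover have "indicat_real (box l u) = (\<lambda>x. if x \<in> box l u then 1 else 0)"
      by (auto simp: indicator_def)
    ultimately show "((\<lambda>x. \<bar>det (matrix (f' x))\<bar>) has_integral measure lebesgue (box l u)) (box l u)"
      unfolding f'(2) lmeasurable_iff_has_integral by (simp add: has_integral_restrict_UNIV)
  qed auto
  then have "emeasure lebesgue (f ` box l u) = emeasure lebesgue (box l u)"
    by (metis emeasure_eq_measure2 lmeasurable_box)
  then have "emeasure lborel (f ` box l u) = emeasure lborel (box l u)"
    using s by simp
  then show "emeasure (distr lborel borel g) (box l u) = ennreal (\<Prod>b\<in>Basis. (u - l) \<bullet> b)"
    using emeasure_lborel_box[OF le] g by (simp add: emeasure_distr im)
qed simp

lemma distr_lborel_eq_of_det_1_ordered: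
  fixes f g :: "real^'n::finite \<Rightarrow> real^'n"
  assumes fg: "\<And>x. f (g x) = x" "\<And>x. g (f x) = x"
    and f': "\<And>x. (f has_derivative f' x) (at x)"
      "\<And>x. \<bar>det (matrix (\<lambda>w. to_ordered (f' x (of_ordered w))))\<bar> = 1"
    and g[measurable]: "g \<in> borel_measurable borel"
  shows "distr lborel borel g = lborel"
proof -
  have [measurable]: "(of_ordered :: _ \<Rightarrow> real^'n) \<in> borel_measurable borel"
    "(to_ordered :: real^'n \<Rightarrow> _) \<in> borel_measurable borel"
    by (auto intro: borel_measurable_linear linear_of_ordered linear_to_ordered)
  let ?g = "\<lambda>x. to_ordered (g (of_ordered x))"
  have 1: "distr lborel borel ?g = lborel"
  proof (rule distr_lborel_eq_of_det_1[where f = "\<lambda>x. to_ordered (f (of_ordered x))"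
        and f' = "\<lambda>x w. to_ordered (f' (of_ordered x) (of_ordered w))"])
    fix x :: "real^'n ordered"
    have o: "(of_ordered has_derivative of_ordered) (at x)"
      using linear_of_ordered
      by (intro bounded_linear_imp_has_derivative) (simp add: linear_conv_bounded_linear)
    show "((\<lambda>x. to_ordered (f (of_ordered x))) has_derivative
        (\<lambda>w. to_ordered (f' (of_ordered x) (of_ordered w)))) (at x)"
      using bounded_linear.has_derivative[OF _ has_derivative_compose[OF o f'(1)]]
        linear_to_ordered by (auto simp: linear_conv_bounded_linear)
  qed (use fg f' in auto)
  have "distr lborel borel g = distr (distr lborel borel of_ordered) borel g"
    by (simp add: distr_lborel_of_ordered)
  also have "\<dots> = distr (distr lborel borel ?g) borel of_ordered"
    by (simp add: distr_distr o_def)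
  also have "\<dots> = lborel" by (simp add: 1 distr_lborel_of_ordered)
  finally show ?thesis .
qed

section \<open>Invariance of Lebesgue measure and identification of Haar measure\<close>

context graded_coordinates
begin

lemma continuous_m: "continuous_on UNIV (m y)"
  using smooth_m_left by (rule smooth_on_imp_continuous_on)

lemma measurable_m [measurable]: "m y \<in> borel_measurable borel"
  by (intro borel_measurable_continuous_onI continuous_m)

lemma measurable_m2 [measurable]:
  "case_prod m \<in> borel_measurable (borel \<Otimes>\<^sub>M borel)"
proof -
  have "(\<lambda>z. m (fst z) (snd z)) \<in> borel_measurable borel"
    by (intro borel_measurable_continuous_onI smooth_on_imp_continuous_on smooth_m)
  then show ?thesis by (simp add: borel_prod case_prod_beta')
qed

text \<open>By \<open>m_has_derivative_LW\<close> the Jacobian of a translation is the determinant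
  of some \<open>L\<close> times that of some \<open>W\<close>. The latter is 1 by
  \<open>W_unitriangular\<close>, and so is the former because \<open>L q\<close> inverts
  \<open>W q\<close>.\<close>

lemma distr_lborel_m: "distr lborel borel (m y) = lborel"
proof (rule distr_lborel_eq_of_det_1_ordered[where f = "m (- y)"
      and f' = "\<lambda>p w. L (m (- y) p) (W p w)"])
  fix p
  define T :: "(real^'n \<Rightarrow> real^'n) \<Rightarrow> real^'n ordered \<Rightarrow> real^'n ordered"
    where "T F = (\<lambda>w. to_ordered (F (of_ordered w)))" for F
  have lT: "linear (T F)" if "linear F" for F
    using linear_compose[OF linear_compose[OF linear_of_ordered that] linear_to_ordered]
    by (simp add: T_def o_def)
  have W1: "det (matrix (T (W q))) = 1" for q
  proof (rule det_unitriangular[where \<nu> = "\<lambda>i. \<nu> (Rep_ordered i)"])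
    fix i k :: "'n ordered" assume "\<nu> (Rep_ordered i) \<le> \<nu> (Rep_ordered k)"
    moreover have "of_ordered (axis k 1) = axis (Rep_ordered k) 1"
      by (auto simp: of_ordered_def axis_def vec_eq_iff Abs_ordered_inverse Rep_ordered_inverse)
    ultimately show "matrix (T (W q)) $ i $ k = (if i = k then 1 else 0)"
      by (simp add: matrix_def T_def to_ordered_def W_unitriangular Rep_ordered_inject)
  qed
  have L1: "det (matrix (T (L q))) = 1" for q
  proof -
    have "T (L q) \<circ> T (W q) = id" by (auto simp: T_def L_W)
    then have "matrix (T (L q)) ** matrix (T (W q)) = mat 1"
      using matrix_compose[OF lT[OF linear_W] lT[OF linear_L], of q q] matrix_id_mat_1 by metis
    then have "det (matrix (T (L q))) * det (matrix (T (W q))) = 1" by (metis det_I det_mul)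
    then show ?thesis by (simp add: W1)
  qed
  have "T (\<lambda>w. L (m (- y) p) (W p w)) = T (L (m (- y) p)) \<circ> T (W p)" by (auto simp: T_def)
  then have "det (matrix (T (\<lambda>w. L (m (- y) p) (W p w)))) = 1"
    using matrix_compose[OF lT[OF linear_W] lT[OF linear_L], of "m (- y) p" p]
    by (simp add: det_mul W1 L1)
  then show "\<bar>det (matrix (\<lambda>w. to_ordered (L (m (- y) p) (W p (of_ordered w)))))\<bar> = 1"
    by (simp add: T_def)
qed (auto simp: m_cancel m_has_derivative_LW)

lemma nn_integral_lborel_m:
  assumes [measurable]: "f \<in> borel_measurable borel"
  shows "(\<integral>\<^sup>+x. f (m y x) \<partial>lborel) = (\<integral>\<^sup>+x. f x \<partial>lborel)"
proof -
  have "(\<integral>\<^sup>+x. f x \<partial>lborel) = (\<integral>\<^sup>+x. f x \<partial>distr lborel borel (m y))" by (simp add: distr_lborel_m)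
  also have "\<dots> = (\<integral>\<^sup>+x. f (m y x) \<partial>lborel)" by (rule nn_integral_distr) auto
  finally show ?thesis ..
qed

lemma nn_integral_lborel_uminus:
  fixes f :: "real^'n \<Rightarrow> ennreal"
  assumes [measurable]: "f \<in> borel_measurable borel"
  shows "(\<integral>\<^sup>+x. f (- x) \<partial>lborel) = (\<integral>\<^sup>+x. f x \<partial>lborel)"
proof -
  have "lborel = distr lborel borel (uminus :: real^'n \<Rightarrow> _)"
    using lborel_affine[of "-1" "0 :: real^'n"] by (simp add: density_1)
  then have "(\<integral>\<^sup>+x. f x \<partial>lborel) = (\<integral>\<^sup>+x. f x \<partial>distr lborel borel uminus)" by (rule arg_cong)
  also have "\<dots> = (\<integral>\<^sup>+x. f (- x) \<partial>lborel)" by (rule nn_integral_distr) auto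
  finally show ?thesis ..
qed

text \<open>Inversion is \<open>x -> - x\<close>, which preserves \<open>lborel\<close> and
  exchanges right with left translations.\<close>

lemma nn_integral_lborel_m_right:
  assumes [measurable]: "f \<in> borel_measurable borel"
  shows "(\<integral>\<^sup>+x. f (m x y) \<partial>lborel) = (\<integral>\<^sup>+x. f x \<partial>lborel)"
proof -
  have [measurable]: "(\<lambda>x. m x y) \<in> borel_measurable borel"
    using measurable_compose[OF measurable_Pair2' measurable_m2, of y] by simp
  have "(\<integral>\<^sup>+x. f (m x y) \<partial>lborel) = (\<integral>\<^sup>+x. f (m (- x) y) \<partial>lborel)"
    by (rule nn_integral_lborel_uminus[symmetric]) auto
  also have "\<dots> = (\<integral>\<^sup>+x. f (- m (- y) x) \<partial>lborel)" by (simp add: minus_m)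
  also have "\<dots> = (\<integral>\<^sup>+x. f (- x) \<partial>lborel)" by (rule nn_integral_lborel_m) auto
  also have "\<dots> = (\<integral>\<^sup>+x. f x \<partial>lborel)" by (rule nn_integral_lborel_uminus) auto
  finally show ?thesis .
qed

text \<open>The usual Tonelli argument; right and inversion invariance of \<open>lborel\<close> make the modular
  function trivial.\<close>

lemma invariant_measure_unique:
  assumes sets_\<mu> [measurable_cong, simp]: "sets \<mu> = sets borel"
    and inv: "\<And>y. distr \<mu> borel (m y) = \<mu>"
    and fin: "\<And>K. compact K \<Longrightarrow> emeasure \<mu> K < \<infinity>"
    and f [measurable]: "f \<in> borel_measurable borel"
  shows "(\<integral>\<^sup>+x. f x \<partial>\<mu>) = emeasure \<mu> (cbox 0 One) * (\<integral>\<^sup>+x. f x \<partial>lborel)"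
proof -
  have sp: "space \<mu> = UNIV" using sets_eq_imp_space_eq[OF sets_\<mu>] by simp
  interpret \<mu>: sigma_finite_measure \<mu>
  proof (unfold_locales)
    show "\<exists>A. countable A \<and> A \<subseteq> sets \<mu> \<and> \<Union>A = space \<mu> \<and> (\<forall>a\<in>A. emeasure \<mu> a \<noteq> \<infinity>)"
      using fin by (intro exI[of _ "range (\<lambda>n. cball 0 (real n))"])
        (auto simp: sp less_top[symmetric] intro: real_arch_simple)
  qed
  interpret P: pair_sigma_finite \<mu> "lborel :: (real^'n) measure" ..
  have inv': "(\<integral>\<^sup>+x. h (m y x) \<partial>\<mu>) = (\<integral>\<^sup>+x. h x \<partial>\<mu>)" if [measurable]: "h \<in> borel_measurable borel" for h y
  proof -
    have "(\<integral>\<^sup>+x. h x \<partial>\<mu>) = (\<integral>\<^sup>+x. h x \<partial>distr \<mu> borel (m y))" by (simp add: inv)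
    also have "\<dots> = (\<integral>\<^sup>+x. h (m y x) \<partial>\<mu>)" by (rule nn_integral_distr) auto
    finally show ?thesis ..
  qed
  \<comment> \<open>A test function of total mass 1, which makes the factor the
    \<open>\<mu>\<close>-measure of the unit cube. By right invariance the integral of
    \<open>g (m y x)\<close> over \<open>y\<close> is 1, and inserting it starts the
    exchange.\<close>
  define g :: "real^'n \<Rightarrow> ennreal" where "g = indicator (cbox 0 One)"
  have [measurable]: "g \<in> borel_measurable borel" by (simp add: g_def)
  have g1: "(\<integral>\<^sup>+x. g x \<partial>lborel) = 1"
    by (simp add: g_def emeasure_lborel_cbox_eq)
  have "(\<integral>\<^sup>+x. f x \<partial>\<mu>) = (\<integral>\<^sup>+x. (\<integral>\<^sup>+y. f x * g (m y x) \<partial>lborel) \<partial>\<mu>)"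
    by (simp add: nn_integral_cmult nn_integral_lborel_m_right g1)
  also have "\<dots> = (\<integral>\<^sup>+y. (\<integral>\<^sup>+x. f x * g (m y x) \<partial>\<mu>) \<partial>lborel)"
    by (rule P.Fubini'[symmetric]) measurable
  also have "\<dots> = (\<integral>\<^sup>+y. (\<integral>\<^sup>+x. f (m (- y) x) * g x \<partial>\<mu>) \<partial>lborel)"
  proof (rule nn_integral_cong)
    fix y
    show "(\<integral>\<^sup>+x. f x * g (m y x) \<partial>\<mu>) = (\<integral>\<^sup>+x. f (m (- y) x) * g x \<partial>\<mu>)"
      using inv'[of "\<lambda>x. f (m (- y) x) * g x" y] by (simp add: m_cancel)
  qed
  also have "\<dots> = (\<integral>\<^sup>+x. (\<integral>\<^sup>+y. f (m (- y) x) * g x \<partial>lborel) \<partial>\<mu>)"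
    by (rule P.Fubini') measurable
  also have "\<dots> = (\<integral>\<^sup>+x. (\<integral>\<^sup>+y. f y \<partial>lborel) * g x \<partial>\<mu>)"
    by (simp add: nn_integral_multc nn_integral_lborel_uminus[of "\<lambda>y. f (m y _)"] nn_integral_lborel_m_right)
  also have "\<dots> = (\<integral>\<^sup>+y. f y \<partial>lborel) * emeasure \<mu> (cbox 0 One)"
    by (simp add: nn_integral_cmult g_def)
  finally show ?thesis by (simp add: mult.commute)
qed

end

context graded_coordinates
begin

text \<open>The push-forward of \<open>M\<close> to coordinates is invariant under every
  \<open>m y\<close>, hence a multiple of \<open>lborel\<close>; finiteness on the cube and
  positivity on its interior make the factor positive and finite. Measurability of \<open>F\<close>
  is checked in coordinates.\<close>

lemma haar_measure_coordinates:
  assumes M: "haar_measure M"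
  obtains c where "c \<noteq> 0" "c \<noteq> \<infinity>"
    "\<forall>F. (\<lambda>p. F (e p)) \<in> borel_measurable borel \<longrightarrow>
      (\<integral>\<^sup>+x. F x \<partial>M) = c * (\<integral>\<^sup>+p. F (e p) \<partial>lborel)"
proof -
  have sM [measurable_cong, simp]: "sets M = sets borel" and inv: "\<And>y. distr M M (\<lambda>x. y + x) = M"
    and fin: "\<And>K. compact K \<Longrightarrow> emeasure M K < \<infinity>"
    and pos: "\<And>U. open U \<Longrightarrow> U \<noteq> {} \<Longrightarrow> emeasure M U > 0"
    using M by (auto simp: haar_measure_def)
  have spM: "space M = UNIV" using sets_eq_imp_space_eq[OF sM] by simp
  have [measurable]: "inv e \<in> borel_measurable borel" "e \<in> borel_measurable borel"
    by (auto intro: borel_measurable_continuous_onI continuous_inv_e cont_e)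
  have [measurable]: "(\<lambda>x. y + x) \<in> borel_measurable borel" for y :: 'g
    by (intro borel_measurable_continuous_onI continuous_intros)
  define \<mu> where "\<mu> = distr M borel (inv e)"
  define c where "c = emeasure \<mu> (cbox 0 One)"
  have s\<mu>: "sets \<mu> = sets borel" by (simp add: \<mu>_def)
  have em: "emeasure \<mu> X = emeasure M (inv e -` X)" if "X \<in> sets borel" for X
    using that by (simp add: \<mu>_def emeasure_distr spM)
  have inv\<mu>: "distr \<mu> borel (m y) = \<mu>" for y
  proof -
    have "distr \<mu> borel (m y) = distr M borel (\<lambda>x. m y (inv e x))"
      unfolding \<mu>_def by (subst distr_distr) (auto simp: o_def)
    also have "\<dots> = distr M borel (\<lambda>x. inv e (e y + x))" by (simp add: m_def)
    also have "\<dots> = distr (distr M M (\<lambda>x. e y + x)) borel (inv e)"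
      by (subst distr_distr) (auto simp: o_def)
    finally show ?thesis by (simp add: inv \<mu>_def)
  qed
  have vim: "inv e -` X = e ` X" for X by (auto simp: image_iff) (metis e_inv_e)
  have fin\<mu>: "emeasure \<mu> K < \<infinity>" if "compact K" for K
  proof -
    have "compact (e ` K)" using that cont_e by (metis compact_continuous_image continuous_on_subset subset_UNIV)
    then show ?thesis using fin that by (simp add: em vim borel_compact)
  qed
  have "c \<noteq> \<infinity>" using fin\<mu>[of "cbox 0 One"] by (simp add: c_def)
  moreover have "c \<noteq> 0"
  proof -
    have "inv e -` box 0 One \<noteq> {}"
      unfolding vim by (simp add: box_ne_empty)
    moreover have "open (inv e -` box 0 One)"
      by (intro open_vimage continuous_inv_e open_box)
    ultimately have "0 < emeasure \<mu> (box 0 One)" using pos by (simp add: em)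
    also have "\<dots> \<le> c" unfolding c_def by (intro emeasure_mono box_subset_cbox) (simp add: \<mu>_def)
    finally show ?thesis by simp
  qed
  moreover have "(\<integral>\<^sup>+x. F x \<partial>M) = c * (\<integral>\<^sup>+p. F (e p) \<partial>lborel)"
    if [measurable]: "(\<lambda>p. F (e p)) \<in> borel_measurable borel" for F
  proof -
    have "(\<integral>\<^sup>+x. F x \<partial>M) = (\<integral>\<^sup>+x. (\<lambda>p. F (e p)) (inv e x) \<partial>M)" by simp
    also have "\<dots> = (\<integral>\<^sup>+p. F (e p) \<partial>\<mu>)" unfolding \<mu>_def
      by (rule nn_integral_distr[symmetric]) auto
    also have "\<dots> = c * (\<integral>\<^sup>+p. F (e p) \<partial>lborel)" unfolding c_def
      by (rule invariant_measure_unique[OF s\<mu> inv\<mu> fin\<mu> that])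
    finally show ?thesis .
  qed
  ultimately show ?thesis using that by blast
qed

end

subsection \<open>Hardy inequality on the line and integration along orbits\<close>

text \<open>Equality holds for \<open>w = Q * B\<close>, which is where the constant
  \<open>Q powr Q\<close> originates. The coefficient \<open>1 - 1 / Q\<close> of
  \<open>w powr Q\<close> is below 1, so that term can be absorbed. At \<open>Q = 1\<close> the
  conjugate exponent \<open>Q / (Q - 1)\<close> degenerates, hence the case distinction.\<close>

lemma Young_powr:
  fixes w B Q :: real
  assumes "Q \<ge> 1" "w > 0" "B \<ge> 0"
  shows "Q * (w powr (Q - 1) * B) \<le> (1 - 1 / Q) * w powr Q + (1 / Q) * (Q powr Q * B powr Q)"
proof (cases "Q = 1")
  case True
  then show ?thesis using assms by simp
next
  case False
  then have Q: "Q > 1" using assms by simp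
  have "(Q * B) * w powr (Q - 1) \<le> (Q * B) powr Q / Q + (w powr (Q - 1)) powr (Q / (Q - 1)) / (Q / (Q - 1))"
    by (rule Youngs_inequality) (use Q assms in \<open>auto simp: field_simps\<close>)
  also have "(w powr (Q - 1)) powr (Q / (Q - 1)) / (Q / (Q - 1)) = (1 - 1 / Q) * w powr Q"
  proof -
    have "(Q - 1) * (Q / (Q - 1)) = Q" using Q by simp
    then have "(w powr (Q - 1)) powr (Q / (Q - 1)) = w powr Q" by (simp only: powr_powr)
    then show ?thesis using Q by (simp add: field_simps)
  qed
  also have "(Q * B) powr Q / Q = (1 / Q) * (Q powr Q * B powr Q)"
    using Q assms by (simp add: powr_mult)
  finally show ?thesis by (simp add: mult_ac)
qed

text \<open>Integration by parts against \<open>t + c\<close>; the regularisation \<open>(|h|\<^sup>2 + \<epsilon>\<^sup>2)\<^bsup>Q/2\<^esup>\<close> is needed because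
  \<open>|h|\<^bsup>Q\<^esup>\<close> need not be differentiable for small \<open>Q\<close>.\<close>

lemma hardy_interval:
  fixes h h' :: "real \<Rightarrow> complex"
  assumes h': "\<And>t. (h has_vector_derivative h' t) (at t)" and cont: "continuous_on UNIV h'"
    and ab: "a \<le> b" "h a = 0" "h b = 0" and Q: "Q \<ge> 1"
  shows "integral {a..b} (\<lambda>t. cmod (h t) powr Q) \<le>
    Q powr Q * integral {a..b} (\<lambda>t. cmod (of_real (c + t) * h' t) powr Q)"
proof (rule field_le_epsilon)
  fix \<delta>' :: real assume "\<delta>' > 0"
  \<comment> \<open>The regularisation costs \<open>Q * \<delta>\<close> per unit length; the
    summand 1 keeps the denominator positive when \<open>a = b\<close>.\<close>
  define \<delta> where "\<delta> = \<delta>' / (Q * (b - a + 1))"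
  have \<delta>: "\<delta> > 0" using \<open>\<delta>' > 0\<close> ab Q by (simp add: \<delta>_def)
  define \<epsilon> where "\<epsilon> = \<delta> powr (1 / Q)"
  have \<epsilon>: "\<epsilon> > 0" "\<epsilon> powr Q = \<delta>" using \<delta> Q by (auto simp: \<epsilon>_def powr_powr)
  define n where "n t = h t \<bullet> h t + \<epsilon>\<^sup>2" for t
  define B where "B t = cmod (of_real (c + t) * h' t)" for t
  \<comment> \<open>At a zero of \<open>h\<close> the regularised power equals
    \<open>\<epsilon> powr Q = \<delta>\<close>, so subtracting \<open>\<delta>\<close> makes the
    boundary terms vanish.\<close>
  define G where "G t = (c + t) * (n t powr (Q / 2) - \<delta>)" for t
  define G' where "G' t = (n t powr (Q / 2) - \<delta>)
      + (c + t) * (Q / 2 * n t powr (Q / 2 - 1) * (2 * (h t \<bullet> h' t)))" for t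
  have n: "n t > 0" for t using \<epsilon> by (simp add: n_def add_nonneg_pos)
  have n': "(n has_real_derivative 2 * (h t \<bullet> h' t)) (at t)" for t
  proof -
    have "((\<lambda>t. h t \<bullet> h t) has_vector_derivative h t \<bullet> h' t + h' t \<bullet> h t) (at t)"
      by (rule bounded_bilinear.has_vector_derivative[OF bounded_bilinear_inner h' h'])
    then show ?thesis unfolding n_def[abs_def]
      by (auto intro!: derivative_eq_intros simp: has_real_derivative_iff_has_vector_derivative inner_commute)
  qed
  have dG: "(G has_real_derivative G' t) (at t)" for t
    unfolding G_def[abs_def] G'_def
    by (rule derivative_eq_intros refl DERIV_fun_powr[OF n'] n)+ (auto simp: algebra_simps)
  have hcont: "continuous_on UNIV h"
    using h' by (auto intro!: continuous_at_imp_continuous_on has_vector_derivative_continuous)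
  have G0: "G a = 0" "G b = 0"
  proof -
    have "(\<epsilon>\<^sup>2) powr (Q / 2) = \<epsilon> powr Q" using \<epsilon>(1) by (simp add: powr_powr flip: powr_numeral)
    then show "G a = 0" "G b = 0" using ab \<epsilon> by (simp_all add: G_def n_def)
  qed
  have "(G' has_integral (G b - G a)) {a..b}"
    by (rule fundamental_theorem_of_calculus[OF ab(1)])
      (use dG in \<open>auto simp: has_real_derivative_iff_has_vector_derivative
        intro: has_vector_derivative_at_within\<close>)
  then have intG: "((\<lambda>t. Q * G' t) has_integral 0) {a..b}"
    using has_integral_mult_right[of G' 0] by (simp add: G0)
  \<comment> \<open>With the regularised modulus \<open>w\<close>, Cauchy-Schwarz and Young leave
    the fraction \<open>1 / Q\<close> of \<open>w powr Q\<close>; multiplying by \<open>Q\<close>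
    restores it in full.\<close>
  have key: "cmod (h t) powr Q - Q * \<delta> - Q powr Q * B t powr Q \<le> Q * G' t" for t
  proof -
    define w where "w = n t powr (1 / 2)"
    have w: "w > 0" using n[of t] by (simp add: w_def)
    have hw: "cmod (h t) \<le> w"
    proof -
      have "cmod (h t) = sqrt (h t \<bullet> h t)" by (simp add: norm_eq_sqrt_inner)
      also have "\<dots> \<le> sqrt (n t)" by (simp add: n_def)
      finally show ?thesis using n[of t] by (simp add: w_def powr_half_sqrt)
    qed
    have nw: "n t powr (Q / 2) = w powr Q" "n t powr (Q / 2 - 1) = w powr (Q - 2)"
      by (simp_all add: w_def powr_powr diff_divide_distrib)
    have "\<bar>(c + t) * (h t \<bullet> h' t)\<bar> \<le> w * B t"
    proof -
      have "\<bar>(c + t) * (h t \<bullet> h' t)\<bar> \<le> \<bar>c + t\<bar> * (cmod (h t) * cmod (h' t))"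
        unfolding abs_mult by (intro mult_left_mono Cauchy_Schwarz_ineq2) auto
      also have "\<dots> = cmod (h t) * B t" unfolding B_def norm_mult norm_of_real by simp
      also have "\<dots> \<le> w * B t" using hw by (intro mult_right_mono) (auto simp: B_def)
      finally show ?thesis .
    qed
    then have "w powr (Q - 2) * - ((c + t) * (h t \<bullet> h' t)) \<le> w powr (Q - 2) * (w * B t)"
      by (intro mult_left_mono) auto
    also have "\<dots> = w powr (Q - 1) * B t"
      using w by (simp add: powr_mult_base mult.assoc[symmetric] mult.commute[of _ w])
    finally have "Q * (w powr (Q - 2) * - ((c + t) * (h t \<bullet> h' t))) \<le> Q * (w powr (Q - 1) * B t)"
      using Q by (intro mult_left_mono) auto
    also have "\<dots> \<le> (1 - 1 / Q) * w powr Q + (1 / Q) * (Q powr Q * B t powr Q)"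
      by (rule Young_powr[OF Q w]) (simp add: B_def)
    finally have "G' t \<ge> w powr Q - \<delta> - ((1 - 1 / Q) * w powr Q + (1 / Q) * (Q powr Q * B t powr Q))"
      by (simp add: G'_def nw algebra_simps)
    then have "Q * G' t \<ge> Q * (w powr Q - \<delta> - ((1 - 1 / Q) * w powr Q + (1 / Q) * (Q powr Q * B t powr Q)))"
      using Q by (intro mult_left_mono) auto
    also have "Q * (w powr Q - \<delta> - ((1 - 1 / Q) * w powr Q + (1 / Q) * (Q powr Q * B t powr Q)))
        = w powr Q - Q * \<delta> - Q powr Q * B t powr Q"
      using Q by (simp add: field_simps)
    finally have "w powr Q - Q * \<delta> - Q powr Q * B t powr Q \<le> Q * G' t" .
    moreover have "cmod (h t) powr Q \<le> w powr Q" using hw Q by (intro powr_mono2) auto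
    ultimately show ?thesis by linarith
  qed
  let ?I = "integral {a..b} (\<lambda>t. cmod (h t) powr Q)" and ?J = "integral {a..b} (\<lambda>t. B t powr Q)"
  have "((\<lambda>t. cmod (h t) powr Q) has_integral ?I) {a..b}" "((\<lambda>t. B t powr Q) has_integral ?J) {a..b}"
    unfolding B_def using hcont cont Q
    by (intro integrable_integral integrable_continuous_real continuous_on_powr' continuous_intros;
      auto intro: continuous_on_subset)+
  then have "((\<lambda>t. cmod (h t) powr Q - Q * \<delta> - Q powr Q * B t powr Q) has_integral
      (?I - (b - a) * (Q * \<delta>) - Q powr Q * ?J)) {a..b}"
    using has_integral_const_real[of "Q * \<delta>" a b] ab
    by (intro has_integral_diff has_integral_mult_right) auto
  then have "?I - (b - a) * (Q * \<delta>) - Q powr Q * ?J \<le> 0"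
    by (rule has_integral_le[OF _ intG]) (rule key)
  moreover have "(b - a) * (Q * \<delta>) \<le> \<delta>'"
  proof -
    have "(b - a) * (Q * \<delta>) \<le> (b - a + 1) * (Q * \<delta>)" using Q \<delta> by (intro mult_right_mono) auto
    also have "\<dots> = \<delta>'" using ab Q by (simp add: \<delta>_def)
    finally show ?thesis .
  qed
  ultimately show "?I \<le> Q powr Q * integral {a..b} (\<lambda>t. cmod (of_real (c + t) * h' t) powr Q) + \<delta>'"
    by (simp add: B_def)
qed

lemma hardy_real_line:
  fixes h h' :: "real \<Rightarrow> complex"
  assumes h': "\<And>t. (h has_vector_derivative h' t) (at t)" and cont: "continuous_on UNIV h'"
    and supp: "\<And>t. h t \<noteq> 0 \<Longrightarrow> a \<le> t \<and> t \<le> b" and Q: "Q \<ge> 1"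
  shows "(\<integral>\<^sup>+t. ennreal (cmod (h t) powr Q) \<partial>lborel) \<le>
    ennreal (Q powr Q) * (\<integral>\<^sup>+t. ennreal (cmod (of_real (c + t) * h' t) powr Q) \<partial>lborel)"
proof -
  \<comment> \<open>If \<open>a > b\<close>, then \<open>h\<close> vanishes identically;
    \<open>min\<close> and \<open>max\<close> cover this case, and the margin 1 puts both endpoints
    outside the support.\<close>
  define a' where "a' = min a b - 1"
  define b' where "b' = max a b + 1"
  have "\<not> a \<le> a'" "\<not> b' \<le> b" "a' \<le> b'" by (auto simp: a'_def b'_def)
  then have ab: "a' \<le> b'" "h a' = 0" "h b' = 0" using supp by blast+
  have hcont: "continuous_on UNIV h"
    using h' by (auto intro!: continuous_at_imp_continuous_on has_vector_derivative_continuous)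
  have [measurable]: "h \<in> borel_measurable borel" "h' \<in> borel_measurable borel"
    using hcont cont by (auto intro: borel_measurable_continuous_onI)
  let ?f = "\<lambda>t. cmod (h t) powr Q" and ?g = "\<lambda>t. cmod (of_real (c + t) * h' t) powr Q"
  have int: "(?f has_integral integral {a'..b'} ?f) {a'..b'}" "(?g has_integral integral {a'..b'} ?g) {a'..b'}"
    using hcont cont Q
    by (intro integrable_integral integrable_continuous_real continuous_on_powr' continuous_intros;
      auto intro: continuous_on_subset)+
  have "(\<integral>\<^sup>+t. ennreal (?f t) \<partial>lborel) = (\<integral>\<^sup>+t. ennreal (indicator {a'..b'} t * ?f t) \<partial>lborel)"
    by (intro nn_integral_cong) (use supp in \<open>fastforce simp: indicator_def a'_def b'_def\<close>)
  also have "\<dots> = ennreal (integral {a'..b'} ?f)"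
    by (rule nn_integral_has_integral_lebesgue[OF _ int(1)]) auto
  also have "\<dots> \<le> ennreal (Q powr Q * integral {a'..b'} ?g)"
    using hardy_interval[OF h' cont ab Q] by (rule ennreal_leI)
  also have "\<dots> = ennreal (Q powr Q) * ennreal (integral {a'..b'} ?g)"
    by (rule ennreal_mult') simp
  also have "ennreal (integral {a'..b'} ?g) = (\<integral>\<^sup>+t. ennreal (indicator {a'..b'} t * ?g t) \<partial>lborel)"
    by (rule nn_integral_has_integral_lebesgue[OF _ int(2), symmetric]) auto
  also have "\<dots> \<le> (\<integral>\<^sup>+t. ennreal (?g t) \<partial>lborel)"
    by (intro nn_integral_mono ennreal_leI) (auto simp: indicator_def)
  finally show ?thesis by (simp add: mult_left_mono)
qed

section \<open>The dilation flow and integration over its orbits\<close>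

definition flow :: "('n \<Rightarrow> real) \<Rightarrow> real \<Rightarrow> real^'n \<Rightarrow> real^'n::finite" where
  "flow \<nu> t x = diag_dilation \<nu> (exp t) x"

lemma flow_nth: "flow \<nu> t x $ i = exp (t * \<nu> i) * x $ i"
  by (simp add: flow_def diag_dilation_def exp_powr_real)

lemma flow_add: "flow \<nu> s (flow \<nu> t x) = flow \<nu> (s + t) x"
  by (simp add: vec_eq_iff flow_nth distrib_right exp_add)

lemma flow_0 [simp]: "flow \<nu> 0 x = x"
  by (simp add: vec_eq_iff flow_nth)

lemma measurable_flow [measurable]:
  fixes \<nu> :: "'n::finite \<Rightarrow> real"
  assumes [measurable]: "f \<in> borel_measurable M" "g \<in> borel_measurable M"
  shows "(\<lambda>x. flow \<nu> (f x) (g x)) \<in> borel_measurable M"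
proof -
  have "(\<lambda>z. flow \<nu> (fst z) (snd z)) \<in> borel_measurable (borel :: (real \<times> (real^'n)) measure)"
    unfolding flow_def diag_dilation_def
    by (intro borel_measurable_continuous_onI continuous_intros) auto
  then have "(\<lambda>z. flow \<nu> (fst z) (snd z)) \<in> borel_measurable (borel \<Otimes>\<^sub>M borel)"
    by (simp add: borel_prod)
  from measurable_compose[OF _ this, of "\<lambda>x. (f x, g x)" M] show ?thesis by simp
qed

lemma nn_integral_lborel_flow:
  fixes f :: "real^'n::finite \<Rightarrow> ennreal"
  assumes [measurable]: "f \<in> borel_measurable borel"
  shows "(\<integral>\<^sup>+x. f x \<partial>lborel) = (\<integral>\<^sup>+x. f (flow \<nu> t x) * ennreal (exp (t * (\<Sum>i\<in>UNIV. \<nu> i))) \<partial>lborel)"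
proof -
  define v :: "real^'n" where "v = (\<chi> i. exp (t * \<nu> i))"
  have T: "(\<lambda>x. 0 + (\<Sum>b\<in>Basis. ((v \<bullet> b) * (x \<bullet> b)) *\<^sub>R b)) = flow \<nu> t"
  proof (rule ext, rule euclidean_eqI)
    fix x b :: "real^'n" assume b: "b \<in> Basis"
    then obtain i where i: "b = axis i 1" by (auto simp: Basis_vec_def)
    have "(0 + (\<Sum>b\<in>Basis. ((v \<bullet> b) * (x \<bullet> b)) *\<^sub>R b)) \<bullet> b = (v \<bullet> b) * (x \<bullet> b)"
      unfolding add_0 by (rule inner_sum_left_Basis[OF b])
    also have "\<dots> = flow \<nu> t x \<bullet> b" by (simp add: i inner_axis flow_nth v_def)
    finally show "(0 + (\<Sum>b\<in>Basis. ((v \<bullet> b) * (x \<bullet> b)) *\<^sub>R b)) \<bullet> b = flow \<nu> t x \<bullet> b" .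
  qed
  have "(\<Prod>b\<in>Basis. \<bar>v \<bullet> b\<bar>) = (\<Prod>b\<in>Basis. v \<bullet> b)"
    by (intro prod.cong) (auto simp: Basis_vec_def inner_axis v_def)
  also have "\<dots> = exp (t * (\<Sum>i\<in>UNIV. \<nu> i))"
    unfolding prod_Basis_cart sum_distrib_left by (simp add: v_def exp_sum)
  finally have p: "(\<Prod>b\<in>Basis. \<bar>v \<bullet> b\<bar>) = exp (t * (\<Sum>i\<in>UNIV. \<nu> i))" .
  have "v \<bullet> b \<noteq> 0" if "b \<in> Basis" for b
    using that by (auto simp: Basis_vec_def inner_axis v_def)
  from lborel_affine_euclidean[of "\<lambda>b. v \<bullet> b" 0, OF this]
  have "lborel = density (distr lborel borel (flow \<nu> t)) (\<lambda>_. exp (t * (\<Sum>i\<in>UNIV. \<nu> i)))"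
    unfolding T p .
  then have "(\<integral>\<^sup>+x. f x \<partial>lborel) =
      (\<integral>\<^sup>+x. f x \<partial>density (distr lborel borel (flow \<nu> t)) (\<lambda>_. exp (t * (\<Sum>i\<in>UNIV. \<nu> i))))"
    by (rule arg_cong)
  also have "\<dots> = (\<integral>\<^sup>+x. f (flow \<nu> t x) * ennreal (exp (t * (\<Sum>i\<in>UNIV. \<nu> i))) \<partial>lborel)"
    by (simp add: nn_integral_density nn_integral_distr mult.commute)
  finally show ?thesis .
qed

text \<open>A substitute for polar coordinates that needs no surface measure: average over the flow and
  exchange the integrals.\<close>

lemma nn_integral_over_orbits:
  fixes G :: "real^'n::finite \<Rightarrow> ennreal" and \<sigma> :: "real^'n \<Rightarrow> real"
  assumes [measurable]: "G \<in> borel_measurable borel" "S \<in> sets borel" "\<sigma> \<in> borel_measurable borel"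
    and S: "\<And>t x. x \<in> S \<Longrightarrow> flow \<nu> t x \<in> S"
    and \<sigma>: "\<And>t x. x \<in> S \<Longrightarrow> \<sigma> (flow \<nu> t x) = \<sigma> x + t"
  shows "(\<integral>\<^sup>+x. G x * indicator S x \<partial>lborel) =
    (\<integral>\<^sup>+x. (\<integral>\<^sup>+t. G (flow \<nu> t x) * ennreal (exp (t * (\<Sum>i\<in>UNIV. \<nu> i))) \<partial>lborel)
        * indicator {x\<in>S. 0 \<le> \<sigma> x \<and> \<sigma> x < 1} x \<partial>lborel)"
proof -
  let ?W = "{x\<in>S. 0 \<le> \<sigma> x \<and> \<sigma> x < 1}"
  let ?J = "\<lambda>t. ennreal (exp (t * (\<Sum>i\<in>UNIV. \<nu> i)))"
  have S': "flow \<nu> t x \<in> S \<longleftrightarrow> x \<in> S" for t x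
    using S[of x t] S[of "flow \<nu> t x" "- t"] by (auto simp: flow_add)
  \<comment> \<open>The times at which an orbit is in the window \<open>{0..<1}\<close> of
    \<open>\<sigma>\<close> have total length 1, so inserting the window costs nothing.\<close>
  have one: "(\<integral>\<^sup>+t. indicator {0..<1} (\<sigma> x + t) \<partial>lborel) = (1::ennreal)" for x
  proof -
    have "(\<integral>\<^sup>+t. indicator {0..<1} (\<sigma> x + t) \<partial>lborel) = (\<integral>\<^sup>+t. indicator {- \<sigma> x..<1 - \<sigma> x} t \<partial>lborel)"
      by (intro nn_integral_cong) (auto simp: indicator_def)
    then show ?thesis by simp
  qed
  have "(\<integral>\<^sup>+x. G x * indicator S x \<partial>lborel) =
      (\<integral>\<^sup>+x. (\<integral>\<^sup>+t. G x * indicator S x * indicator {0..<1} (\<sigma> x + t) \<partial>lborel) \<partial>lborel)"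
    by (simp add: nn_integral_cmult one)
  also have "\<dots> = (\<integral>\<^sup>+t. (\<integral>\<^sup>+x. G x * indicator S x * indicator {0..<1} (\<sigma> x + t) \<partial>lborel) \<partial>lborel)"
    by (rule lborel_pair.Fubini'[symmetric]) measurable
  also have "\<dots> = (\<integral>\<^sup>+t. (\<integral>\<^sup>+x. G (flow \<nu> (- t) x) * ?J (- t) * indicator ?W x \<partial>lborel) \<partial>lborel)"
  proof (rule nn_integral_cong)
    fix t :: real
    have "(\<integral>\<^sup>+x. G x * indicator S x * indicator {0..<1} (\<sigma> x + t) \<partial>lborel) =
      (\<integral>\<^sup>+x. G (flow \<nu> (- t) x) * indicator S (flow \<nu> (- t) x)
          * indicator {0..<1} (\<sigma> (flow \<nu> (- t) x) + t) * ?J (- t) \<partial>lborel)"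
      by (rule nn_integral_lborel_flow) measurable
    \<comment> \<open>Now \<open>\<sigma> (flow \<nu> (- t) x) + t = \<sigma> x\<close>: the window
      no longer depends on \<open>t\<close> and selects one unit of each orbit.\<close>
    also have "\<dots> = (\<integral>\<^sup>+x. G (flow \<nu> (- t) x) * ?J (- t) * indicator ?W x \<partial>lborel)"
      by (intro nn_integral_cong) (auto simp: indicator_def S' \<sigma>)
    finally show "(\<integral>\<^sup>+x. G x * indicator S x * indicator {0..<1} (\<sigma> x + t) \<partial>lborel) = \<dots>" .
  qed
  also have "\<dots> = (\<integral>\<^sup>+x. (\<integral>\<^sup>+t. G (flow \<nu> (- t) x) * ?J (- t) * indicator ?W x \<partial>lborel) \<partial>lborel)"
    by (rule lborel_pair.Fubini') measurable
  also have "\<dots> = (\<integral>\<^sup>+x. (\<integral>\<^sup>+t. G (flow \<nu> t x) * ?J t \<partial>lborel) * indicator ?W x \<partial>lborel)"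
  proof (rule nn_integral_cong)
    fix x :: "real^'n"
    have "(\<integral>\<^sup>+t. G (flow \<nu> (- t) x) * ?J (- t) * indicator ?W x \<partial>lborel) =
        (\<integral>\<^sup>+t. G (flow \<nu> (- t) x) * ?J (- t) \<partial>lborel) * indicator ?W x"
      by (rule nn_integral_multc) measurable
    also have "(\<integral>\<^sup>+t. G (flow \<nu> (- t) x) * ?J (- t) \<partial>lborel) =
        (\<integral>\<^sup>+t. G (flow \<nu> t x) * ?J t \<partial>distr lborel borel uminus)"
      by (rule nn_integral_distr[symmetric]) measurable
    finally show "(\<integral>\<^sup>+t. G (flow \<nu> (- t) x) * ?J (- t) * indicator ?W x \<partial>lborel) =
        (\<integral>\<^sup>+t. G (flow \<nu> t x) * ?J t \<partial>lborel) * indicator ?W x"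
      by (simp only: lborel_distr_uminus)
  qed
  finally show ?thesis .
qed

text \<open>The group law is gone here: the inequality and its sharpness involve only Lebesgue
  measure, the diagonal flow and a function that is homogeneous of degree 1 under it.\<close>

locale homogeneous_function =
  fixes \<nu> :: "'n::finite \<Rightarrow> real" and N :: "real^'n \<Rightarrow> real" and Q :: real
  assumes \<nu>_pos: "\<nu> i > 0"
    and N_continuous: "continuous_on UNIV N"
    and N_pos: "p \<noteq> 0 \<Longrightarrow> N p > 0"
    and N_0: "N 0 = 0"
    and N_flow: "N (flow \<nu> t p) = exp t * N p"
    and Q_eq: "Q = (\<Sum>i\<in>UNIV. \<nu> i)"
    and Q_ge_1: "Q \<ge> 1"
begin

lemma N_nonneg: "N p \<ge> 0"
  using N_pos[of p] N_0 by (cases "p = 0") auto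

lemma N_measurable [measurable]: "N \<in> borel_measurable borel"
  using N_continuous by (rule borel_measurable_continuous_onI)

text \<open>The Jacobian \<open>exp (t * Q)\<close> of the flow cancels against the homogeneity of
  \<open>N powr Q\<close>, which leaves \<open>dt\<close> on every orbit. The clock
  \<open>\<sigma>\<close> is left open: it is \<open>ln N\<close> for the inequality and a smooth
  substitute for sharpness.\<close>

lemma nn_integral_weighted_orbits:
  fixes g :: "real^'n \<Rightarrow> real"
  assumes [measurable]: "g \<in> borel_measurable borel" "S \<in> sets borel" "\<sigma> \<in> borel_measurable borel"
    and S: "\<And>t x. x \<in> S \<Longrightarrow> flow \<nu> t x \<in> S" and S0: "0 \<notin> S"
    and \<sigma>: "\<And>t x. x \<in> S \<Longrightarrow> \<sigma> (flow \<nu> t x) = \<sigma> x + t"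
  shows "(\<integral>\<^sup>+x. ennreal (g x powr Q / N x powr Q) * indicator S x \<partial>lborel) =
    (\<integral>\<^sup>+x. ennreal (1 / N x powr Q) * (\<integral>\<^sup>+t. ennreal (g (flow \<nu> t x) powr Q) \<partial>lborel)
        * indicator {x\<in>S. 0 \<le> \<sigma> x \<and> \<sigma> x < 1} x \<partial>lborel)"
proof -
  have eq: "ennreal (g (flow \<nu> t x) powr Q / N (flow \<nu> t x) powr Q) * ennreal (exp (t * Q)) =
      ennreal (1 / N x powr Q) * ennreal (g (flow \<nu> t x) powr Q)" if "x \<in> S" for t x
  proof -
    have "N x > 0" using that S0 N_pos by metis
    then have "g (flow \<nu> t x) powr Q / N (flow \<nu> t x) powr Q * exp (t * Q) =
        1 / N x powr Q * g (flow \<nu> t x) powr Q"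
      by (simp add: N_flow powr_mult exp_powr_real)
    then show ?thesis by (simp flip: ennreal_mult')
  qed
  have "(\<integral>\<^sup>+x. ennreal (g x powr Q / N x powr Q) * indicator S x \<partial>lborel) =
    (\<integral>\<^sup>+x. (\<integral>\<^sup>+t. ennreal (g (flow \<nu> t x) powr Q / N (flow \<nu> t x) powr Q) * ennreal (exp (t * Q)) \<partial>lborel)
        * indicator {x\<in>S. 0 \<le> \<sigma> x \<and> \<sigma> x < 1} x \<partial>lborel)"
    unfolding Q_eq by (rule nn_integral_over_orbits) (use S \<sigma> in auto)
  also have "\<dots> = (\<integral>\<^sup>+x. ennreal (1 / N x powr Q) * (\<integral>\<^sup>+t. ennreal (g (flow \<nu> t x) powr Q) \<partial>lborel)
        * indicator {x\<in>S. 0 \<le> \<sigma> x \<and> \<sigma> x < 1} x \<partial>lborel)"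
  proof (rule nn_integral_cong)
    fix x
    show "(\<integral>\<^sup>+t. ennreal (g (flow \<nu> t x) powr Q / N (flow \<nu> t x) powr Q) * ennreal (exp (t * Q)) \<partial>lborel)
        * indicator {x\<in>S. 0 \<le> \<sigma> x \<and> \<sigma> x < 1} x =
      ennreal (1 / N x powr Q) * (\<integral>\<^sup>+t. ennreal (g (flow \<nu> t x) powr Q) \<partial>lborel)
        * indicator {x\<in>S. 0 \<le> \<sigma> x \<and> \<sigma> x < 1} x"
    proof (cases "x \<in> S")
      case True
      then show ?thesis by (simp add: eq nn_integral_cmult)
    qed simp
  qed
  finally show ?thesis .
qed

lemma flow_eq_0_iff: "flow \<nu> t x = 0 \<longleftrightarrow> x = 0"
  by (simp add: vec_eq_iff flow_nth)

text \<open>On the orbit of \<open>x\<close> the function \<open>ln N\<close> is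
  \<open>ln (N x) + t\<close>, so \<open>hardy_real_line\<close> applies with
  \<open>c = ln (N x)\<close>, and the result is integrated over the unit window of the orbits. The
  bounds \<open>n1\<close> and \<open>n2\<close> confine the support on each orbit to a bounded time
  interval.\<close>

lemma hardy_coordinates:
  fixes F E :: "real^'n \<Rightarrow> complex"
  assumes E: "\<And>p. ((\<lambda>t. F (flow \<nu> t p)) has_vector_derivative E p) (at 0)"
    and F_cont: "continuous_on UNIV F" and E_cont: "continuous_on UNIV E"
    and supp: "0 < n1" "\<And>p. F p \<noteq> 0 \<Longrightarrow> n1 \<le> N p \<and> N p \<le> n2"
  shows "(\<integral>\<^sup>+x. ennreal (cmod (F x) powr Q / N x powr Q) \<partial>lborel) \<le>
    ennreal (Q powr Q) * (\<integral>\<^sup>+x. ennreal (cmod (of_real (ln (N x)) * E x) powr Q / N x powr Q) \<partial>lborel)"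
proof -
  have [measurable]: "F \<in> borel_measurable borel" "E \<in> borel_measurable borel"
    using F_cont E_cont by (auto intro: borel_measurable_continuous_onI)
  let ?S = "- {0 :: real^'n}"
  let ?\<sigma> = "\<lambda>x. ln (N x)"
  let ?W = "{x\<in>?S. 0 \<le> ?\<sigma> x \<and> ?\<sigma> x < 1}"
  have full: "(\<integral>\<^sup>+x. G x * indicator ?S x \<partial>lborel) = (\<integral>\<^sup>+x. G x \<partial>lborel)" for G :: "real^'n \<Rightarrow> ennreal"
    by (intro nn_integral_cong_AE) (use AE_lborel_singleton[of "0 :: real^'n"] in \<open>auto elim!: eventually_mono\<close>)
  note orb = nn_integral_weighted_orbits[where S = ?S and \<sigma> = ?\<sigma>]
  have \<sigma>: "?\<sigma> (flow \<nu> t x) = ?\<sigma> x + t" if "x \<in> ?S" for t x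
    using that N_pos[of x] by (simp add: N_flow ln_mult)
  have one: "(\<integral>\<^sup>+t. ennreal (cmod (F (flow \<nu> t x)) powr Q) \<partial>lborel) \<le> ennreal (Q powr Q) *
      (\<integral>\<^sup>+t. ennreal (cmod (of_real (ln (N (flow \<nu> t x))) * E (flow \<nu> t x)) powr Q) \<partial>lborel)"
    if x: "x \<in> ?S" for x
  proof -
    have Nx: "N x > 0" using x N_pos by simp
    \<comment> \<open>\<open>E\<close> is the derivative at time 0 from every starting point; the
      flow property carries it to all times.\<close>
    have "((\<lambda>t. F (flow \<nu> t x)) has_vector_derivative E (flow \<nu> t x)) (at t)" for t
    proof -
      have "((\<lambda>s. F (flow \<nu> s (flow \<nu> t x))) \<circ> (\<lambda>s. s - t) has_vector_derivative 1 *\<^sub>R E (flow \<nu> t x)) (at t)"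
        by (rule vector_diff_chain_at) (use E[of "flow \<nu> t x"] in \<open>auto intro!: derivative_eq_intros\<close>)
      then show ?thesis by (simp add: o_def flow_add)
    qed
    moreover have "continuous_on UNIV (\<lambda>t. E (flow \<nu> t x))"
      by (rule continuous_on_compose2[OF E_cont])
        (auto simp: flow_def diag_dilation_def intro!: continuous_intros)
    moreover have "ln (n1 / N x) \<le> t \<and> t \<le> ln (n2 / N x)" if "F (flow \<nu> t x) \<noteq> 0" for t
    proof -
      have "n1 / N x \<le> exp t" "exp t \<le> n2 / N x" using supp(2)[OF that] Nx by (auto simp: N_flow field_simps)
      moreover have "n1 / N x > 0" using supp(1) Nx by simp
      ultimately show ?thesis
        by (metis exp_gt_zero ln_exp ln_le_cancel_iff order_less_le_trans)
    qed
    ultimately have "(\<integral>\<^sup>+t. ennreal (cmod (F (flow \<nu> t x)) powr Q) \<partial>lborel) \<le> ennreal (Q powr Q) *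
      (\<integral>\<^sup>+t. ennreal (cmod (of_real (?\<sigma> x + t) * E (flow \<nu> t x)) powr Q) \<partial>lborel)"
      by (rule hardy_real_line) (use Q_ge_1 in auto)
    then show ?thesis by (simp only: \<sigma>[OF x])
  qed
  have "(\<integral>\<^sup>+x. ennreal (cmod (F x) powr Q / N x powr Q) \<partial>lborel) =
      (\<integral>\<^sup>+x. ennreal (cmod (F x) powr Q / N x powr Q) * indicator ?S x \<partial>lborel)" by (rule full[symmetric])
  also have "\<dots> = (\<integral>\<^sup>+x. ennreal (1 / N x powr Q) * (\<integral>\<^sup>+t. ennreal (cmod (F (flow \<nu> t x)) powr Q) \<partial>lborel)
        * indicator ?W x \<partial>lborel)"
    by (rule orb) (use \<sigma> in \<open>auto simp: flow_eq_0_iff\<close>)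
  also have "\<dots> \<le> (\<integral>\<^sup>+x. ennreal (Q powr Q) * (ennreal (1 / N x powr Q) *
      (\<integral>\<^sup>+t. ennreal (cmod (of_real (ln (N (flow \<nu> t x))) * E (flow \<nu> t x)) powr Q) \<partial>lborel)
        * indicator ?W x) \<partial>lborel)"
  proof (rule nn_integral_mono)
    fix x
    show "ennreal (1 / N x powr Q) * (\<integral>\<^sup>+t. ennreal (cmod (F (flow \<nu> t x)) powr Q) \<partial>lborel) * indicator ?W x
      \<le> ennreal (Q powr Q) * (ennreal (1 / N x powr Q) *
      (\<integral>\<^sup>+t. ennreal (cmod (of_real (ln (N (flow \<nu> t x))) * E (flow \<nu> t x)) powr Q) \<partial>lborel)
        * indicator ?W x)"
    proof (cases "x \<in> ?W")
      case True
      then show ?thesis using mult_left_mono[OF one[of x], of "ennreal (1 / N x powr Q)"]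
        by (simp add: mult_ac)
    qed simp
  qed
  also have "\<dots> = ennreal (Q powr Q) * (\<integral>\<^sup>+x. ennreal (1 / N x powr Q) *
      (\<integral>\<^sup>+t. ennreal (cmod (of_real (ln (N (flow \<nu> t x))) * E (flow \<nu> t x)) powr Q) \<partial>lborel)
        * indicator ?W x \<partial>lborel)"
    by (rule nn_integral_cmult) measurable
  also have "\<dots> = ennreal (Q powr Q) *
      (\<integral>\<^sup>+x. ennreal (cmod (of_real (ln (N x)) * E x) powr Q / N x powr Q) * indicator ?S x \<partial>lborel)"
    by (subst orb) (use \<sigma> in \<open>auto simp: flow_eq_0_iff\<close>)
  finally show ?thesis by (simp only: full)
qed

end

subsection \<open>Near-extremal functions\<close>

text \<open>The support, from -2 to -1, corresponds to \<open>u\<close> between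
  \<open>- exp (2 * L)\<close> and \<open>- exp L\<close> under \<open>w = - ln (- u) / L\<close>.
  As it stays below 0, the trial functions are pushed to minus infinity when \<open>L\<close>
  grows.\<close>

definition bump :: "real \<Rightarrow> real" where
  "bump w = flat_exp 1 (w + 2) * flat_exp 1 (- 1 - w)"

text \<open>The polynomial \<open>[:0, 0, 1:]\<close> is the one that
  \<open>flat_exp_has_derivative\<close> produces for \<open>p = 1\<close>.\<close>

definition bump' :: "real \<Rightarrow> real" where
  "bump' w = flat_exp [:0, 0, 1:] (w + 2) * flat_exp 1 (- 1 - w) - flat_exp 1 (w + 2) * flat_exp [:0, 0, 1:] (- 1 - w)"

lemma flat_exp_1: "flat_exp 1 x \<ge> 0" "flat_exp 1 x \<le> 1" "flat_exp 1 x > 0 \<longleftrightarrow> x > 0" "flat_exp p x \<noteq> 0 \<Longrightarrow> x > 0"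
  by (auto simp: flat_exp_def split: if_splits)

lemma bump_nonneg: "bump w \<ge> 0" and bump_pos_iff: "bump w > 0 \<longleftrightarrow> - 2 < w \<and> w < - 1"
  and bump_supp: "bump w \<noteq> 0 \<Longrightarrow> - 2 < w \<and> w < - 1" and bump'_supp: "bump' w \<noteq> 0 \<Longrightarrow> - 2 < w \<and> w < - 1"
  by (auto simp: bump_def bump'_def flat_exp_def split: if_splits)

lemma bump_has_derivative: "(bump has_real_derivative bump' w) (at w)"
proof -
  have d: "(flat_exp 1 has_real_derivative flat_exp [:0, 0, 1:] x) (at x)" for x
    using flat_exp_has_derivative[of 1 x] by (simp add: one_pCons pderiv_pCons)
  have "((\<lambda>w. flat_exp 1 (w + 2)) has_real_derivative flat_exp [:0, 0, 1:] (w + 2) * 1) (at w)"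
    by (rule DERIV_chain2[OF d]) (auto intro!: derivative_eq_intros)
  moreover have "((\<lambda>w. flat_exp 1 (- 1 - w)) has_real_derivative flat_exp [:0, 0, 1:] (- 1 - w) * - 1) (at w)"
    by (rule DERIV_chain2[OF d]) (auto intro!: derivative_eq_intros)
  ultimately show ?thesis
    unfolding bump_def[abs_def] bump'_def by (auto intro!: derivative_eq_intros)
qed

lemma continuous_flat_exp: "continuous_on UNIV (flat_exp p)"
  using C_k_on_flat_exp[of 0 p] by simp

lemma continuous_bump: "continuous_on UNIV bump" "continuous_on UNIV bump'"
  unfolding bump_def[abs_def] bump'_def[abs_def]
  by (auto intro!: continuous_intros continuous_on_compose2[OF continuous_flat_exp])

lemma C_k_on_bump: "C_k_on k bump UNIV"
proof -
  have "C_k_on k (\<lambda>w::real. w + 2) UNIV" "C_k_on k (\<lambda>w::real. - 1 - w) UNIV"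
    unfolding diff_conv_add_uminus
    by (intro C_k_on_add C_k_on_linear C_k_on_const bounded_linear_ident bounded_linear_minus open_UNIV)+
  then show ?thesis unfolding bump_def[abs_def]
    by (intro C_k_on_mult C_k_on_compose[OF _ _ C_k_on_flat_exp]) auto
qed

text \<open>In the variable \<open>w = - ln (- u) / L\<close>, the cut-off extremal \<open>(- u)\<^bsup>-1/Q\<^esup>\<close> has a fixed profile, and
  its derivative contributes only terms of order \<open>1 / L\<close>.\<close>

definition profile :: "real \<Rightarrow> real \<Rightarrow> real \<Rightarrow> real" where
  "profile Q L u = (if u < 0 then (- u) powr (- 1 / Q) * bump (- ln (- u) / L) else 0)"

definition profile' :: "real \<Rightarrow> real \<Rightarrow> real \<Rightarrow> real" where
  "profile' Q L u = (if u < 0 then (- u) powr (- 1 / Q - 1) *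
      (bump (- ln (- u) / L) / Q + bump' (- ln (- u) / L) / L) else 0)"

lemma profile_supp:
  assumes "L > 0" "profile Q L u \<noteq> 0 \<or> profile' Q L u \<noteq> 0"
  shows "- exp (2 * L) < u \<and> u < - exp L"
proof -
  have u: "u < 0" and "bump (- ln (- u) / L) \<noteq> 0 \<or> bump' (- ln (- u) / L) \<noteq> 0"
    using assms(2) by (auto simp: profile_def profile'_def split: if_splits)
  then have "- 2 < - ln (- u) / L" "- ln (- u) / L < - 1"
    using bump_supp bump'_supp by blast+
  then have "ln (- u) < 2 * L" "L < ln (- u)" using assms(1) by (simp_all add: field_simps)
  then have "exp (ln (- u)) < exp (2 * L)" "exp L < exp (ln (- u))" by simp_all
  then have "- u < exp (2 * L)" "exp L < - u" using u by simp_all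
  then show ?thesis by linarith
qed

lemma profile_has_derivative:
  assumes "L > 0"
  shows "(profile Q L has_real_derivative profile' Q L u) (at u)"
proof (cases "u < 0")
  case True
  have "((\<lambda>u. - ln (- u) / L) has_real_derivative (1 / (- u)) / L) (at u)"
    using True assms by (auto intro!: derivative_eq_intros simp: field_simps)
  from DERIV_chain2[OF bump_has_derivative this]
  have b: "((\<lambda>u. bump (- ln (- u) / L)) has_real_derivative
      bump' (- ln (- u) / L) * ((1 / (- u)) / L)) (at u)" .
  have p: "((\<lambda>u. (- u) powr (- 1 / Q)) has_real_derivative (1 / Q) * (- u) powr (- 1 / Q - 1)) (at u)"
    using True by (auto intro!: derivative_eq_intros DERIV_fun_powr)
  have m: "(- u) powr (- 1 / Q) / (- u) = (- u) powr (- 1 / Q - 1)"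
    using True by (simp add: powr_diff)
  have "((\<lambda>u. (- u) powr (- 1 / Q) * bump (- ln (- u) / L)) has_real_derivative
      (1 / Q) * (- u) powr (- 1 / Q - 1) * bump (- ln (- u) / L)
      + bump' (- ln (- u) / L) * ((1 / (- u)) / L) * (- u) powr (- 1 / Q)) (at u)"
    by (rule DERIV_mult[OF p b])
  also have "(1 / Q) * (- u) powr (- 1 / Q - 1) * bump (- ln (- u) / L)
      + bump' (- ln (- u) / L) * ((1 / (- u)) / L) * (- u) powr (- 1 / Q)
      = (1 / Q) * (- u) powr (- 1 / Q - 1) * bump (- ln (- u) / L)
      + bump' (- ln (- u) / L) / L * ((- u) powr (- 1 / Q) / (- u))" by simp
  also have "\<dots> = profile' Q L u"
    unfolding m using True by (simp add: profile'_def algebra_simps)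
  finally show ?thesis
    by (rule has_field_derivative_transform_within_open[where S = "{..<0}"])
      (use True in \<open>auto simp: profile_def\<close>)
next
  case False
  \<comment> \<open>The support ends at \<open>- exp L\<close>, which is below -1, so the extension
    by 0 is locally constant around every \<open>u \<ge> 0\<close>.\<close>
  have z: "profile Q L v = 0" "profile' Q L v = 0" if "v > - 1" for v
  proof -
    have "\<not> v < - exp L" using that assms by (smt (verit) one_less_exp_iff)
    then show "profile Q L v = 0" "profile' Q L v = 0" using profile_supp[OF assms] by blast+
  qed
  have "((\<lambda>v. 0) has_real_derivative profile' Q L u) (at u)" using z[of u] False by simp
  then show ?thesis
    by (rule has_field_derivative_transform_within_open[where S = "{- 1<..}"])
      (use z False in auto)
qed

lemma profile_measurable [measurable]:
  "profile Q L \<in> borel_measurable borel" "profile' Q L \<in> borel_measurable borel"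
proof -
  have [measurable]: "bump \<in> borel_measurable borel" "bump' \<in> borel_measurable borel"
    using continuous_bump by (auto intro: borel_measurable_continuous_onI)
  show "profile Q L \<in> borel_measurable borel" "profile' Q L \<in> borel_measurable borel"
    unfolding profile_def[abs_def] profile'_def[abs_def] by measurable
qed

lemma nn_integral_exp_substitution:
  fixes f :: "real \<Rightarrow> real"
  assumes [measurable]: "f \<in> borel_measurable borel" and L: "L > 0"
    and supp: "\<And>u. f u \<noteq> 0 \<Longrightarrow> - exp (2 * L) \<le> u \<and> u \<le> - exp L"
  shows "(\<integral>\<^sup>+u. ennreal (f u) \<partial>lborel) =
    (\<integral>\<^sup>+w. ennreal (f (- exp (- L * w)) * (L * exp (- L * w))) * indicator {- 2..- 1} w \<partial>lborel)"
proof -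
  have "(\<integral>\<^sup>+u. ennreal (f u) \<partial>lborel) =
      (\<integral>\<^sup>+u. ennreal (f u) * indicator {- exp (- L * (- 2))..- exp (- L * (- 1))} u \<partial>lborel)"
    by (intro nn_integral_cong) (use supp in \<open>force simp: indicator_def mult.commute\<close>)
  also have "\<dots> = (\<integral>\<^sup>+w. ennreal (f (- exp (- L * w)) * (L * exp (- L * w))) * indicator {- 2..- 1} w \<partial>lborel)"
    unfolding nn_integral_set_ennreal
    by (rule nn_integral_substitution[where f = f and g = "\<lambda>w. - exp (- L * w)"
          and g' = "\<lambda>w. L * exp (- L * w)" and a = "- 2" and b = "- 1"])
      (use L in \<open>auto intro!: derivative_eq_intros continuous_intros simp: set_borel_measurable_def\<close>)
  finally show ?thesis .
qed

text \<open>The factor \<open>(- u) powr (- 1 / Q)\<close> raised to the power \<open>Q\<close>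
  turns \<open>du\<close> into \<open>L dw\<close>, so \<open>L\<close> appears only in front of the
  integral.\<close>

lemma profile_integral:
  assumes L: "L > 0" and Q: "Q \<ge> 1"
  shows "(\<integral>\<^sup>+u. ennreal (profile Q L u powr Q) \<partial>lborel) =
    ennreal L * (\<integral>\<^sup>+w. ennreal (bump w powr Q) * indicator {- 2..- 1} w \<partial>lborel)"
proof -
  have [measurable]: "bump \<in> borel_measurable borel"
    using continuous_bump by (auto intro: borel_measurable_continuous_onI)
  have eq: "profile Q L (- exp (- L * w)) powr Q * (L * exp (- L * w)) = L * bump w powr Q" for w
  proof -
    have "profile Q L (- exp (- L * w)) = exp (L * w / Q) * bump w"
      using L Q by (simp add: profile_def exp_powr_real)
    then show ?thesis using Q by (simp add: powr_mult bump_nonneg exp_powr_real flip: exp_add)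
  qed
  have "(\<integral>\<^sup>+u. ennreal (profile Q L u powr Q) \<partial>lborel) = (\<integral>\<^sup>+w. ennreal (profile Q L (- exp (- L * w)) powr Q
      * (L * exp (- L * w))) * indicator {- 2..- 1} w \<partial>lborel)"
    by (rule nn_integral_exp_substitution[OF _ L]) (use profile_supp[OF L, of Q] in \<open>auto simp: less_imp_le\<close>)
  also have "\<dots> = (\<integral>\<^sup>+w. ennreal L * (ennreal (bump w powr Q) * indicator {- 2..- 1} w) \<partial>lborel)"
    unfolding eq using L by (simp add: ennreal_mult' mult.assoc)
  finally show ?thesis by (simp add: nn_integral_cmult)
qed

text \<open>\<open>K\<close> stands for the bounded discrepancy between \<open>ln N\<close> and the
  variable \<open>u\<close>. Relative to \<open>|u| = exp (- L * w)\<close> it is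
  \<open>K * exp (L * w)\<close>, which tends to 0 on the support of \<open>bump\<close> as
  \<open>L\<close> grows.\<close>

lemma profile'_integral:
  assumes L: "L > 0" and Q: "Q \<ge> 1" and K: "K \<ge> 0"
  shows "(\<integral>\<^sup>+u. ennreal (((\<bar>u\<bar> + K) * \<bar>profile' Q L u\<bar>) powr Q) \<partial>lborel) =
    ennreal L * (\<integral>\<^sup>+w. ennreal (((1 + K * exp (L * w)) * \<bar>bump w / Q + bump' w / L\<bar>) powr Q)
      * indicator {- 2..- 1} w \<partial>lborel)"
proof -
  have [measurable]: "bump \<in> borel_measurable borel" "bump' \<in> borel_measurable borel"
    using continuous_bump by (auto intro: borel_measurable_continuous_onI)
  have eq: "((\<bar>- exp (- L * w)\<bar> + K) * \<bar>profile' Q L (- exp (- L * w))\<bar>) powr Q * (L * exp (- L * w))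
      = L * ((1 + K * exp (L * w)) * \<bar>bump w / Q + bump' w / L\<bar>) powr Q" for w
  proof -
    define b where "b = \<bar>bump w / Q + bump' w / L\<bar>"
    have "profile' Q L (- exp (- L * w)) = exp (L * w / Q + L * w) * (bump w / Q + bump' w / L)"
      using L Q by (simp add: profile'_def exp_powr_real algebra_simps)
    then have "\<bar>profile' Q L (- exp (- L * w))\<bar> = exp (L * w / Q + L * w) * b"
      by (simp add: abs_mult b_def)
    then have "(\<bar>- exp (- L * w)\<bar> + K) * \<bar>profile' Q L (- exp (- L * w))\<bar> =
        (exp (- L * w) + K) * exp (L * w) * exp (L * w / Q) * b"
      by (simp add: exp_add)
    also have "(exp (- L * w) + K) * exp (L * w) = 1 + K * exp (L * w)"
      by (simp add: distrib_right flip: exp_add)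
    finally have 1: "(\<bar>- exp (- L * w)\<bar> + K) * \<bar>profile' Q L (- exp (- L * w))\<bar> =
        exp (L * w / Q) * ((1 + K * exp (L * w)) * b)" by simp
    have "(exp (L * w / Q) * ((1 + K * exp (L * w)) * b)) powr Q = exp (L * w) * ((1 + K * exp (L * w)) * b) powr Q"
      using Q K by (subst powr_mult) (auto simp: b_def exp_powr_real)
    then show ?thesis unfolding 1 b_def by (simp flip: exp_add)
  qed
  have "(\<integral>\<^sup>+u. ennreal (((\<bar>u\<bar> + K) * \<bar>profile' Q L u\<bar>) powr Q) \<partial>lborel) =
      (\<integral>\<^sup>+w. ennreal (((\<bar>- exp (- L * w)\<bar> + K) * \<bar>profile' Q L (- exp (- L * w))\<bar>) powr Q
      * (L * exp (- L * w))) * indicator {- 2..- 1} w \<partial>lborel)"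
    by (rule nn_integral_exp_substitution[OF _ L]) (use profile_supp[OF L, of Q] in \<open>auto simp: less_imp_le\<close>)
  also have "\<dots> = (\<integral>\<^sup>+w. ennreal L * (ennreal (((1 + K * exp (L * w)) * \<bar>bump w / Q + bump' w / L\<bar>) powr Q)
      * indicator {- 2..- 1} w) \<partial>lborel)"
    unfolding eq using L by (simp add: ennreal_mult' mult.assoc)
  finally show ?thesis by (simp add: nn_integral_cmult)
qed

text \<open>After the substitution both sides carry the same factor \<open>L\<close>. As it grows,
  the terms with \<open>bump'\<close> and with \<open>K\<close> disappear, and the right-hand
  integral tends to \<open>1 / Q powr Q\<close> times the left-hand one.\<close>

lemma profile_sharp:
  assumes Q: "Q \<ge> 1" and K: "K \<ge> 0"
    and C: "\<And>L. L \<ge> L0 \<Longrightarrow> L > 0 \<Longrightarrow> (\<integral>\<^sup>+u. ennreal (profile Q L u powr Q) \<partial>lborel) \<le>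
      ennreal C * (\<integral>\<^sup>+u. ennreal (((\<bar>u\<bar> + K) * \<bar>profile' Q L u\<bar>) powr Q) \<partial>lborel)"
  shows "Q powr Q \<le> C"
proof -
  have [measurable]: "bump \<in> borel_measurable borel" "bump' \<in> borel_measurable borel"
    using continuous_bump by (auto intro: borel_measurable_continuous_onI)
  define I where "I = (\<integral>\<^sup>+w. ennreal (bump w powr Q) * indicator {- 2..- 1} w \<partial>lborel)"
  \<comment> \<open>The summand 1 gives \<open>L n \<ge> 1\<close>, by which
    \<open>bump' w / L n\<close> is bounded uniformly in \<open>n\<close>.\<close>
  define L where "L n = \<bar>L0\<bar> + 1 + real n" for n
  have L: "L n > 0" "L n \<ge> L0" "L n \<ge> 1" for n by (auto simp: L_def)
  have Linf: "filterlim L at_top sequentially" unfolding L_def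
    by (intro filterlim_tendsto_add_at_top[OF tendsto_const] filterlim_real_sequentially)
  define u where "u n w = ((1 + K * exp (L n * w)) * \<bar>bump w / Q + bump' w / L n\<bar>) powr Q" for n w
  obtain M where M: "\<And>w. w \<in> {- 2..- 1} \<Longrightarrow> \<bar>bump' w\<bar> \<le> M" "M \<ge> 0"
  proof -
    have "bounded (bump' ` {- 2..- 1})"
      by (intro compact_imp_bounded compact_continuous_image continuous_on_subset[OF continuous_bump(2)]) auto
    then obtain M where "\<forall>w\<in>{- 2..- 1}. \<bar>bump' w\<bar> \<le> M" by (auto simp: bounded_iff)
    then show ?thesis using that[of "max M 0"] by fastforce
  qed
  have b1: "bump w \<le> 1" for w
    unfolding bump_def using flat_exp_1 by (intro mult_le_one) auto
  have "(\<lambda>n. (\<integral>\<^sup>+w. ennreal (u n w) * indicator {- 2..- 1} w \<partial>lborel)) \<longlonglongrightarrow>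
      (\<integral>\<^sup>+w. ennreal ((bump w / Q) powr Q) * indicator {- 2..- 1} w \<partial>lborel)"
  proof (rule nn_integral_dominated_convergence)
    show "AE w in lborel. ennreal (u n w) * indicator {- 2..- 1} w
        \<le> ennreal (((1 + K) * (1 + M)) powr Q) * indicator {- 2..- 1} w" for n
    proof (rule AE_I2)
      fix w
      have "u n w \<le> ((1 + K) * (1 + M)) powr Q" if w: "w \<in> {- 2..- 1}"
      proof -
        have "K * exp (L n * w) \<le> K * 1"
          using w L(1)[of n] K by (intro mult_left_mono) (auto simp: mult_nonneg_nonpos)
        moreover have "\<bar>bump w / Q + bump' w / L n\<bar> \<le> 1 + M"
        proof -
          have "\<bar>bump w / Q\<bar> \<le> 1" using b1[of w] bump_nonneg[of w] Q by (simp add: divide_le_eq)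
          moreover have "\<bar>bump' w / L n\<bar> \<le> M"
            using M(1)[OF w] M(2) L[of n] mult_left_mono[of 1 "L n" M] by (simp add: abs_divide divide_le_eq)
          ultimately show ?thesis by linarith
        qed
        ultimately show ?thesis unfolding u_def using Q K
          by (intro powr_mono2 mult_mono) (auto intro!: mult_nonneg_nonneg add_nonneg_nonneg)
      qed
      then show "ennreal (u n w) * indicator {- 2..- 1} w
          \<le> ennreal (((1 + K) * (1 + M)) powr Q) * indicator {- 2..- 1} w"
        by (auto simp: indicator_def intro: ennreal_leI)
    qed
    show "(\<integral>\<^sup>+w. ennreal (((1 + K) * (1 + M)) powr Q) * indicator {- 2..- 1 :: real} w \<partial>lborel) < \<infinity>"
      by (simp add: nn_integral_cmult_indicator ennreal_mult_less_top)
    show "AE w in lborel. (\<lambda>n. ennreal (u n w) * indicator {- 2..- 1} w) \<longlonglongrightarrow>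
        ennreal ((bump w / Q) powr Q) * indicator {- 2..- 1} w"
    proof (rule AE_I2)
      fix w :: real
      show "(\<lambda>n. ennreal (u n w) * indicator {- 2..- 1} w) \<longlonglongrightarrow>
        ennreal ((bump w / Q) powr Q) * indicator {- 2..- 1} w"
      proof (cases "w \<in> {- 2..- 1}")
        case True
        have "filterlim (\<lambda>n. w * L n) at_bot sequentially"
          by (rule filterlim_tendsto_neg_mult_at_bot[OF tendsto_const _ Linf]) (use True in auto)
        then have "filterlim (\<lambda>n. L n * w) at_bot sequentially" by (simp only: mult.commute)
        then have e: "(\<lambda>n. exp (L n * w)) \<longlonglongrightarrow> 0" by (rule filterlim_compose[OF exp_at_bot])
        have d: "(\<lambda>n. bump' w / L n) \<longlonglongrightarrow> 0"
          by (rule tendsto_divide_0[OF tendsto_const]) (use Linf filterlim_at_top_imp_at_infinity in blast)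
        have "(\<lambda>n. u n w) \<longlonglongrightarrow> ((1 + K * 0) * \<bar>bump w / Q + 0\<bar>) powr Q"
          unfolding u_def
        proof (rule tendsto_powr'[OF _ tendsto_const])
          show "(\<lambda>n. (1 + K * exp (L n * w)) * \<bar>bump w / Q + bump' w / L n\<bar>)
              \<longlonglongrightarrow> (1 + K * 0) * \<bar>bump w / Q + 0\<bar>"
            by (intro tendsto_intros e d)
        qed (use Q K in auto)
        then have "(\<lambda>n. u n w) \<longlonglongrightarrow> (bump w / Q) powr Q"
          using bump_nonneg[of w] Q by simp
        then show ?thesis using True by (simp add: tendsto_ennrealI)
      qed simp
    qed
  qed (auto simp: u_def)
  also have "(\<integral>\<^sup>+w. ennreal ((bump w / Q) powr Q) * indicator {- 2..- 1} w \<partial>lborel) =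
      (\<integral>\<^sup>+w. ennreal (1 / Q powr Q) * (ennreal (bump w powr Q) * indicator {- 2..- 1} w) \<partial>lborel)"
    using Q bump_nonneg
    by (intro nn_integral_cong) (simp add: powr_divide mult.assoc[symmetric] flip: ennreal_mult')
  also have "\<dots> = ennreal (1 / Q powr Q) * I"
    unfolding I_def by (rule nn_integral_cmult) measurable
  finally have lim: "(\<lambda>n. (\<integral>\<^sup>+w. ennreal (u n w) * indicator {- 2..- 1} w \<partial>lborel)) \<longlonglongrightarrow> ennreal (1 / Q powr Q) * I" .
  have "I \<le> ennreal C * (\<integral>\<^sup>+w. ennreal (u n w) * indicator {- 2..- 1} w \<partial>lborel)" for n
  proof -
    have "ennreal (L n) * I \<le> ennreal (L n) * (ennreal C * (\<integral>\<^sup>+w. ennreal (u n w) * indicator {- 2..- 1} w \<partial>lborel))"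
      using C[OF L(2,1)[of n]]
      unfolding profile_integral[OF L(1) Q] profile'_integral[OF L(1) Q K] I_def[symmetric] u_def
      by (simp add: mult_ac)
    then show ?thesis using L(1)[of n] by (subst (asm) ennreal_mult_le_mult_iff) auto
  qed
  then have "I \<le> ennreal C * (ennreal (1 / Q powr Q) * I)"
    by (intro LIMSEQ_le_const[OF ennreal_tendsto_cmult[OF _ lim]]) auto
  moreover have "I \<noteq> \<infinity>"
  proof -
    have "I \<le> (\<integral>\<^sup>+w. 1 * indicator {- 2..- 1 :: real} w \<partial>lborel)" unfolding I_def
      using b1 bump_nonneg Q by (intro nn_integral_mono) (auto simp: indicator_def powr_le1)
    also have "\<dots> < \<infinity>" by simp
    finally show ?thesis by simp
  qed
  moreover have "I \<noteq> 0"
  proof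
    assume "I = 0"
    then have "AE w in lborel. ennreal (bump w powr Q) * indicator {- 2..- 1} w = 0"
      unfolding I_def by (subst (asm) nn_integral_0_iff_AE) auto
    then have "AE w in lborel. w \<notin> {- 2<..<- 1 :: real}"
    proof eventually_elim
      fix w assume "ennreal (bump w powr Q) * indicator {- 2..- 1} w = 0"
      then show "w \<notin> {- 2<..<- 1}" using bump_pos_iff[of w] by (auto simp: indicator_def)
    qed
    then have "emeasure lborel {- 2<..<- 1 :: real} = 0"
      by (subst (asm) AE_iff_measurable[where N = "{- 2<..<- 1 :: real}"]) auto
    then show False by simp
  qed
  ultimately have "1 \<le> ennreal C * ennreal (1 / Q powr Q)"
    using ennreal_mult_le_mult_iff[of I 1 "ennreal C * ennreal (1 / Q powr Q)"] by (simp add: mult_ac)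
  \<comment> \<open>A negative \<open>C\<close> would be coerced to 0, which the previous inequality
    excludes.\<close>
  then have "1 \<le> C * (1 / Q powr Q)"
    by (simp add: ennreal_mult''[symmetric] ennreal_le_iff2 flip: ennreal_1)
  then show ?thesis using Q by (simp add: field_simps)
qed

context homogeneous_function
begin

text \<open>Since \<open>N\<close> is only continuous, the extremal family cannot be radial. It lives in the half space
  \<open>x\<^sub>0 > 0\<close> of an arbitrary coordinate, whose homogeneous function \<open>exp (\<sigma> x)\<close> is smooth there, and is cut off by the
  dilation-invariant \<open>\<kappa>\<close>. Pushing the support to \<open>\<sigma> \<rightarrow> -\<infinity>\<close> makes the bounded error between \<open>ln N\<close> and \<open>\<sigma>\<close>
  negligible.\<close>

definition i0 :: 'n where "i0 = undefined"
definition H :: "(real^'n) set" where "H = {x. x $ i0 > 0}"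
definition \<sigma> :: "real^'n \<Rightarrow> real" where "\<sigma> x = ln (x $ i0) / \<nu> i0"
definition \<kappa> :: "real^'n \<Rightarrow> real" where
  "\<kappa> x = (\<Sum>i\<in>UNIV - {i0}. x $ i * x $ i * (x $ i0) powr (- 2 * \<nu> i / \<nu> i0))"

lemma flow_H: "x \<in> H \<Longrightarrow> flow \<nu> t x \<in> H"
  by (simp add: H_def flow_nth)

lemma flow_H_iff: "flow \<nu> t x \<in> H \<longleftrightarrow> x \<in> H"
  by (simp add: H_def flow_nth zero_less_mult_iff)

lemma flow_\<sigma>: "x \<in> H \<Longrightarrow> \<sigma> (flow \<nu> t x) = \<sigma> x + t"
  using \<nu>_pos[of i0] by (simp add: H_def \<sigma>_def flow_nth ln_mult field_simps)

lemma flow_\<kappa>: "x \<in> H \<Longrightarrow> \<kappa> (flow \<nu> t x) = \<kappa> x"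
proof -
  assume x: "x \<in> H"
  have "exp (t * \<nu> i) * x $ i * (exp (t * \<nu> i) * x $ i) * (exp (t * \<nu> i0) * x $ i0) powr (- 2 * \<nu> i / \<nu> i0)
      = x $ i * x $ i * (x $ i0) powr (- 2 * \<nu> i / \<nu> i0)" for i
  proof -
    have "exp (t * \<nu> i) * exp (t * \<nu> i) * exp (t * \<nu> i0) powr (- 2 * \<nu> i / \<nu> i0) = 1"
      using \<nu>_pos[of i0] by (simp add: exp_powr_real flip: exp_add)
    then show ?thesis using x by (simp add: powr_mult H_def)
  qed
  then show ?thesis unfolding \<kappa>_def flow_nth by (simp only:)
qed

lemma open_H: "open H"
  unfolding H_def by (intro open_Collect_less continuous_intros)

lemma H_\<kappa>_le_1:
  assumes "x \<in> H" "\<kappa> x \<le> 1" "i \<noteq> i0"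
  shows "\<bar>x $ i\<bar> \<le> (x $ i0) powr (\<nu> i / \<nu> i0)"
proof -
  let ?r = "x $ i0"
  have r: "?r > 0" using assms(1) by (simp add: H_def)
  have "x $ i * x $ i * ?r powr (- 2 * \<nu> i / \<nu> i0) \<le> \<kappa> x"
    unfolding \<kappa>_def by (rule member_le_sum) (use assms in auto)
  then have "(x $ i * x $ i * ?r powr (- 2 * \<nu> i / \<nu> i0)) * ?r powr (2 * \<nu> i / \<nu> i0) \<le> 1 * ?r powr (2 * \<nu> i / \<nu> i0)"
    using assms(2) by (intro mult_right_mono) auto
  then have "(x $ i)\<^sup>2 \<le> (?r powr (\<nu> i / \<nu> i0))\<^sup>2"
    using r by (simp add: mult.assoc power2_eq_square flip: powr_add)
  then have "\<bar>x $ i\<bar> \<le> \<bar>?r powr (\<nu> i / \<nu> i0)\<bar>" by (simp only: abs_le_square_iff)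
  then show ?thesis by simp
qed

text \<open>The difference of \<open>ln N\<close> and \<open>\<sigma>\<close> is constant on orbits.
  Each orbit in question meets the slice where coordinate \<open>i0\<close> is 1, and there
  \<open>\<kappa> \<le> 1\<close> bounds the other coordinates; this part of the slice lies in a
  compact set that avoids \<open>0\<close>, on which \<open>ln N\<close> is bounded.\<close>

lemma ln_N_near_\<sigma>:
  obtains K where "K \<ge> 0" "\<And>x. x \<in> H \<Longrightarrow> \<kappa> x \<le> 1 \<Longrightarrow> \<bar>ln (N x) - \<sigma> x\<bar> \<le> K"
proof -
  define D where "D = cbox (\<chi> i. - 1) (\<chi> i. 1) \<inter> {x :: real^'n. x $ i0 = 1}"
  have "compact D" unfolding D_def
    by (intro compact_Int_closed compact_cbox closed_Collect_eq continuous_intros)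
  moreover have "N x \<noteq> 0" if "x \<in> D" for x
    using N_pos[of x] that by (force simp: D_def)
  then have "continuous_on D (\<lambda>x. ln (N x))"
    by (intro continuous_intros continuous_on_subset[OF N_continuous]) auto
  ultimately have "bounded ((\<lambda>x. ln (N x)) ` D)"
    by (intro compact_imp_bounded compact_continuous_image)
  then obtain K where K: "\<And>x. x \<in> D \<Longrightarrow> \<bar>ln (N x)\<bar> \<le> K" by (auto simp: bounded_iff)
  have "\<bar>ln (N x) - \<sigma> x\<bar> \<le> max K 0" if x: "x \<in> H" "\<kappa> x \<le> 1" for x
  proof -
    define q where "q = flow \<nu> (- \<sigma> x) x"
    have q1: "q $ i0 = 1"
      using x \<nu>_pos[of i0] by (simp add: q_def flow_nth \<sigma>_def H_def exp_minus)
    have q: "q \<in> H" "\<kappa> q \<le> 1" using x by (auto simp: q_def flow_H flow_\<kappa>)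
    have "\<bar>q $ i\<bar> \<le> 1" for i
      using H_\<kappa>_le_1[OF q, of i] q1 by (cases "i = i0") auto
    then have "q \<in> D" by (auto simp: D_def mem_box_cart q1 abs_le_iff minus_le_iff)
    then have "\<bar>ln (N q)\<bar> \<le> K" by (rule K)
    moreover have "N x > 0" using x N_pos[of x] by (force simp: H_def)
    ultimately show ?thesis by (simp add: q_def N_flow ln_mult)
  qed
  then show ?thesis using that[of "max K 0"] by auto
qed

definition trial :: "real \<Rightarrow> real^'n \<Rightarrow> real" where
  "trial L x = (if x \<in> H then profile Q L (\<sigma> x) * flat_exp 1 (1 - \<kappa> x) else 0)"

text \<open>Since \<open>\<kappa>\<close> is constant on orbits, differentiation along the flow hits
  the profile only.\<close>

definition trial' :: "real \<Rightarrow> real^'n \<Rightarrow> real" where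
  "trial' L x = (if x \<in> H then profile' Q L (\<sigma> x) * flat_exp 1 (1 - \<kappa> x) else 0)"

lemma trial_has_derivative:
  assumes "L > 0"
  shows "((\<lambda>t. trial L (flow \<nu> t x)) has_real_derivative trial' L x) (at 0)"
proof (cases "x \<in> H")
  case True
  have "((\<lambda>t. profile Q L (\<sigma> x + t)) has_real_derivative profile' Q L (\<sigma> x + 0) * 1) (at 0)"
    by (rule DERIV_chain2[OF profile_has_derivative[OF assms]]) (auto intro!: derivative_eq_intros)
  then have "((\<lambda>t. profile Q L (\<sigma> x + t) * flat_exp 1 (1 - \<kappa> x)) has_real_derivative trial' L x) (at 0)"
    using True by (auto intro!: derivative_eq_intros simp: trial'_def)
  then show ?thesis using True by (simp add: trial_def flow_H_iff flow_\<sigma> flow_\<kappa>)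
next
  case False
  then show ?thesis by (simp add: trial_def trial'_def flow_H_iff)
qed

lemma trial_supp:
  assumes L: "L > 0" and x: "trial L x \<noteq> 0"
  shows "x \<in> H" "\<kappa> x < 1" "- exp (2 * L) < \<sigma> x" "\<sigma> x < - exp L"
  using x profile_supp[OF L, of Q "\<sigma> x"] flat_exp_1(4)[of 1 "1 - \<kappa> x"]
  by (auto simp: trial_def split: if_splits)

lemma C_k_on_\<kappa>: "C_k_on k \<kappa> H"
  unfolding \<kappa>_def[abs_def]
  by (intro C_k_on_sum C_k_on_mult C_k_on_linear C_k_on_compose[OF _ _ C_k_on_powr] open_H
      bounded_linear_vec_nth) (auto simp: H_def)

text \<open>Two open sets suffice. On \<open>T1\<close> one has \<open>\<sigma> < 0\<close>, so
  every factor is a composition of smooth functions; \<open>T2\<close> lies off the support and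
  contains the boundary of \<open>H\<close>, where the formula itself would be singular.\<close>

lemma smooth_trial:
  assumes L: "L > 0" shows "smooth_on (trial L) UNIV"
proof (rule smooth_on_local)
  fix x :: "real^'n"
  let ?a = "\<nu> i0"
  define T1 where "T1 = {x :: real^'n. x $ i0 > 0 \<and> x $ i0 < 1}"
  define T2 where "T2 = {x :: real^'n. x $ i0 < exp (- ?a * exp (2 * L)) \<or> exp (- ?a * exp L) < x $ i0}"
  have o1: "open T1" unfolding T1_def
    by (intro open_Collect_conj open_Collect_less continuous_intros)
  have o2: "open T2" unfolding T2_def
    by (intro open_Collect_disj open_Collect_less continuous_intros)
  have "exp (- ?a * exp L) < 1" using \<nu>_pos[of i0] by simp
  moreover have "exp (- ?a * exp (2 * L)) > 0" by (rule exp_gt_zero)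
  ultimately have cover: "x \<in> T1 \<or> x \<in> T2"
    unfolding T1_def T2_def mem_Collect_eq by linarith
  have \<sigma>_neg: "\<sigma> x < 0" if "x \<in> T1" for x
    using that \<nu>_pos[of i0] by (simp add: T1_def \<sigma>_def divide_neg_pos)
  have T1H: "T1 \<subseteq> H" by (auto simp: T1_def H_def)
  have s1: "smooth_on (trial L) T1"
    unfolding smooth_on_def
  proof
    fix k
    have "C_k_on k (\<lambda>x. (- 1 / ?a) *\<^sub>R ln (x $ i0)) T1"
      by (intro C_k_on_linear_compose[where h = "\<lambda>y. (- 1 / ?a) *\<^sub>R y"] bounded_linear_scaleR_right o1
          C_k_on_compose[OF _ _ C_k_on_ln] C_k_on_linear bounded_linear_vec_nth) (auto simp: T1_def)
    then have \<sigma>: "C_k_on k (\<lambda>x. - \<sigma> x) T1" by (simp add: \<sigma>_def)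
    have 1: "C_k_on k (\<lambda>x. (- \<sigma> x) powr (- 1 / Q)) T1"
      by (rule C_k_on_compose[OF o1 \<sigma> C_k_on_powr]) (use \<sigma>_neg in auto)
    have "C_k_on k (\<lambda>x. (- 1 / L) *\<^sub>R ln (- \<sigma> x)) T1"
      by (intro C_k_on_linear_compose[where h = "\<lambda>y. (- 1 / L) *\<^sub>R y"] bounded_linear_scaleR_right o1
          C_k_on_compose[OF _ \<sigma> C_k_on_ln]) (use \<sigma>_neg in auto)
    then have "C_k_on k (\<lambda>x. - ln (- \<sigma> x) / L) T1" by simp
    from C_k_on_compose[OF o1 this C_k_on_bump]
    have 2: "C_k_on k (\<lambda>x. bump (- ln (- \<sigma> x) / L)) T1" by simp
    have "C_k_on k (\<lambda>x. 1 + - \<kappa> x) T1"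
      by (intro C_k_on_add C_k_on_const o1 C_k_on_linear_compose[where h = uminus]
          bounded_linear_minus bounded_linear_ident C_k_on_subset[OF C_k_on_\<kappa> T1H])
    from C_k_on_compose[OF o1 this C_k_on_flat_exp, of 1]
    have 3: "C_k_on k (\<lambda>x. flat_exp 1 (1 - \<kappa> x)) T1" by simp
    show "C_k_on k (trial L) T1"
      by (rule C_k_on_cong[OF o1 _ C_k_on_mult[OF o1 C_k_on_mult[OF o1 1 2] 3]])
        (use T1H \<sigma>_neg in \<open>auto simp: trial_def profile_def\<close>)
  qed
  have s2: "smooth_on (trial L) T2"
  proof (rule smooth_on_cong[OF o2 _ smooth_on_const[OF o2, of 0]])
    fix y assume y: "y \<in> T2"
    show "0 = trial L y"
    proof (rule ccontr)
      assume "0 \<noteq> trial L y"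
      from trial_supp[OF L this[symmetric]]
      have p: "y $ i0 > 0" and "- exp (2 * L) * ?a < ln (y $ i0)" "ln (y $ i0) < - exp L * ?a"
        using \<nu>_pos[of i0] by (simp_all add: H_def \<sigma>_def pos_less_divide_eq pos_divide_less_eq)
      then have "exp (- exp (2 * L) * ?a) < exp (ln (y $ i0))" "exp (ln (y $ i0)) < exp (- exp L * ?a)"
        by (simp_all only: exp_less_cancel_iff)
      then show False using y p by (auto simp: T2_def mult.commute)
    qed
  qed
  show "\<exists>T. open T \<and> x \<in> T \<and> smooth_on (trial L) T"
    using cover o1 o2 s1 s2 by blast
qed

text \<open>On the support \<open>ln N \<le> \<sigma> + K\<close> and
  \<open>\<sigma> < - exp L \<le> - L\<close>, so the bound on \<open>L\<close> gives
  \<open>N \<le> R / 2\<close>. The lower bound \<open>a1\<close> for coordinate \<open>i0\<close>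
  keeps the compact set away from \<open>0\<close>, and \<open>\<kappa> < 1\<close> bounds the other
  coordinates.\<close>

lemma trial_compact_supp:
  assumes R: "R > 0" and K: "\<And>x. x \<in> H \<Longrightarrow> \<kappa> x \<le> 1 \<Longrightarrow> \<bar>ln (N x) - \<sigma> x\<bar> \<le> K"
    and L: "L > 0" "K - ln (R / 2) \<le> L"
  shows "\<exists>C. compact C \<and> C \<subseteq> {x. 0 < N x \<and> N x < R} \<and> (\<forall>x. trial L x \<noteq> 0 \<longrightarrow> x \<in> C)"
proof -
  define a1 where "a1 = exp (- \<nu> i0 * exp (2 * L))"
  define C where "C = cbox (\<chi> i. - 1) (\<chi> i. 1) \<inter> ({x :: real^'n. a1 \<le> x $ i0} \<inter> {x. N x \<le> R / 2})"
  have "closed {x. N x \<le> R / 2}"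
    by (intro closed_Collect_le N_continuous continuous_intros)
  then have "compact C" unfolding C_def
    by (intro compact_Int_closed compact_cbox closed_Int closed_Collect_le N_continuous continuous_intros)
  moreover have "0 < N x" if "x \<in> C" for x
  proof -
    have "a1 > 0" by (simp add: a1_def)
    then have "x \<noteq> 0" using that by (auto simp: C_def)
    then show ?thesis by (rule N_pos)
  qed
  moreover have "N x < R" if "x \<in> C" for x using that R by (auto simp: C_def)
  moreover have "x \<in> C" if x: "trial L x \<noteq> 0" for x
  proof -
    note s = trial_supp[OF L(1) x]
    have r: "x $ i0 > 0" using s(1) by (simp add: H_def)
    have "- exp (2 * L) * \<nu> i0 < ln (x $ i0)"
      using s(3) \<nu>_pos[of i0] by (simp add: \<sigma>_def pos_less_divide_eq)
    moreover have "\<sigma> x < 0" using s(4) exp_gt_zero[of L] by linarith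
    ultimately have "a1 < exp (ln (x $ i0))" "ln (x $ i0) < 0"
      unfolding a1_def using \<nu>_pos[of i0]
      by (simp_all only: exp_less_cancel_iff) (simp_all add: \<sigma>_def mult.commute divide_less_0_iff)
    then have a: "a1 \<le> x $ i0" "x $ i0 \<le> 1" using r by auto
    have "\<bar>x $ i\<bar> \<le> 1" for i
    proof (cases "i = i0")
      case False
      have "\<bar>x $ i\<bar> \<le> (x $ i0) powr (\<nu> i / \<nu> i0)" using H_\<kappa>_le_1[OF s(1) _ False] s(2) by simp
      also have "\<dots> \<le> 1" using r a(2) \<nu>_pos[of i] \<nu>_pos[of i0] by (intro powr_le1) auto
      finally show ?thesis .
    qed (use r a in auto)
    then have b: "x \<in> cbox (\<chi> i. - 1) (\<chi> i. 1)" by (auto simp: mem_box_cart abs_le_iff minus_le_iff)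
    have "ln (N x) \<le> \<sigma> x + K" using K[OF s(1)] s(2) by fastforce
    also have "\<dots> \<le> - L + K" using s(4) exp_ge_add_one_self[of L] by linarith
    also have "\<dots> \<le> ln (R / 2)" using L(2) by linarith
    finally have "N x \<le> R / 2"
      using N_pos[of x] r R by (subst (asm) ln_le_cancel_iff) force+
    then show ?thesis using a b by (auto simp: C_def)
  qed
  ultimately show ?thesis by blast
qed

text \<open>For \<open>trial L\<close> the left integral is \<open>c\<close> times an integral of
  the profile, and the right one is at most \<open>c\<close> times the matching integral of its
  derivative, where \<open>c\<close> collects the cut-off over the orbits. Cancelling
  \<open>c\<close> leaves the situation of \<open>profile_sharp\<close>.\<close>

lemma sharp_coordinates:
  assumes R: "R > 0"
    and C: "\<And>F E. smooth_on F UNIV \<Longrightarrow>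
      \<exists>K. compact K \<and> K \<subseteq> {x. 0 < N x \<and> N x < R} \<and> (\<forall>x. F x \<noteq> 0 \<longrightarrow> x \<in> K) \<Longrightarrow>
      (\<And>x. ((\<lambda>t. F (flow \<nu> t x)) has_real_derivative E x) (at 0)) \<Longrightarrow>
      (\<integral>\<^sup>+x. ennreal (\<bar>F x\<bar> powr Q / N x powr Q) \<partial>lborel) \<le>
      ennreal C * (\<integral>\<^sup>+x. ennreal ((\<bar>ln (N x)\<bar> * \<bar>E x\<bar>) powr Q / N x powr Q) \<partial>lborel)"
  shows "Q powr Q \<le> C"
proof -
  obtain K where K: "K \<ge> 0" "\<And>x. x \<in> H \<Longrightarrow> \<kappa> x \<le> 1 \<Longrightarrow> \<bar>ln (N x) - \<sigma> x\<bar> \<le> K"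
    using ln_N_near_\<sigma> by blast
  define \<phi> where "\<phi> x = flat_exp 1 (1 - \<kappa> x)" for x
  have \<phi>0: "\<phi> x \<ge> 0" "\<phi> x \<le> 1" for x by (simp_all add: \<phi>_def flat_exp_1)
  have \<phi>_flow: "x \<in> H \<Longrightarrow> \<phi> (flow \<nu> t x) = \<phi> x" for t x by (simp add: \<phi>_def flow_\<kappa>)
  have [measurable]: "H \<in> sets borel" using open_H by simp
  have [measurable]: "(\<lambda>x::real^'n. x $ i) \<in> borel_measurable borel" for i
    by (intro borel_measurable_continuous_onI continuous_intros)
  have [measurable]: "\<sigma> \<in> borel_measurable borel" "\<kappa> \<in> borel_measurable borel"
    unfolding \<sigma>_def[abs_def] \<kappa>_def[abs_def] by measurable
  have [measurable]: "flat_exp p \<in> borel_measurable borel" for p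
    by (intro borel_measurable_continuous_onI continuous_flat_exp)
  have [measurable]: "\<phi> \<in> borel_measurable borel"
    unfolding \<phi>_def[abs_def] by measurable
  have [measurable]: "trial L \<in> borel_measurable borel" "trial' L \<in> borel_measurable borel" for L
    unfolding trial_def[abs_def] trial'_def[abs_def] by measurable
  let ?W = "{x\<in>H. 0 \<le> \<sigma> x \<and> \<sigma> x < 1}"
  define c where "c = (\<integral>\<^sup>+x. ennreal (1 / N x powr Q) * ennreal (\<phi> x powr Q) * indicator ?W x \<partial>lborel)"
  have H0: "0 \<notin> H" by (simp add: H_def)
  note orb = nn_integral_weighted_orbits[where S = H and \<sigma> = \<sigma>, OF _ _ _ flow_H H0 flow_\<sigma>]
  have shift: "(\<integral>\<^sup>+t. g (a + t) \<partial>lborel) = (\<integral>\<^sup>+t. g t \<partial>lborel)"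
    if "g \<in> borel_measurable borel" for g :: "real \<Rightarrow> ennreal" and a :: real
    using nn_integral_real_affine[OF that, of 1 a] by simp
  \<comment> \<open>On the window, \<open>\<sigma> \<ge> 0\<close> gives
    \<open>N \<ge> exp (- K)\<close>, and \<open>\<sigma> < 1\<close> with
    \<open>\<kappa> \<le> 1\<close> confines \<open>x\<close> to a box.\<close>
  have "c \<noteq> \<infinity>"
  proof -
    define b :: "real^'n" where "b = (\<chi> i. exp (\<nu> i))"
    have "c \<le> (\<integral>\<^sup>+x. ennreal (exp (K * Q)) * indicator (cbox (- b) b) x \<partial>lborel)"
      unfolding c_def
    proof (rule nn_integral_mono)
      fix x
      show "ennreal (1 / N x powr Q) * ennreal (\<phi> x powr Q) * indicator ?W x
          \<le> ennreal (exp (K * Q)) * indicator (cbox (- b) b) x"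
      proof (cases "x \<in> ?W \<and> \<phi> x \<noteq> 0")
        case True
        then have x: "x \<in> H" "0 \<le> \<sigma> x" "\<sigma> x < 1" and k: "\<kappa> x \<le> 1"
          using flat_exp_1(4)[of 1 "1 - \<kappa> x"] by (auto simp: \<phi>_def)
        have r: "x $ i0 > 0" using x(1) by (simp add: H_def)
        have "ln (x $ i0) \<le> \<nu> i0" using x(3) \<nu>_pos[of i0] by (simp add: \<sigma>_def pos_divide_less_eq)
        then have r': "x $ i0 \<le> exp (\<nu> i0)" using r by (metis exp_le_cancel_iff exp_ln)
        have "\<bar>x $ i\<bar> \<le> exp (\<nu> i)" for i
        proof (cases "i = i0")
          case False
          have "\<bar>x $ i\<bar> \<le> (x $ i0) powr (\<nu> i / \<nu> i0)" by (rule H_\<kappa>_le_1[OF x(1) k False])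
          also have "\<dots> \<le> exp (\<nu> i0) powr (\<nu> i / \<nu> i0)"
            using r r' \<nu>_pos[of i] \<nu>_pos[of i0] by (intro powr_mono2) auto
          also have "\<dots> = exp (\<nu> i)" using \<nu>_pos[of i0] by (simp add: exp_powr_real)
          finally show ?thesis .
        qed (use r r' in auto)
        then have "x \<in> cbox (- b) b" by (auto simp: mem_box_cart b_def abs_le_iff minus_le_iff)
        moreover have "1 / N x powr Q * \<phi> x powr Q \<le> exp (K * Q) * 1"
        proof (rule mult_mono)
          have Nx: "N x > 0" using r N_pos[of x] by force
          have "- K \<le> ln (N x)" using K(2)[OF x(1) k] x(2) by linarith
          then have "exp (- K) \<le> N x" using Nx by (metis exp_le_cancel_iff exp_ln)
          then have "exp (- K) powr Q \<le> N x powr Q" using Q_ge_1 by (intro powr_mono2) auto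
          then have "exp (- (K * Q)) \<le> N x powr Q" by (simp add: exp_powr_real)
          then have "1 \<le> exp (K * Q) * N x powr Q"
            using mult_left_mono[of "exp (- (K * Q))" "N x powr Q" "exp (K * Q)"] by (simp add: exp_minus)
          then show "1 / N x powr Q \<le> exp (K * Q)" using Nx by (simp add: divide_le_eq)
          show "\<phi> x powr Q \<le> 1" using \<phi>0[of x] Q_ge_1 by (intro powr_le1) auto
        qed auto
        ultimately show ?thesis using True by (simp add: ennreal_leI flip: ennreal_mult')
      next
        case False
        then have "ennreal (1 / N x powr Q) * ennreal (\<phi> x powr Q) * indicator ?W x = 0"
          using Q_ge_1 by (auto simp: indicator_def)
        then show ?thesis by (simp only: zero_le)
      qed
    qed
    also have "\<dots> < \<infinity>"
      by (simp add: nn_integral_cmult_indicator ennreal_mult_less_top emeasure_lborel_cbox_eq)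
    finally show ?thesis by simp
  qed
  moreover have "c \<noteq> 0"
  proof
    assume "c = 0"
    then have ae: "AE x in lborel. ennreal (1 / N x powr Q) * ennreal (\<phi> x powr Q) * indicator ?W x = 0"
      unfolding c_def by (subst (asm) nn_integral_0_iff_AE) auto
    \<comment> \<open>An open set on which the integrand of \<open>c\<close> is positive. The
      witness below has only coordinate \<open>i0\<close> nonzero, with
      \<open>\<sigma> = 1 / 2\<close> and \<open>\<kappa> = 0\<close>.\<close>
    define U where "U = H \<inter> (\<lambda>x. (\<sigma> x, \<kappa> x)) -` ({0<..<1} \<times> {..<1})"
    have "continuous_on H \<kappa>" using C_k_on_\<kappa>[of 0] by simp
    moreover have "continuous_on H \<sigma>" unfolding \<sigma>_def[abs_def]
      using \<nu>_pos[of i0] by (auto intro!: continuous_intros simp: H_def)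
    ultimately have "open U" unfolding U_def
      by (intro continuous_open_preimage open_H open_Times continuous_intros) auto
    then have "closed (- U)" by (simp add: closed_Compl)
    moreover have "(\<chi> i. if i = i0 then exp (\<nu> i0 / 2) else 0) \<in> U"
      using \<nu>_pos[of i0] by (simp add: U_def H_def \<sigma>_def \<kappa>_def)
    moreover have "AE x in lborel. x \<notin> U"
      using ae
    proof eventually_elim
      fix x assume z: "ennreal (1 / N x powr Q) * ennreal (\<phi> x powr Q) * indicator ?W x = 0"
      show "x \<notin> U"
      proof
        assume x: "x \<in> U"
        then have "x \<in> ?W" "\<phi> x > 0" by (auto simp: U_def \<phi>_def flat_exp_1)
        moreover have "N x > 0" using x N_pos[of x] by (force simp: U_def H_def)
        ultimately show False using z by simp
      qed
    qed
    ultimately show False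
      using mem_closed_if_AE_lebesgue[OF _ AE_completion, of "- U"] by auto
  qed
  ultimately have c: "c \<noteq> 0" "c \<noteq> \<infinity>" by auto
  show ?thesis
  proof (rule profile_sharp[OF Q_ge_1 K(1)])
    fix L assume L: "L \<ge> K - ln (R / 2)" "L > 0"
    have cl: "(\<integral>\<^sup>+x. ennreal (\<bar>trial L x\<bar> powr Q / N x powr Q) \<partial>lborel) \<le>
      ennreal C * (\<integral>\<^sup>+x. ennreal ((\<bar>ln (N x)\<bar> * \<bar>trial' L x\<bar>) powr Q / N x powr Q) \<partial>lborel)"
      by (rule C[OF smooth_trial[OF L(2)] trial_compact_supp[OF R K(2) L(2,1)] trial_has_derivative[OF L(2)]])
    have p0: "profile Q L u \<ge> 0" for u by (simp add: profile_def bump_nonneg)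
    let ?I1 = "\<integral>\<^sup>+u. ennreal (profile Q L u powr Q) \<partial>lborel"
    let ?I2 = "\<integral>\<^sup>+u. ennreal (((\<bar>u\<bar> + K) * \<bar>profile' Q L u\<bar>) powr Q) \<partial>lborel"
    have "(\<integral>\<^sup>+x. ennreal (\<bar>trial L x\<bar> powr Q / N x powr Q) \<partial>lborel) =
        (\<integral>\<^sup>+x. ennreal (\<bar>trial L x\<bar> powr Q / N x powr Q) * indicator H x \<partial>lborel)"
      using Q_ge_1 by (intro nn_integral_cong) (auto simp: indicator_def trial_def)
    also have "\<dots> = (\<integral>\<^sup>+x. ennreal (1 / N x powr Q) *
        (\<integral>\<^sup>+t. ennreal (\<bar>trial L (flow \<nu> t x)\<bar> powr Q) \<partial>lborel) * indicator ?W x \<partial>lborel)"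
      by (rule orb) auto
    also have "\<dots> = (\<integral>\<^sup>+x. ennreal (1 / N x powr Q) * ennreal (\<phi> x powr Q) * indicator ?W x * ?I1 \<partial>lborel)"
    proof (rule nn_integral_cong)
      fix x
      show "ennreal (1 / N x powr Q) * (\<integral>\<^sup>+t. ennreal (\<bar>trial L (flow \<nu> t x)\<bar> powr Q) \<partial>lborel) * indicator ?W x
          = ennreal (1 / N x powr Q) * ennreal (\<phi> x powr Q) * indicator ?W x * ?I1"
      proof (cases "x \<in> H")
        case True
        have "\<bar>trial L (flow \<nu> t x)\<bar> powr Q = \<phi> x powr Q * profile Q L (\<sigma> x + t) powr Q" for t
          using True p0 \<phi>0[of x]
          by (simp add: trial_def flow_H flow_\<sigma> \<phi>_flow flip: \<phi>_def) (simp add: powr_mult abs_mult)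
        then have "(\<integral>\<^sup>+t. ennreal (\<bar>trial L (flow \<nu> t x)\<bar> powr Q) \<partial>lborel)
            = ennreal (\<phi> x powr Q) * (\<integral>\<^sup>+t. ennreal (profile Q L (\<sigma> x + t) powr Q) \<partial>lborel)"
          by (simp add: ennreal_mult' nn_integral_cmult)
        also have "(\<integral>\<^sup>+t. ennreal (profile Q L (\<sigma> x + t) powr Q) \<partial>lborel) = ?I1"
          by (rule shift[of "\<lambda>u. ennreal (profile Q L u powr Q)"]) measurable
        finally show ?thesis by (simp add: mult_ac)
      qed simp
    qed
    also have "\<dots> = c * ?I1" unfolding c_def by (rule nn_integral_multc) measurable
    finally have lhs: "(\<integral>\<^sup>+x. ennreal (\<bar>trial L x\<bar> powr Q / N x powr Q) \<partial>lborel) = c * ?I1" .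
    have "(\<integral>\<^sup>+x. ennreal ((\<bar>ln (N x)\<bar> * \<bar>trial' L x\<bar>) powr Q / N x powr Q) \<partial>lborel) =
        (\<integral>\<^sup>+x. ennreal ((\<bar>ln (N x)\<bar> * \<bar>trial' L x\<bar>) powr Q / N x powr Q) * indicator H x \<partial>lborel)"
      using Q_ge_1 by (intro nn_integral_cong) (auto simp: indicator_def trial'_def)
    also have "\<dots> = (\<integral>\<^sup>+x. ennreal (1 / N x powr Q) *
        (\<integral>\<^sup>+t. ennreal ((\<bar>ln (N (flow \<nu> t x))\<bar> * \<bar>trial' L (flow \<nu> t x)\<bar>) powr Q) \<partial>lborel) * indicator ?W x \<partial>lborel)"
      by (rule orb) auto
    \<comment> \<open>Here \<open>|ln N|\<close> is replaced by \<open>|\<sigma>| + K\<close>, the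
      error controlled by \<open>ln_N_near_\<sigma>\<close>.\<close>
    also have "\<dots> \<le> (\<integral>\<^sup>+x. ennreal (1 / N x powr Q) * ennreal (\<phi> x powr Q) * indicator ?W x * ?I2 \<partial>lborel)"
    proof (rule nn_integral_mono)
      fix x
      show "ennreal (1 / N x powr Q) * (\<integral>\<^sup>+t. ennreal ((\<bar>ln (N (flow \<nu> t x))\<bar> * \<bar>trial' L (flow \<nu> t x)\<bar>) powr Q) \<partial>lborel)
          * indicator ?W x \<le> ennreal (1 / N x powr Q) * ennreal (\<phi> x powr Q) * indicator ?W x * ?I2"
      proof (cases "x \<in> H")
        case True
        have "(\<bar>ln (N (flow \<nu> t x))\<bar> * \<bar>trial' L (flow \<nu> t x)\<bar>) powr Q
            \<le> \<phi> x powr Q * ((\<bar>\<sigma> x + t\<bar> + K) * \<bar>profile' Q L (\<sigma> x + t)\<bar>) powr Q" for t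
        proof (cases "\<phi> x = 0")
          case False
          then have k: "\<kappa> x \<le> 1" using flat_exp_1(4)[of 1 "1 - \<kappa> x"] by (auto simp: \<phi>_def)
          have "\<bar>ln (N (flow \<nu> t x)) - \<sigma> (flow \<nu> t x)\<bar> \<le> K"
            by (rule K(2)) (use True k in \<open>auto simp: flow_H flow_\<kappa>\<close>)
          then have "\<bar>ln (N (flow \<nu> t x))\<bar> \<le> \<bar>\<sigma> x + t\<bar> + K" using flow_\<sigma>[OF True, of t] by linarith
          then have "\<bar>ln (N (flow \<nu> t x))\<bar> * \<bar>trial' L (flow \<nu> t x)\<bar>
              \<le> (\<bar>\<sigma> x + t\<bar> + K) * \<bar>profile' Q L (\<sigma> x + t) * \<phi> x\<bar>"
            using True by (simp add: trial'_def flow_H flow_\<sigma> \<phi>_flow mult_right_mono flip: \<phi>_def)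
          also have "\<dots> = \<phi> x * ((\<bar>\<sigma> x + t\<bar> + K) * \<bar>profile' Q L (\<sigma> x + t)\<bar>)"
            using \<phi>0[of x] by (simp add: abs_mult)
          finally have "(\<bar>ln (N (flow \<nu> t x))\<bar> * \<bar>trial' L (flow \<nu> t x)\<bar>) powr Q
              \<le> (\<phi> x * ((\<bar>\<sigma> x + t\<bar> + K) * \<bar>profile' Q L (\<sigma> x + t)\<bar>)) powr Q"
            using Q_ge_1 by (intro powr_mono2) auto
          also have "\<dots> = \<phi> x powr Q * ((\<bar>\<sigma> x + t\<bar> + K) * \<bar>profile' Q L (\<sigma> x + t)\<bar>) powr Q"
            by (rule powr_mult)
          finally show ?thesis .
        next
          case z: True
          then show ?thesis
            using True Q_ge_1 by (simp add: trial'_def flow_H \<phi>_flow flip: \<phi>_def)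
        qed
        then have "(\<integral>\<^sup>+t. ennreal ((\<bar>ln (N (flow \<nu> t x))\<bar> * \<bar>trial' L (flow \<nu> t x)\<bar>) powr Q) \<partial>lborel)
            \<le> (\<integral>\<^sup>+t. ennreal (\<phi> x powr Q) * ennreal (((\<bar>\<sigma> x + t\<bar> + K) * \<bar>profile' Q L (\<sigma> x + t)\<bar>) powr Q) \<partial>lborel)"
          by (intro nn_integral_mono) (simp add: ennreal_leI flip: ennreal_mult')
        also have "\<dots> = ennreal (\<phi> x powr Q) *
            (\<integral>\<^sup>+t. ennreal (((\<bar>\<sigma> x + t\<bar> + K) * \<bar>profile' Q L (\<sigma> x + t)\<bar>) powr Q) \<partial>lborel)"
          by (rule nn_integral_cmult) measurable
        also have "(\<integral>\<^sup>+t. ennreal (((\<bar>\<sigma> x + t\<bar> + K) * \<bar>profile' Q L (\<sigma> x + t)\<bar>) powr Q) \<partial>lborel) = ?I2"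
          by (rule shift[of "\<lambda>u. ennreal (((\<bar>u\<bar> + K) * \<bar>profile' Q L u\<bar>) powr Q)"]) measurable
        finally have "ennreal (1 / N x powr Q) * (\<integral>\<^sup>+t. ennreal ((\<bar>ln (N (flow \<nu> t x))\<bar> * \<bar>trial' L (flow \<nu> t x)\<bar>) powr Q) \<partial>lborel)
            \<le> ennreal (1 / N x powr Q) * (ennreal (\<phi> x powr Q) * ?I2)" by (rule mult_left_mono) simp
        from mult_right_mono[OF this, of "indicator ?W x"] show ?thesis by (simp add: mult_ac)
      qed simp
    qed
    also have "\<dots> = c * ?I2" unfolding c_def by (rule nn_integral_multc) measurable
    finally have rhs: "(\<integral>\<^sup>+x. ennreal ((\<bar>ln (N x)\<bar> * \<bar>trial' L x\<bar>) powr Q / N x powr Q) \<partial>lborel) \<le> c * ?I2" .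
    have "c * ?I1 \<le> ennreal C * (c * ?I2)"
      using cl mult_left_mono[OF rhs, of "ennreal C"] unfolding lhs by (rule order_trans) simp
    then have "c * ?I1 \<le> c * (ennreal C * ?I2)" by (simp add: mult_ac)
    then show "?I1 \<le> ennreal C * ?I2"
      using c by (subst (asm) ennreal_mult_le_mult_iff) auto
  qed
qed

end

subsection \<open>Homogeneous groups\<close>

lemma flow_has_derivative:
  fixes \<nu> :: "'n::finite \<Rightarrow> real" and p :: "real^'n"
  shows "((\<lambda>t. flow \<nu> t p) has_derivative (\<lambda>s. s *\<^sub>R (\<chi> i. \<nu> i * p $ i))) (at 0)"
proof (subst has_derivative_componentwise_within, rule ballI)
  fix b :: "real^'n" assume "b \<in> Basis"
  then obtain i where b: "b = axis i 1" by (auto simp: Basis_vec_def)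
  have "((\<lambda>t. exp (t * \<nu> i) * p $ i) has_derivative (\<lambda>s. s * (\<nu> i * p $ i))) (at 0)"
    by (auto intro!: derivative_eq_intros)
  then show "((\<lambda>t. flow \<nu> t p \<bullet> b) has_derivative (\<lambda>s. s *\<^sub>R (\<chi> i. \<nu> i * p $ i) \<bullet> b)) (at 0)"
    by (simp add: b inner_axis flow_nth)
qed

text \<open>\<open>dilation_0\<close> ranges over all real \<open>r\<close>, because at the unit the
  radial derivative is taken at \<open>r = 0\<close>.\<close>

locale homogeneous_coordinates = graded_coordinates atlas j e \<nu>
  for atlas :: "('g::{topological_group_add, t2_space, second_countable_topology}, 'n::finite) chart set"
    and j e and \<nu> :: "'n \<Rightarrow> real" +
  fixes expo :: "real^'n \<Rightarrow> 'g" and A :: "real^'n \<Rightarrow> real^'n" and N :: "'g \<Rightarrow> real" and Q :: real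
  assumes dilation_e: "r > 0 \<Longrightarrow> group_dilation expo A r (e p) = e (diag_dilation \<nu> r p)"
    and dilation_0: "group_dilation expo A r 0 = 0"
    and hom: "homogeneous_function \<nu> (\<lambda>p. N (e p)) Q"
begin

sublocale NE: homogeneous_function \<nu> "\<lambda>p. N (e p)" Q by (rule hom)

text \<open>The derivative along the Euler field, the generator of the dilation flow.\<close>

definition euler :: "('g \<Rightarrow> complex) \<Rightarrow> real^'n \<Rightarrow> complex" where
  "euler f p = frechet_derivative (\<lambda>p. f (e p)) (at p) (\<chi> i. \<nu> i * p $ i)"

lemma euler_has_derivative:
  assumes "smooth_fun atlas f"
  shows "((\<lambda>t. f (e (flow \<nu> t p))) has_vector_derivative euler f p) (at 0)"
proof -
  let ?D = "frechet_derivative (\<lambda>p. f (e p)) (at p)"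
  have D: "((\<lambda>p. f (e p)) has_derivative ?D) (at p)"
    by (rule smooth_on_has_derivative[OF smooth_fun_compose_e[OF assms]]) auto
  have "((\<lambda>t. f (e (flow \<nu> t p))) has_derivative (\<lambda>s. ?D (s *\<^sub>R (\<chi> i. \<nu> i * p $ i)))) (at 0)"
    by (rule has_derivative_compose[where g = "\<lambda>p. f (e p)" and f = "\<lambda>t. flow \<nu> t p", OF flow_has_derivative])
      (use D in simp)
  then show ?thesis
    unfolding has_vector_derivative_def euler_def linear_cmul[OF has_derivative_linear[OF D]] .
qed

lemma continuous_euler:
  assumes "smooth_fun atlas f" shows "continuous_on UNIV (euler f)"
proof -
  have s: "smooth_on (\<lambda>p. f (e p)) UNIV" by (rule smooth_fun_compose_e[OF assms])
  have "euler f p = (\<Sum>i\<in>UNIV. (\<nu> i * p $ i) *\<^sub>R frechet_derivative (\<lambda>p. f (e p)) (at p) (axis i 1))" for p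
  proof -
    note l = has_derivative_linear[OF smooth_on_has_derivative[OF s UNIV_I, of p]]
    show ?thesis unfolding euler_def
      by (subst vec_eq_sum_axis) (simp add: linear_sum[OF l] linear_cmul[OF l])
  qed
  then have "euler f = (\<lambda>p. \<Sum>i\<in>UNIV. (\<nu> i * p $ i) *\<^sub>R frechet_derivative (\<lambda>p. f (e p)) (at p) (axis i 1))"
    by (rule ext)
  then show ?thesis
    by (simp only:)
      (intro continuous_intros smooth_on_imp_continuous_on smooth_on_frechet_derivative s)
qed

text \<open>The curve in \<open>radial_derivative\<close> is the flow line at time
  \<open>ln r - ln (N x)\<close>, and the logarithm contributes the factor
  \<open>1 / N x\<close>.\<close>

lemma radial_derivative_e:
  assumes "smooth_fun atlas f"
  shows "radial_derivative expo A N f (e p) = (1 / N (e p)) *\<^sub>R euler f p"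
proof (cases "p = 0")
  \<comment> \<open>At the unit both sides are 0: the dilations fix it and the Euler field vanishes
    there.\<close>
  case True
  have "euler f 0 = 0"
    unfolding euler_def
    using linear_0[OF has_derivative_linear[OF smooth_on_has_derivative[OF smooth_fun_compose_e[OF assms] UNIV_I, of 0]]]
    by (simp add: zero_vec_def)
  moreover have "radial_derivative expo A N f (e 0) = 0"
    unfolding radial_derivative_def by (simp add: dilation_0)
  ultimately show ?thesis using True by simp
next
  case False
  let ?n = "N (e p)"
  have n: "?n > 0" using NE.N_pos[OF False] .
  have "((\<lambda>t. f (e (flow \<nu> t p))) \<circ> (\<lambda>r. ln r - ln ?n) has_vector_derivative (1 / ?n) *\<^sub>R euler f p) (at ?n)"
    by (rule vector_diff_chain_at)
      (use n euler_has_derivative[OF assms] in \<open>auto intro!: derivative_eq_intros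
        simp: has_real_derivative_iff_has_vector_derivative[symmetric] divide_inverse\<close>)
  then have "((\<lambda>r. f (group_dilation expo A r (group_dilation expo A (1 / ?n) (e p))))
      has_vector_derivative (1 / ?n) *\<^sub>R euler f p) (at ?n)"
  proof (rule has_vector_derivative_transform_within_open[where S = "{0<..}"])
    fix r :: real assume "r \<in> {0<..}"
    then have r: "r > 0" by simp
    have "diag_dilation \<nu> r (diag_dilation \<nu> (1 / ?n) p) = flow \<nu> (ln r - ln ?n) p"
      using r n by (simp add: vec_eq_iff flow_nth diag_dilation_def powr_def left_diff_distrib
          exp_diff ln_div exp_minus field_simps)
    then show "((\<lambda>t. f (e (flow \<nu> t p))) \<circ> (\<lambda>r. ln r - ln ?n)) r =
        f (group_dilation expo A r (group_dilation expo A (1 / ?n) (e p)))"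
      using r n by (simp add: dilation_e)
  qed (use n in auto)
  then show ?thesis unfolding radial_derivative_def by (rule vector_derivative_at)
qed

context
  fixes M :: "'g measure" and c :: ennreal and R :: real
  assumes M: "\<And>F. (\<lambda>p. F (e p)) \<in> borel_measurable borel \<Longrightarrow>
      (\<integral>\<^sup>+x. F x \<partial>M) = c * (\<integral>\<^sup>+p. F (e p) \<partial>lborel)"
begin

text \<open>The factor \<open>1 / N\<close> of \<open>radial_derivative_e\<close> produces the same
  weight in both integrals. The restriction to the ball disappears since \<open>f\<close> and its
  Euler derivative vanish outside it.\<close>

lemma hardy_integrals_coordinates:
  assumes f: "f \<in> test_functions atlas (quasi_ball N R - {0})"
  shows "(\<integral>\<^sup>+x\<in>quasi_ball N R. ennreal (cmod (f x) powr Q / N x powr Q) \<partial>M) =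
      c * (\<integral>\<^sup>+p. ennreal (cmod (f (e p)) powr Q / N (e p) powr Q) \<partial>lborel)"
    and "(\<integral>\<^sup>+x\<in>quasi_ball N R. ennreal (cmod (of_real (ln (N x)) * radial_derivative expo A N f x) powr Q) \<partial>M) =
      c * (\<integral>\<^sup>+p. ennreal (cmod (of_real (ln (N (e p))) * euler f p) powr Q / N (e p) powr Q) \<partial>lborel)"
proof -
  have s: "smooth_fun atlas f" and supp: "closure {x. f x \<noteq> 0} \<subseteq> quasi_ball N R - {0}"
    using f by (auto simp: test_functions_def)
  have [measurable]: "(\<lambda>p. f (e p)) \<in> borel_measurable borel" "euler f \<in> borel_measurable borel"
    using continuous_euler[OF s] smooth_on_imp_continuous_on[OF smooth_fun_compose_e[OF s]]
    by (auto intro: borel_measurable_continuous_onI)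
  note [measurable] = NE.N_measurable
  have f0: "f (e p) = 0" if "e p \<notin> quasi_ball N R" for p
    using supp closure_subset[of "{x. f x \<noteq> 0}"] that by auto
  \<comment> \<open>The closed support lies in the ball, so \<open>f\<close> is zero near every
    point outside, and its derivative vanishes there too.\<close>
  have euler0: "euler f p = 0" if "e p \<notin> quasi_ball N R" for p
  proof -
    let ?U = "e -` (- closure {x. f x \<noteq> 0})"
    have "open ?U" by (intro open_vimage_e) auto
    moreover have "p \<in> ?U" using that supp by auto
    moreover have "f (e q) = 0" if "q \<in> ?U" for q
      using that closure_subset[of "{x. f x \<noteq> 0}"] by auto
    ultimately have "((\<lambda>p. f (e p)) has_derivative (\<lambda>v. 0)) (at p)"
      using has_derivative_transform_within_open[OF has_derivative_const[of "0 :: complex"], of ?U p] by simp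
    from frechet_derivative_at[OF this] show ?thesis unfolding euler_def by metis
  qed
  have 1: "ennreal (cmod (f (e p)) powr Q / N (e p) powr Q) * indicator (quasi_ball N R) (e p)
      = ennreal (cmod (f (e p)) powr Q / N (e p) powr Q)" for p
    using f0[of p] NE.Q_ge_1 by (auto simp: indicator_def)
  show "(\<integral>\<^sup>+x\<in>quasi_ball N R. ennreal (cmod (f x) powr Q / N x powr Q) \<partial>M) =
      c * (\<integral>\<^sup>+p. ennreal (cmod (f (e p)) powr Q / N (e p) powr Q) \<partial>lborel)"
    by (subst M) (simp_all add: 1)
  have 2: "ennreal (cmod (of_real (ln (N (e p))) * radial_derivative expo A N f (e p)) powr Q)
        * indicator (quasi_ball N R) (e p)
      = ennreal (cmod (of_real (ln (N (e p))) * euler f p) powr Q / N (e p) powr Q)" for p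
  proof -
    have "cmod (of_real (ln (N (e p))) * radial_derivative expo A N f (e p))
        = cmod (of_real (ln (N (e p))) * euler f p) / N (e p)"
      using NE.N_nonneg[of p] by (simp add: radial_derivative_e[OF s] norm_mult)
    then have "cmod (of_real (ln (N (e p))) * radial_derivative expo A N f (e p)) powr Q
        = cmod (of_real (ln (N (e p))) * euler f p) powr Q / N (e p) powr Q"
      using NE.N_nonneg[of p] by (simp only: powr_divide norm_ge_zero)
    then show ?thesis using euler0[of p] NE.Q_ge_1 by (auto simp: indicator_def)
  qed
  show "(\<integral>\<^sup>+x\<in>quasi_ball N R. ennreal (cmod (of_real (ln (N x)) * radial_derivative expo A N f x) powr Q) \<partial>M) =
      c * (\<integral>\<^sup>+p. ennreal (cmod (of_real (ln (N (e p))) * euler f p) powr Q / N (e p) powr Q) \<partial>lborel)"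
    by (subst M) (simp_all only: 2, measurable)
qed

lemma hardy_inequality:
  assumes f: "f \<in> test_functions atlas (quasi_ball N R - {0})"
  shows "(\<integral>\<^sup>+x\<in>quasi_ball N R. ennreal (cmod (f x) powr Q / N x powr Q) \<partial>M) \<le> ennreal (Q powr Q) *
    (\<integral>\<^sup>+x\<in>quasi_ball N R. ennreal (cmod (of_real (ln (N x)) * radial_derivative expo A N f x) powr Q) \<partial>M)"
proof -
  let ?K = "inv e ` closure {x. f x \<noteq> 0}"
  have s: "smooth_fun atlas f" and comp: "compact (closure {x. f x \<noteq> 0})"
    and supp: "closure {x. f x \<noteq> 0} \<subseteq> quasi_ball N R - {0}"
    using f by (auto simp: test_functions_def)
  have K: "compact ?K"
    by (rule compact_continuous_image[OF continuous_on_subset[OF continuous_inv_e subset_UNIV] comp])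
  have K': "0 < N (e p) \<and> N (e p) < R" if "p \<in> ?K" for p
  proof -
    have "e p \<in> quasi_ball N R - {0}" using that supp by auto
    then show ?thesis using NE.N_pos[of p] by (cases "p = 0") (auto simp: quasi_ball_def)
  qed
  \<comment> \<open>The support is compact and omits the unit, so \<open>N\<close> has a positive
    minimum on it; empty support means \<open>f = 0\<close>.\<close>
  have "\<exists>n1>0. \<forall>p\<in>?K. n1 \<le> N (e p)"
  proof (cases "?K = {}")
    case False
    then obtain q where "q \<in> ?K" "\<forall>p\<in>?K. N (e q) \<le> N (e p)"
      using continuous_attains_inf[OF K _ continuous_on_subset[OF NE.N_continuous subset_UNIV]] by blast
    then show ?thesis using K' by blast
  qed (auto intro: exI[of _ 1])
  then obtain n1 where n1: "n1 > 0" "\<And>p. p \<in> ?K \<Longrightarrow> n1 \<le> N (e p)" by blast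
  have mem: "p \<in> ?K" if "f (e p) \<noteq> 0" for p
  proof
    show "e p \<in> closure {x. f x \<noteq> 0}" using that closure_subset by fast
  qed simp
  have "(\<integral>\<^sup>+p. ennreal (cmod (f (e p)) powr Q / N (e p) powr Q) \<partial>lborel) \<le> ennreal (Q powr Q) *
      (\<integral>\<^sup>+p. ennreal (cmod (of_real (ln (N (e p))) * euler f p) powr Q / N (e p) powr Q) \<partial>lborel)"
  proof (rule NE.hardy_coordinates[OF euler_has_derivative[OF s]])
    show "continuous_on UNIV (\<lambda>p. f (e p))"
      by (rule smooth_on_imp_continuous_on[OF smooth_fun_compose_e[OF s]])
    show "n1 \<le> N (e p) \<and> N (e p) \<le> R" if "f (e p) \<noteq> 0" for p
      using mem[OF that] K' n1(2) by (auto simp: less_imp_le)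
  qed (use n1 continuous_euler[OF s] in auto)
  from mult_left_mono[OF this, of c] show ?thesis
    unfolding hardy_integrals_coordinates[OF f] by (simp add: mult_ac)
qed

text \<open>Real trial functions in coordinates are carried to complex test functions on the group,
  and the Haar factor \<open>c\<close> cancels because it is positive and finite.\<close>

lemma hardy_constant_sharp:
  assumes c: "c \<noteq> 0" "c \<noteq> \<infinity>" and R: "R > 0"
    and C: "\<And>f. f \<in> test_functions atlas (quasi_ball N R - {0}) \<Longrightarrow>
      (\<integral>\<^sup>+x\<in>quasi_ball N R. ennreal (cmod (f x) powr Q / N x powr Q) \<partial>M) \<le> ennreal C *
      (\<integral>\<^sup>+x\<in>quasi_ball N R. ennreal (cmod (of_real (ln (N x)) * radial_derivative expo A N f x) powr Q) \<partial>M)"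
  shows "Q powr Q \<le> C"
proof (rule NE.sharp_coordinates[OF R])
  fix F E :: "real^'n \<Rightarrow> real"
  assume F: "smooth_on F UNIV"
    and "\<exists>K. compact K \<and> K \<subseteq> {x. 0 < N (e x) \<and> N (e x) < R} \<and> (\<forall>x. F x \<noteq> 0 \<longrightarrow> x \<in> K)"
    and E: "\<And>x. ((\<lambda>t. F (flow \<nu> t x)) has_real_derivative E x) (at 0)"
  from this(2) obtain K where K: "compact K" "K \<subseteq> {x. 0 < N (e x) \<and> N (e x) < R}" "\<And>x. F x \<noteq> 0 \<Longrightarrow> x \<in> K"
    by blast
  define f :: "'g \<Rightarrow> complex" where "f x = of_real (F (inv e x))" for x
  have "smooth_on (\<lambda>p. complex_of_real (F p)) UNIV"
    unfolding smooth_on_def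
    by (intro allI C_k_on_linear_compose[OF open_UNIV bounded_linear_of_real] smooth_onD[OF F])
  then have s: "smooth_fun atlas f" unfolding f_def by (rule smooth_fun_compose_inv_e)
  have "compact (e ` K)"
    by (rule compact_continuous_image[OF continuous_on_subset[OF cont_e subset_UNIV] K(1)])
  have cl: "closure {x. f x \<noteq> 0} \<subseteq> e ` K"
  proof (rule closure_minimal)
    show "{x. f x \<noteq> 0} \<subseteq> e ` K"
    proof
      fix x assume "x \<in> {x. f x \<noteq> 0}"
      then have "inv e x \<in> K" by (intro K(3)) (simp add: f_def)
      then show "x \<in> e ` K" by (rule image_eqI[rotated]) simp
    qed
    show "closed (e ` K)" using \<open>compact (e ` K)\<close> by (rule compact_imp_closed)
  qed
  have "compact (closure {x. f x \<noteq> 0})"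
    using closed_Int_compact[OF closed_closure \<open>compact (e ` K)\<close>, of "{x. f x \<noteq> 0}"] cl
    by (simp only: Int_absorb2)
  moreover have "e ` K \<subseteq> quasi_ball N R - {0}"
  proof
    fix x assume "x \<in> e ` K"
    then obtain p where p: "p \<in> K" "x = e p" by blast
    then have "0 < N x" "N x < R" using K(2) by auto
    then show "x \<in> quasi_ball N R - {0}" using NE.N_0 by (auto simp: quasi_ball_def)
  qed
  ultimately have f: "f \<in> test_functions atlas (quasi_ball N R - {0})"
    using s cl unfolding test_functions_def by blast
  have euler: "euler f p = of_real (E p)" for p
  proof -
    have "((\<lambda>t. f (e (flow \<nu> t p))) has_vector_derivative of_real (E p)) (at 0)"
      using bounded_linear.has_vector_derivative[OF bounded_linear_of_real
          E[of p, unfolded has_real_derivative_iff_has_vector_derivative]]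
      by (simp add: f_def)
    from vector_derivative_unique_at[OF euler_has_derivative[OF s] this] show ?thesis .
  qed
  have "c * (\<integral>\<^sup>+x. ennreal (\<bar>F x\<bar> powr Q / N (e x) powr Q) \<partial>lborel) \<le>
      c * (ennreal C * (\<integral>\<^sup>+x. ennreal ((\<bar>ln (N (e x))\<bar> * \<bar>E x\<bar>) powr Q / N (e x) powr Q) \<partial>lborel))"
    using C[OF f] unfolding hardy_integrals_coordinates[OF f] euler
    by (simp add: f_def norm_mult mult.left_commute[of c])
  then show "(\<integral>\<^sup>+x. ennreal (\<bar>F x\<bar> powr Q / N (e x) powr Q) \<partial>lborel) \<le>
      ennreal C * (\<integral>\<^sup>+x. ennreal ((\<bar>ln (N (e x))\<bar> * \<bar>E x\<bar>) powr Q / N (e x) powr Q) \<partial>lborel)"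
    using c by (subst (asm) ennreal_mult_le_mult_iff) auto
qed

end

end

section \<open>Reduction to an eigenbasis of \<open>A\<close>\<close>

lemma diagonalisable_eigenbasis:
  fixes A :: "real^'n::finite \<Rightarrow> real^'n"
  assumes "diagonalisable A"
  obtains P :: "real^'n \<Rightarrow> real^'n" and \<nu> where "linear P" "bij P" "\<forall>x. A (P x) = P (\<chi> i. \<nu> i * x $ i)"
proof -
  obtain B where B: "independent B" "span B = UNIV" "\<forall>b\<in>B. \<exists>\<nu>. A b = \<nu> *\<^sub>R b" and A: "linear A"
    using assms by (auto simp: diagonalisable_def)
  have fB: "finite B" using B(1) by (rule independent_imp_finite)
  have "card B = dim (UNIV :: (real^'n) set)"
    using basis_card_eq_dim[of B UNIV] B by simp
  then have "card (UNIV :: 'n set) = card B" by simp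
  then obtain \<beta> where \<beta>: "bij_betw \<beta> (UNIV :: 'n set) B"
    using finite_same_card_bij[OF finite[of UNIV] fB] by blast
  have \<beta>B: "\<beta> i \<in> B" for i using \<beta> by (auto simp: bij_betw_def)
  then have "\<forall>i. \<exists>\<nu>. A (\<beta> i) = \<nu> *\<^sub>R \<beta> i" using B(3) by blast
  from choice[OF this] obtain \<nu> where \<nu>: "\<And>i. A (\<beta> i) = \<nu> i *\<^sub>R \<beta> i" by blast
  define P where "P x = (\<Sum>i\<in>UNIV. x $ i *\<^sub>R \<beta> i)" for x :: "real^'n"
  have lP: "linear P"
    by (rule linearI) (simp_all add: P_def sum.distrib scaleR_add_left scaleR_sum_right)
  have P_axis: "P (axis i 1) = \<beta> i" for i
  proof -
    have "P (axis i 1) = (\<Sum>k\<in>UNIV. if k = i then \<beta> k else 0)"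
      unfolding P_def by (intro sum.cong) (auto simp: axis_def)
    then show ?thesis by simp
  qed
  have "B \<subseteq> range P"
  proof
    fix b assume "b \<in> B"
    then obtain i where "b = \<beta> i" using \<beta> by (auto simp: bij_betw_def)
    then show "b \<in> range P" using P_axis by (metis rangeI)
  qed
  then have "span B \<subseteq> range P"
    by (rule span_minimal) (simp add: linear_subspace_image lP)
  then have "surj P" using B(2) by auto
  moreover from this have "inj P" using lP by (intro linear_surj_imp_inj)
  ultimately have bP: "bij P" by (simp add: bij_def)
  have "\<forall>x. A (P x) = P (\<chi> i. \<nu> i * x $ i)"
    by (simp add: P_def linear_sum[OF A] linear_cmul[OF A] \<nu> mult.commute)
  from that[OF lP bP this] show ?thesis .
qed

lemma linear_inv_of_bij:
  assumes "linear P" "bij P" shows "linear (inv P)"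
proof (rule linearI)
  have inv: "inv P (P x) = x" "P (inv P y) = y" for x y
    using assms(2) by (auto simp: bij_is_inj bij_is_surj surj_f_inv_f)
  show "inv P (x + y) = inv P x + inv P y" for x y
    using linear_add[OF assms(1), of "inv P x" "inv P y"] by (metis inv)
  show "inv P (r *\<^sub>R x) = r *\<^sub>R inv P x" for r x
    using linear_cmul[OF assms(1), of r "inv P x"] by (metis inv)
qed

text \<open>Along an eigenvector the exponential series is scalar. There is no sign condition on
  \<open>r\<close>, as the formula also serves to evaluate the dilation of \<open>0\<close> for
  arbitrary \<open>r\<close>.\<close>

lemma dilation_eigenbasis:
  fixes A P :: "real^'n::finite \<Rightarrow> real^'n"
  assumes P: "linear P" and A: "linear A" and AP: "\<And>x. A (P x) = P (\<chi> i. \<nu> i * x $ i)"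
  shows "dilation A r (P x) = P (\<chi> i. exp (ln r * \<nu> i) * x $ i)"
proof -
  have pow: "((\<lambda>w. ln r *\<^sub>R A w) ^^ k) (P x) = P (\<chi> i. (ln r * \<nu> i) ^ k * x $ i)" for k
  proof (induction k)
    case (Suc k)
    have "ln r *\<^sub>R P (\<chi> i. \<nu> i * ((ln r * \<nu> i) ^ k * x $ i)) = P (\<chi> i. (ln r * \<nu> i) ^ Suc k * x $ i)"
      unfolding linear_cmul[OF P, symmetric] by (rule arg_cong[of _ _ P]) (simp add: vec_eq_iff mult_ac)
    then show ?case by (simp add: Suc AP)
  qed simp
  have P_sum: "P y = (\<Sum>i\<in>UNIV. y $ i *\<^sub>R P (axis i 1))" for y
  proof -
    have "P y = P (\<Sum>i\<in>UNIV. y $ i *\<^sub>R axis i 1)" by (simp only: vec_eq_sum_axis[symmetric])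
    then show ?thesis by (simp add: linear_sum[OF P] linear_cmul[OF P])
  qed
  have "(\<lambda>k. \<Sum>i\<in>UNIV. ((ln r * \<nu> i) ^ k /\<^sub>R fact k * x $ i) *\<^sub>R P (axis i 1)) sums
      (\<Sum>i\<in>UNIV. (exp (ln r * \<nu> i) * x $ i) *\<^sub>R P (axis i 1))"
    by (intro sums_sum bounded_linear.sums[OF bounded_linear_scaleR_left] sums_mult2 exp_converges)
  also have "(\<lambda>k. \<Sum>i\<in>UNIV. ((ln r * \<nu> i) ^ k /\<^sub>R fact k * x $ i) *\<^sub>R P (axis i 1)) =
      (\<lambda>k. (1 / fact k) *\<^sub>R ((\<lambda>w. ln r *\<^sub>R A w) ^^ k) (P x))"
    unfolding pow by (subst (2) P_sum) (simp add: scaleR_sum_right divide_inverse mult_ac)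
  also have "(\<Sum>i\<in>UNIV. (exp (ln r * \<nu> i) * x $ i) *\<^sub>R P (axis i 1)) = P (\<chi> i. exp (ln r * \<nu> i) * x $ i)"
    by (subst (2) P_sum) simp
  finally show ?thesis unfolding dilation_def by (rule sums_unique[symmetric])
qed

lemma homogeneous_dim_eigenbasis:
  fixes A P :: "real^'n::finite \<Rightarrow> real^'n"
  assumes P: "linear P" "bij P" and A: "linear A" and AP: "\<And>x. A (P x) = P (\<chi> i. \<nu> i * x $ i)"
  shows "homogeneous_dim A = (\<Sum>i\<in>UNIV. \<nu> i)"
proof -
  define D :: "real^'n \<Rightarrow> real^'n" where "D x = (\<chi> i. \<nu> i * x $ i)" for x
  have D: "linear D" by (rule linearI) (simp_all add: D_def vec_eq_iff algebra_simps)
  have iP: "linear (inv P)" using P by (rule linear_inv_of_bij)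
  have inv: "inv P (P x) = x" "P (inv P x) = x" for x
    using P(2) by (auto simp: bij_is_inj bij_is_surj surj_f_inv_f)
  have "A = P \<circ> (D \<circ> inv P)" using AP inv by (auto simp: fun_eq_iff D_def) (metis inv(2))
  then have "trace (matrix A) = trace (matrix P ** matrix (D \<circ> inv P))"
    by (simp add: matrix_compose[OF linear_compose[OF iP D] P(1)])
  also have "\<dots> = trace (matrix (D \<circ> inv P) ** matrix P)" by (rule trace_mul_sym)
  also have "matrix (D \<circ> inv P) ** matrix P = matrix (D \<circ> inv P \<circ> P)"
    by (rule matrix_compose[OF P(1) linear_compose[OF iP D], symmetric])
  also have "D \<circ> inv P \<circ> P = D" by (auto simp: inv)
  also have "trace (matrix D) = (\<Sum>i\<in>UNIV. \<nu> i)"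
    by (simp add: trace_def matrix_def D_def axis_def)
  finally show ?thesis by (simp add: homogeneous_dim_def)
qed

text \<open>Composing \<open>\<iota>\<close> and \<open>expo\<close> with the eigenbasis map
  \<open>P\<close> changes only the basis of the Lie algebra, but makes the dilations diagonal. The
  new bracket is the old one conjugated by \<open>P\<close>, so the diagonal dilations are
  automorphisms of it.\<close>

lemma homogeneous_group_coordinates:
  fixes atlas :: "('g::{topological_group_add, t2_space, second_countable_topology}, 'n::finite) chart set"
  assumes G: "homogeneous_group atlas \<iota> expo A" and Q: "Q = homogeneous_dim A"
    and N: "homogeneous_quasi_norm expo A N"
  obtains j e \<nu> where "homogeneous_coordinates atlas j e \<nu> expo A N Q"
proof -
  interpret homogeneous_group atlas \<iota> expo A by (rule G)
  interpret X: exponential_coordinates atlas \<iota> expo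
    by unfold_locales (rule lie_algebra_iso exponential_map expo_diffeo)+
  obtain P :: "real^'n \<Rightarrow> real^'n" and \<nu> where P: "linear P" "bij P" and AP': "\<forall>x. A (P x) = P (\<chi> i. \<nu> i * x $ i)"
    by (rule diagonalisable_eigenbasis[OF diagonalisable])
  note AP = AP'[rule_format]
  have A: "linear A" using diagonalisable by (simp add: diagonalisable_def)
  have inv: "inv P (P x) = x" "P (inv P x) = x" for x
    using P(2) by (auto simp: bij_is_inj bij_is_surj surj_f_inv_f)
  have injP: "P x = P y \<longleftrightarrow> x = y" for x y using P(2) by (auto simp: bij_is_inj inj_eq)
  have iP: "linear (inv P)" using P by (rule linear_inv_of_bij)
  have bP: "bounded_linear P" "bounded_linear (inv P)" using P(1) iP by (simp_all add: linear_conv_bounded_linear)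
  define e where "e p = expo (P p)" for p
  define j where "j v = \<iota> (P v)" for v
  have bij_e: "bij e" unfolding e_def using bij_comp[OF P(2) X.bij_e] by (simp add: o_def)
  have inv_e: "inv e x = inv P (inv expo x)" for x
    by (rule inv_f_eq) (use bij_e in \<open>auto simp: bij_is_inj e_def inv\<close>)
  have \<nu>: "\<nu> i > 0" for i
  proof -
    have "A (P (axis i 1)) = P (\<nu> i *\<^sub>R axis i 1)"
      unfolding AP injP by (simp add: vec_eq_iff axis_def)
    then have "A (P (axis i 1)) = \<nu> i *\<^sub>R P (axis i 1)" by (simp add: linear_cmul[OF P(1)])
    moreover have "P (axis i 1) \<noteq> 0"
      using injP[of "axis i 1" 0] linear_0[OF P(1)] by (simp add: axis_eq_0_iff)
    ultimately show ?thesis using positive_eigenvalues unfolding positive_eigenvalues_def by blast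
  qed
  have dil: "dilation A r (P p) = P (diag_dilation \<nu> r p)" if "r > 0" for r p
    using that by (simp add: dilation_eigenbasis[OF P(1) A AP] diag_dilation_def powr_def mult.commute)
  have iso_j: "lie_algebra_iso atlas j"
    using lie_algebra_iso bij_betw_trans[OF P(2), of \<iota> "lie_algebra atlas"]
    by (simp add: lie_algebra_iso_def j_def[abs_def] o_def linear_add[OF P(1)] linear_cmul[OF P(1)])
  have exp_j: "exponential_map atlas j e"
    using exponential_map by (simp add: exponential_map_def j_def e_def linear_cmul[OF P(1)])
  have cont_e: "continuous_on UNIV e"
    unfolding e_def by (intro continuous_on_compose2[OF X.cont_e linear_continuous_on[OF bP(1)]]) auto
  have "smooth_on (\<lambda>v. \<phi> (e v)) (e -` U)" if U: "(U, \<phi>) \<in> atlas" for U \<phi>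
    unfolding e_def
  proof (rule smooth_on_compose[OF _ _ X.smooth_e[OF U]])
    show op: "open ((\<lambda>p. expo (P p)) -` U)"
      using cont_e X.open_chart(1)[OF U] by (simp add: open_vimage e_def[abs_def])
    show "smooth_on P ((\<lambda>p. expo (P p)) -` U)" by (rule smooth_on_linear[OF op bP(1)])
  qed auto
  moreover have "smooth_fun atlas (inv e)"
    unfolding smooth_fun_def
  proof (clarify)
    fix U \<phi> assume U: "(U, \<phi>) \<in> atlas"
    have s: "smooth_on (\<lambda>p. inv expo (inv_into U \<phi> p)) (\<phi> ` U)"
      using X.smooth_inv_e U by (auto simp: smooth_fun_def)
    have "smooth_on (\<lambda>p. inv P (inv expo (inv_into U \<phi> p))) (\<phi> ` U)"
      by (rule smooth_on_compose[OF X.open_chart(2)[OF U] s smooth_on_linear[OF open_UNIV bP(2)]]) auto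
    then show "smooth_on (\<lambda>p. inv e (inv_into U \<phi> p)) (\<phi> ` U)" by (simp only: inv_e)
  qed
  ultimately have diffeo_e: "diffeo_from_euclidean atlas e"
    using bij_e cont_e by (auto simp: diffeo_from_euclidean_def)
  have br: "P (lie_bracket j u v) = lie_bracket \<iota> (P u) (P v)" for u v
  proof -
    have "inj j" using iso_j by (auto simp: lie_algebra_iso_def bij_betw_def)
    moreover have "j (inv P (lie_bracket \<iota> (P u) (P v))) = commutator (j u) (j v)"
      by (simp add: j_def inv X.j_br)
    ultimately have "lie_bracket j u v = inv P (lie_bracket \<iota> (P u) (P v))"
      unfolding lie_bracket_def[of j] by (rule inv_f_eq)
    then show ?thesis by (simp add: inv)
  qed
  have bd: "lie_bracket j (diag_dilation \<nu> r u) (diag_dilation \<nu> r v) = diag_dilation \<nu> r (lie_bracket j u v)"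
    if r: "r > 0" for r u v
  proof -
    have "P (lie_bracket j (diag_dilation \<nu> r u) (diag_dilation \<nu> r v))
        = lie_bracket \<iota> (dilation A r (P u)) (dilation A r (P v))" by (simp add: br dil[OF r])
    also have "\<dots> = dilation A r (P (lie_bracket j u v))"
      using dilation_morphism[OF r] by (simp add: lie_algebra_morphism_def br)
    also have "\<dots> = P (diag_dilation \<nu> r (lie_bracket j u v))" by (rule dil[OF r])
    finally show ?thesis by (simp only: injP)
  qed
  have graded: "graded_coordinates atlas j e \<nu>"
    by unfold_locales (fact iso_j exp_j diffeo_e \<nu> bd)+
  interpret Y: graded_coordinates atlas j e \<nu> by (rule graded)
  have dil_e: "group_dilation expo A r (e p) = e (diag_dilation \<nu> r p)" if "r > 0" for r p
    by (simp add: group_dilation_def e_def dil[OF that])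
  have "dilation A r 0 = 0" for r
    using dilation_eigenbasis[OF P(1) A AP, of r 0] linear_0[OF P(1)] by (simp add: flip: zero_vec_def)
  then have dil_0: "group_dilation expo A r 0 = 0" for r
    by (simp add: group_dilation_def)
  have Q\<nu>: "Q = (\<Sum>i\<in>UNIV. \<nu> i)" unfolding Q by (rule homogeneous_dim_eigenbasis[OF P A AP])
  have hom: "homogeneous_function \<nu> (\<lambda>p. N (e p)) Q"
  proof
    have n: "continuous_on UNIV N" "N x \<ge> 0" "N x = 0 \<longleftrightarrow> x = 0"
      "r > 0 \<Longrightarrow> N (group_dilation expo A r x) = r * N x" for x r
      using N by (simp_all add: homogeneous_quasi_norm_def)
    show "\<nu> i > 0" for i by (rule \<nu>)
    show "continuous_on UNIV (\<lambda>p. N (e p))" by (rule continuous_on_compose2[OF n(1) cont_e]) auto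
    show "N (e p) > 0" if "p \<noteq> 0" for p
    proof -
      have "e p \<noteq> e 0" unfolding inj_eq[OF bij_is_inj[OF bij_e]] by (rule that)
      then show ?thesis using n(2,3)[of "e p"] by simp
    qed
    show "N (e 0) = 0" using n(3) by simp
    show "N (e (flow \<nu> t p)) = exp t * N (e p)" for t p
      using n(4)[of "exp t" "e p"] by (simp add: flow_def dil_e)
    show "Q = (\<Sum>i\<in>UNIV. \<nu> i)" by (rule Q\<nu>)
    \<comment> \<open>The index type is nonempty, so the normalisation \<open>dim_le\<close> yields
      the lower bound on \<open>Q\<close> under which Hardy's inequality is proved.\<close>
    have "1 \<le> real CARD('n)" by (simp add: Suc_leI)
    then show "Q \<ge> 1" using dim_le Q by linarith
  qed
  have "homogeneous_coordinates atlas j e \<nu> expo A N Q"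
    using graded homogeneous_coordinates_axioms.intro[OF dil_e dil_0 hom]
    by (rule homogeneous_coordinates.intro)
  then show ?thesis by (rule that)
qed

theorem theorem4p1:
  fixes atlas :: "('g::{topological_group_add, t2_space, second_countable_topology}, 'n::finite) chart set"
    and \<iota> :: "real^'n \<Rightarrow> 'g vfield"
    and expo :: "real^'n \<Rightarrow> 'g"
    and A :: "real^'n \<Rightarrow> real^'n"
    and M :: "'g measure"
    and N :: "'g \<Rightarrow> real"
    and Q R :: real
  assumes "homogeneous_group atlas \<iota> expo A"
    and "Q = homogeneous_dim A"
    and "haar_measure M"
    and "homogeneous_quasi_norm expo A N"
    and "R > 0"
  shows "(\<forall>f \<in> test_functions atlas (quasi_ball N R - {0}).
            (\<integral>\<^sup>+x\<in>quasi_ball N R. ennreal (cmod (f x) powr Q / N x powr Q) \<partial>M)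
            \<le> ennreal (Q powr Q) *
              (\<integral>\<^sup>+x\<in>quasi_ball N R.
                 ennreal (cmod (of_real (ln (N x)) * radial_derivative expo A N f x) powr Q) \<partial>M))
       \<and> (\<forall>C::real.
            (\<forall>f \<in> test_functions atlas (quasi_ball N R - {0}).
               (\<integral>\<^sup>+x\<in>quasi_ball N R. ennreal (cmod (f x) powr Q / N x powr Q) \<partial>M)
               \<le> ennreal C *
                 (\<integral>\<^sup>+x\<in>quasi_ball N R.
                    ennreal (cmod (of_real (ln (N x)) * radial_derivative expo A N f x) powr Q) \<partial>M))
            \<longrightarrow> Q powr Q \<le> C)"
proof -
  obtain j e \<nu> where "homogeneous_coordinates atlas j e \<nu> expo A N Q"
    using homogeneous_group_coordinates[OF assms(1,2,4)] .
  then interpret homogeneous_coordinates atlas j e \<nu> expo A N Q .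
  obtain c where c: "c \<noteq> 0" "c \<noteq> \<infinity>" and M': "\<forall>F. (\<lambda>p. F (e p)) \<in> borel_measurable borel \<longrightarrow>
      (\<integral>\<^sup>+x. F x \<partial>M) = c * (\<integral>\<^sup>+p. F (e p) \<partial>lborel)"
    by (rule haar_measure_coordinates[OF assms(3)])
  note M = M'[rule_format]
  show ?thesis
  proof (intro conjI ballI allI impI)
    fix f assume "f \<in> test_functions atlas (quasi_ball N R - {0})"
    from hardy_inequality[OF M this]
    show "(\<integral>\<^sup>+x\<in>quasi_ball N R. ennreal (cmod (f x) powr Q / N x powr Q) \<partial>M)
            \<le> ennreal (Q powr Q) *
              (\<integral>\<^sup>+x\<in>quasi_ball N R.
                 ennreal (cmod (of_real (ln (N x)) * radial_derivative expo A N f x) powr Q) \<partial>M)" .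
  next
    fix C
    assume "\<forall>f \<in> test_functions atlas (quasi_ball N R - {0}).
               (\<integral>\<^sup>+x\<in>quasi_ball N R. ennreal (cmod (f x) powr Q / N x powr Q) \<partial>M)
               \<le> ennreal C *
                 (\<integral>\<^sup>+x\<in>quasi_ball N R.
                    ennreal (cmod (of_real (ln (N x)) * radial_derivative expo A N f x) powr Q) \<partial>M)"
    then show "Q powr Q \<le> C"
      by (intro hardy_constant_sharp[OF M c assms(5)]) auto
  qed
qed

end
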